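(* Let $A$ be a finite alphabet, let $u \in A^{\mathbb N}$ be an infinite word, and let $\pi$ be a linear projection from $\mathbb R^A$ onto a hyperplane $\mathcal P$ of $\mathbb R^A$. Assume that: (i) $\pi(\mathbb Z^A)$ is dense in $\mathcal P$; (ii) $\pi(D_u)$ is bounded; (iii) the subshift $(\overline{S^{\mathbb N}u},S)$ is minimal; (iv) for every $a\in A$ the boundary of $\overline{\pi(D_{u,a})}$ has zero Lebesgue measure; (v) the union $\overline{\pi(D_u)}=\bigcup_{a\in A}\overline{\pi(D_{u,a})}$ is disjoint in Lebesgue measure. Then there exist a $\sigma$-algebra on $\overline{S^{\mathbb N}u}$ and an $S$-invariant measure $\mu$ on it such that $(\overline{S^{\mathbb N}u},S,\mu)$ is a finite extension of the translation on the torus $(\mathcal P/\pi(\Gamma_0),T,\lambda)$, where $T$ is the translation by $\pi(e_a)$ (for any $a\in A$; it does not depend on $a$) and $\lambda$ is the Lebesgue measure. Moreover this extension map is also a topological semi-conjugacy from $(\overline{S^{\mathbb N}u},S)$ to $(\mathcal P/\pi(\Gamma_0),T)$. If moreover the union $\bigcup_{t\in\pi(\Gamma_0)}\left(\overline{\pi(D_u)}+t\right)=\mathcal P$ is disjoint in Lebesgue measure, then the subshift $(\overline{S^{\mathbb N}u},S,\mu)$ is uniquely ergodic and is (measurably) isomorphic to the translation on the torus $(\mathcal P/\pi(\Gamma_0),T,\lambda)$ and to a domain exchange on $\overline{\pi(D_u)}$.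
   Context: $S:A^{\mathbb N}\to A^{\mathbb N}$, $(u_i)_i\mapsto(u_{i+1})_i$ is the shift; $A^{\mathbb N}$ carries the usual (product) topology; $S^{\mathbb N}u=\{S^nu: n\in\mathbb N\}$, and the subshift generated by $u$ is $(\overline{S^{\mathbb N}u},S)$. For a finite word $v$, $\mathrm{Ab}(v)=(|v|_a)_{a\in A}\in\mathbb N^A$ where $|v|_a$ is the number of occurrences of $a$ in $v$; $(e_a)_{a\in A}$ is the canonical basis of $\mathbb R^A$. The discrete line of $u$ is $D_u=\{\mathrm{Ab}(v): v \text{ finite prefix of } u\}$, and $D_{u,a}=\{\mathrm{Ab}(v): va \text{ finite prefix of } u\}$ for $a\in A$. $\Gamma_0$ is the subgroup of $\mathbb Z^A$ generated by $\{e_a-e_b: a,b\in A\}$. A union is disjoint in Lebesgue measure if the pairwise intersections of its distinct members (indexed by distinct indices) have zero Lebesgue measure. A system is a finite extension of another if there is a measurable factor map onto the latter which is almost everywhere $m$-to-one for some fixed finite $m$. A topological semi-conjugacy is a continuous surjective map intertwining the two dynamics. The domain exchange on $\overline{\pi(D_u)}$ is the Lebesgue-almost everywhere defined map $x\mapsto x+\pi(e_a)$ for $x\in\overline{\pi(D_{u,a})}$, with $\overline{\pi(D_u)}$ endowed with Lebesgue measure. *)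

theory Defs
  imports
    "HOL-Probability.Probability"
    "HOL-Computational_Algebra.Group_Closure"
begin

section \<open>Infinite words, subshifts, discrete lines\<close>

definition is_prefix :: "'a list \<Rightarrow> (nat \<Rightarrow> 'a) \<Rightarrow> bool" where
  "is_prefix v u \<longleftrightarrow> v = map u [0..<length v]"

definition word_shift :: "(nat \<Rightarrow> 'a) \<Rightarrow> (nat \<Rightarrow> 'a)" where
  "word_shift u = (\<lambda>i. u (Suc i))"

definition word_topology :: "(nat \<Rightarrow> 'a) topology" where
  "word_topology = product_topology (\<lambda>_. discrete_topology UNIV) UNIV"

definition subshift :: "(nat \<Rightarrow> 'a) \<Rightarrow> (nat \<Rightarrow> 'a) topology" where
  "subshift u = subtopology word_topology (word_topology closure_of {(word_shift ^^ n) u | n. True})"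

definition Ab :: "'a list \<Rightarrow> real ^ 'a::finite" where
  "Ab v = (\<chi> a. real (count_list v a))"

abbreviation unit_vec :: "'a \<Rightarrow> real ^ 'a::finite" where
  "unit_vec a \<equiv> axis a 1"

definition discrete_line :: "(nat \<Rightarrow> 'a) \<Rightarrow> (real ^ 'a::finite) set" where
  "discrete_line u = {Ab v | v. is_prefix v u}"

definition discrete_line_letter :: "(nat \<Rightarrow> 'a) \<Rightarrow> 'a \<Rightarrow> (real ^ 'a::finite) set" where
  "discrete_line_letter u a = {Ab v | v. is_prefix (v @ [a]) u}"

definition integer_vectors :: "(real ^ 'a::finite) set" where
  "integer_vectors = {x. \<forall>a. x $ a \<in> \<int>}"

definition Gamma0 :: "(real ^ 'a::finite) set" where
  "Gamma0 = group_closure {unit_vec a - unit_vec b | a b. True}"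

definition projection_onto_hyperplane ::
    "(real ^ 'a \<Rightarrow> real ^ 'a) \<Rightarrow> (real ^ 'a::finite) set \<Rightarrow> bool" where
  "projection_onto_hyperplane \<pi> P \<longleftrightarrow>
     linear \<pi> \<and> range \<pi> = P \<and> (\<forall>x\<in>P. \<pi> x = x) \<and> Suc (dim P) = CARD('a)"


section \<open>Lebesgue measure on a linear subspace\<close>

definition is_orthonormal_basis :: "'e::euclidean_space set \<Rightarrow> 'e set \<Rightarrow> bool" where
  "is_orthonormal_basis P B \<longleftrightarrow>
     B \<subseteq> P \<and> span B = P \<and> pairwise orthogonal B \<and> (\<forall>b\<in>B. norm b = 1)"

text \<open>The construction of \<^const>\<open>lborel\<close>, with an orthonormal basis of the subspace \<open>P\<close> in place of
  the standard basis. The result does not depend on the basis chosen; on \<open>P = {0}\<close> it is the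
  Dirac measure.\<close>

definition lborel_subspace :: "'e::euclidean_space set \<Rightarrow> 'e measure" where
  "lborel_subspace P = (let B = (SOME B. is_orthonormal_basis P B) in
     distr (\<Pi>\<^sub>M b\<in>B. lborel) (restrict_space borel P) (\<lambda>f. \<Sum>b\<in>B. f b *\<^sub>R b))"

definition disjoint_in_measure :: "'e measure \<Rightarrow> 'i set \<Rightarrow> ('i \<Rightarrow> 'e set) \<Rightarrow> bool" where
  "disjoint_in_measure M I F \<longleftrightarrow> pairwise (\<lambda>i j. F i \<inter> F j \<in> null_sets M) I"


section \<open>Dynamical systems\<close>

definition borel_of :: "'x topology \<Rightarrow> 'x measure" where
  "borel_of X = sigma (topspace X) {U. openin X U}"

definition minimal_system :: "'x topology \<Rightarrow> ('x \<Rightarrow> 'x) \<Rightarrow> bool" where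
  "minimal_system X T \<longleftrightarrow>
     (\<forall>C. closedin X C \<and> C \<noteq> {} \<and> T ` C \<subseteq> C \<longrightarrow> C = topspace X)"

definition semi_conjugacy ::
    "'x topology \<Rightarrow> ('x \<Rightarrow> 'x) \<Rightarrow> 'y topology \<Rightarrow> ('y \<Rightarrow> 'y) \<Rightarrow> ('x \<Rightarrow> 'y) \<Rightarrow> bool" where
  "semi_conjugacy X S Y T \<phi> \<longleftrightarrow>
     continuous_map X Y \<phi> \<and> \<phi> ` topspace X = topspace Y \<and>
     (\<forall>x\<in>topspace X. \<phi> (S x) = T (\<phi> x))"

definition measure_preserving :: "'x measure \<Rightarrow> 'y measure \<Rightarrow> ('x \<Rightarrow> 'y) \<Rightarrow> bool" where
  "measure_preserving \<mu> \<nu> f \<longleftrightarrow> f \<in> measurable \<mu> \<nu> \<and> distr \<mu> \<nu> f = \<nu>"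

definition invariant_borel_probability :: "'x topology \<Rightarrow> ('x \<Rightarrow> 'x) \<Rightarrow> 'x measure \<Rightarrow> bool" where
  "invariant_borel_probability X T \<mu> \<longleftrightarrow>
     sets \<mu> = sets (borel_of X) \<and> prob_space \<mu> \<and> measure_preserving \<mu> \<mu> T"

definition uniquely_ergodic :: "'x topology \<Rightarrow> ('x \<Rightarrow> 'x) \<Rightarrow> 'x measure \<Rightarrow> bool" where
  "uniquely_ergodic X T \<mu> \<longleftrightarrow>
     invariant_borel_probability X T \<mu> \<and>
     (\<forall>\<nu>. invariant_borel_probability X T \<nu> \<longrightarrow> \<nu> = \<mu>)"

definition factor_map ::
    "'x measure \<Rightarrow> ('x \<Rightarrow> 'x) \<Rightarrow> 'y measure \<Rightarrow> ('y \<Rightarrow> 'y) \<Rightarrow> ('x \<Rightarrow> 'y) \<Rightarrow> bool" where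
  "factor_map \<mu> S \<nu> T \<phi> \<longleftrightarrow>
     measure_preserving \<mu> \<nu> \<phi> \<and> \<phi> ` space \<mu> = space \<nu> \<and> (AE x in \<mu>. \<phi> (S x) = T (\<phi> x))"

text \<open>Since \<^const>\<open>card\<close> is \<open>0\<close> on infinite sets, \<open>m > 0\<close> makes the fibres finite.\<close>

definition finite_extension_map ::
    "'x measure \<Rightarrow> ('x \<Rightarrow> 'x) \<Rightarrow> 'y measure \<Rightarrow> ('y \<Rightarrow> 'y) \<Rightarrow> ('x \<Rightarrow> 'y) \<Rightarrow> bool" where
  "finite_extension_map \<mu> S \<nu> T \<phi> \<longleftrightarrow>
     factor_map \<mu> S \<nu> T \<phi> \<and> (\<exists>m>0. AE y in \<nu>. card {x \<in> space \<mu>. \<phi> x = y} = m)"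

definition measurably_isomorphic ::
    "'x measure \<Rightarrow> ('x \<Rightarrow> 'x) \<Rightarrow> 'y measure \<Rightarrow> ('y \<Rightarrow> 'y) \<Rightarrow> bool" where
  "measurably_isomorphic \<mu> S \<nu> T \<longleftrightarrow>
     (\<exists>X0 Y0 \<psi>. X0 \<in> sets \<mu> \<and> space \<mu> - X0 \<in> null_sets \<mu> \<and> S ` X0 \<subseteq> X0 \<and>
        Y0 \<in> sets \<nu> \<and> space \<nu> - Y0 \<in> null_sets \<nu> \<and> T ` Y0 \<subseteq> Y0 \<and>
        bij_betw \<psi> X0 Y0 \<and>
        measure_preserving (restrict_space \<mu> X0) (restrict_space \<nu> Y0) \<psi> \<and>
        measure_preserving (restrict_space \<nu> Y0) (restrict_space \<mu> X0) (the_inv_into X0 \<psi>) \<and>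
        (\<forall>x\<in>X0. \<psi> (S x) = T (\<psi> x)))"


section \<open>The torus \<open>P / L\<close>\<close>

definition coset :: "'e::euclidean_space set \<Rightarrow> 'e \<Rightarrow> 'e set" where
  "coset L x = (\<lambda>t. x + t) ` L"

definition torus :: "'e::euclidean_space set \<Rightarrow> 'e set \<Rightarrow> 'e set topology" where
  "torus P L = topology (\<lambda>U. U \<subseteq> coset L ` P \<and> openin (top_of_set P) {x \<in> P. coset L x \<in> U})"

lemma openin_torus:
  "openin (torus P L) U \<longleftrightarrow>
     U \<subseteq> coset L ` P \<and> openin (top_of_set P) {x \<in> P. coset L x \<in> U}"
proof -
  have "istopology (\<lambda>U. U \<subseteq> coset L ` P \<and> openin (top_of_set P) {x \<in> P. coset L x \<in> U})"
    unfolding istopology_def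
  proof (intro conjI allI impI)
    fix S T :: "'a set set"
    assume "S \<subseteq> coset L ` P \<and> openin (top_of_set P) {x \<in> P. coset L x \<in> S}"
      and "T \<subseteq> coset L ` P \<and> openin (top_of_set P) {x \<in> P. coset L x \<in> T}"
    moreover have "{x \<in> P. coset L x \<in> S \<inter> T} = {x \<in> P. coset L x \<in> S} \<inter> {x \<in> P. coset L x \<in> T}"
      by blast
    ultimately show "S \<inter> T \<subseteq> coset L ` P"
      and "openin (top_of_set P) {x \<in> P. coset L x \<in> S \<inter> T}"
      by (auto intro: openin_Int)
  next
    fix \<K> :: "'a set set set"
    assume *: "\<forall>K\<in>\<K>. K \<subseteq> coset L ` P \<and> openin (top_of_set P) {x \<in> P. coset L x \<in> K}"
    then show "\<Union>\<K> \<subseteq> coset L ` P" by blast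
    have "{x \<in> P. coset L x \<in> \<Union>\<K>} = (\<Union>K\<in>\<K>. {x \<in> P. coset L x \<in> K})" by blast
    with * show "openin (top_of_set P) {x \<in> P. coset L x \<in> \<Union>\<K>}" by auto
  qed
  then show ?thesis by (simp add: torus_def topology_inverse')
qed

lemma topspace_torus: "topspace (torus P L) = coset L ` P"
proof -
  have "{x \<in> P. coset L x \<in> coset L ` P} = P" by blast
  then have "openin (torus P L) (coset L ` P)" by (simp add: openin_torus)
  then show ?thesis
    unfolding topspace_def by (auto simp: openin_torus)
qed

definition is_fundamental_domain :: "'e::euclidean_space set \<Rightarrow> 'e set \<Rightarrow> 'e set \<Rightarrow> bool" where
  "is_fundamental_domain P L F \<longleftrightarrow>
     F \<subseteq> P \<and> F \<in> sets borel \<and> (\<forall>x\<in>P. \<exists>!t. t \<in> L \<and> x - t \<in> F)"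

text \<open>Lebesgue measure of the torus, normalised to total mass \<open>1\<close>, for a lattice \<open>L\<close> of \<open>P\<close>. The
  result does not depend on the fundamental domain chosen.\<close>

definition torus_lebesgue :: "'e::euclidean_space set \<Rightarrow> 'e set \<Rightarrow> 'e set measure" where
  "torus_lebesgue P L =
     distr (uniform_measure (lborel_subspace P) (SOME F. is_fundamental_domain P L F))
       (borel_of (torus P L)) (coset L)"


section \<open>The domain exchange\<close>

text \<open>The point \<open>x\<close> is left fixed when it lies in several (or none) of the pieces; the set of such
  \<open>x\<close> in \<open>closure (\<pi> ` discrete_line u)\<close> is null as soon as the pieces are disjoint in measure.\<close>

definition domain_exchange ::
    "(real ^ 'a \<Rightarrow> real ^ 'a) \<Rightarrow> (nat \<Rightarrow> 'a) \<Rightarrow> real ^ 'a::finite \<Rightarrow> real ^ 'a" where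
  "domain_exchange \<pi> u x =
     (if \<exists>!a. x \<in> closure (\<pi> ` discrete_line_letter u a)
      then x + \<pi> (unit_vec (THE a. x \<in> closure (\<pi> ` discrete_line_letter u a)))
      else x)"

lemma closure_discrete_line:
  "closure (\<pi> ` discrete_line u) = (\<Union>a. closure (\<pi> ` discrete_line_letter u a))"
proof -
  have "is_prefix v u \<longleftrightarrow> is_prefix (v @ [u (length v)]) u" for v
    by (simp add: is_prefix_def)
  moreover have "is_prefix (v @ [a]) u \<Longrightarrow> is_prefix v u" for v a
    by (simp add: is_prefix_def)
  ultimately have "discrete_line u = (\<Union>a. discrete_line_letter u a)"
    unfolding discrete_line_def discrete_line_letter_def by blast
  then have *: "\<pi> ` discrete_line u = (\<Union>a. \<pi> ` discrete_line_letter u a)"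
    by (simp add: image_UN)
  show ?thesis
  proof (rule antisym)
    show "closure (\<pi> ` discrete_line u) \<subseteq> (\<Union>a. closure (\<pi> ` discrete_line_letter u a))"
      unfolding * by (intro closure_minimal closed_UN UN_mono closure_subset) auto
    show "(\<Union>a. closure (\<pi> ` discrete_line_letter u a)) \<subseteq> closure (\<pi> ` discrete_line u)"
      unfolding * by (intro UN_least closure_mono) auto
  qed
qed

text \<open>Normalised Lebesgue measure on a subset \<open>R\<close> of \<open>P\<close>, as a measure with space \<open>R\<close>.\<close>

definition normalized_lebesgue_on :: "'e::euclidean_space set \<Rightarrow> 'e set \<Rightarrow> 'e measure" where
  "normalized_lebesgue_on P R = restrict_space (uniform_measure (lborel_subspace P) R) R"

end

theory Submission
  imports Defs
begin

text \<open>
  Since \<open>\<pi> ` discrete_line u\<close> is bounded and the subshift is minimal, the cocycle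
  \<open>x \<mapsto> \<pi> (unit_vec (x 0))\<close> is the coboundary of a continuous map \<open>position\<close> from the subshift onto \<open>R\<close>,
  which carries the cylinder of the letter \<open>a\<close> onto the piece of \<open>a\<close>. Modulo \<open>L\<close> it is the semi-conjugacy
  onto the torus. Outside a null set the pieces are disjoint, so a point of \<open>R\<close> determines
  the letters of its preimage one after another: \<open>position\<close> is injective there, and \<open>\<mu>\<close> is Lebesgue
  measure on \<open>R\<close> pulled back by it.

  The image under \<open>position\<close> of any invariant probability, summed over all its translates by \<open>L\<close>, is
  invariant under the dense group \<open>\<pi> ` integer_vectors\<close>; by semicontinuity and Fubini it is a multiple of
  Lebesgue measure that does not depend on the probability. For \<open>\<mu>\<close> this says that the number of points
  of \<open>R\<close> in a coset of \<open>L\<close> is almost everywhere constant, which gives the finite extension. If the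
  translates of \<open>R\<close> tile, it forces the image of every invariant probability to be normalised Lebesgue
  measure on \<open>R\<close>, whence unique ergodicity.
\<close>

section \<open>Borel measures of topologies and measurable isomorphisms\<close>

text \<open>Density of the projected integer vectors enters twice: it makes \<open>\<pi>\<close>
  injective on the hyperplane \<open>coord_sum x = 0\<close>, whence \<open>L\<close> is discrete,
  and it makes the translation on the torus minimal. Finite covolume of \<open>L\<close> is not
  computed from a basis: the compact set \<open>R\<close> meets every coset, which bounds the
  measure of a fundamental domain by that of \<open>R\<close>.

  Measures are compared on \<open>P\<close> rather than on the quotient. The counting function
  \<open>hits A\<close> stands for a function on the torus and makes Fatou, Fubini and translation
  invariance directly available; a fundamental domain enters only through its measure and through
  the value \<open>1\<close> of its own count. The obstacle is that different letters translate by
  different vectors, so \<open>position\<close> is not equivariant for a single translation of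
  \<open>P\<close>; these vectors agree modulo \<open>L\<close>, and \<open>hits\<close> does not
  see the difference.

  The null sets of bad points are saturated under all projected integer vectors, so discarding them
  never cuts an orbit. The inverse of \<open>position\<close> is Borel because
  \<open>position\<close> maps closed subsets of the compact subshift to compact sets.\<close>

lemma space_borel_of: "space (borel_of X) = topspace X"
  unfolding borel_of_def by (rule space_measure_of) (auto dest: openin_subset)

lemma sets_borel_of: "sets (borel_of X) = sigma_sets (topspace X) {U. openin X U}"
  unfolding borel_of_def by (rule sets_measure_of) (auto dest: openin_subset)

lemma borel_of_open: "openin X U \<Longrightarrow> U \<in> sets (borel_of X)"
  by (simp add: sets_borel_of)

lemma borel_of_closed:
  assumes "closedin X C"
  shows "C \<in> sets (borel_of X)"
proof -
  have "topspace X - (topspace X - C) \<in> sets (borel_of X)"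
    using assms sets.compl_sets[of "topspace X - C" "borel_of X"]
    by (simp add: borel_of_open space_borel_of closedin_def)
  then show ?thesis
    using closedin_subset[OF assms] by (simp add: double_diff)
qed

text \<open>Testing on closed sets suffices, and in a compact space these are compact;
  \<open>coding_measurable\<close> computes preimages this way.\<close>

lemma measurable_borel_ofI:
  assumes "f \<in> space M \<rightarrow> topspace X"
    and "\<And>C. closedin X C \<Longrightarrow> f -` C \<inter> space M \<in> sets M"
  shows "f \<in> measurable M (borel_of X)"
  unfolding borel_of_def
proof (rule measurable_measure_of)
  fix U assume U: "U \<in> {U. openin X U}"
  have "f -` U \<inter> space M = space M - (f -` (topspace X - U) \<inter> space M)"
    using assms(1) openin_subset[of X U] U by auto
  then show "f -` U \<inter> space M \<in> sets M"
    using assms(2)[of "topspace X - U"] U by auto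
qed (use assms(1) openin_subset in auto)

lemma continuous_map_measurable_borel_of:
  assumes "continuous_map X Y f"
  shows "f \<in> measurable (borel_of X) (borel_of Y)"
  using assms
  by (intro measurable_borel_ofI)
     (auto simp: space_borel_of continuous_map_closedin Int_def vimage_def conj_commute
           intro!: borel_of_closed)

lemma continuous_map_measurable_borel:
  fixes f :: "'x \<Rightarrow> 'y::topological_space"
  assumes "continuous_map X euclidean f"
  shows "f \<in> measurable (borel_of X) borel"
proof (rule borel_measurableI)
  fix U :: "'y set" assume "open U"
  then have "openin X {x \<in> topspace X. f x \<in> U}"
    using assms by (simp add: openin_continuous_map_preimage)
  then show "f -` U \<inter> space (borel_of X) \<in> sets (borel_of X)"
    by (auto simp: space_borel_of Int_def vimage_def conj_commute intro: borel_of_open)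
qed

text \<open>That the inverse preserves measure is automatic: the restriction of \<open>N\<close> to
  \<open>Y0\<close> is the image of that of \<open>M\<close> to \<open>X0\<close>, and pushing it
  back returns the latter. Only measurability of the inverse must be supplied, in the form
  \<open>img\<close>.\<close>

lemma measurably_isomorphicI:
  assumes f: "measure_preserving M N f"
    and X0: "X0 \<in> sets M" "space M - X0 \<in> null_sets M" "S ` X0 \<subseteq> X0"
    and Y0: "Y0 \<in> sets N" "space N - Y0 \<in> null_sets N" "T ` Y0 \<subseteq> Y0"
    and bij: "bij_betw f X0 Y0"
    and img: "\<And>V. V \<in> sets M \<Longrightarrow> V \<subseteq> X0 \<Longrightarrow> f ` V \<in> sets N"
    and eqv: "\<And>x. x \<in> X0 \<Longrightarrow> f (S x) = T (f x)"
  shows "measurably_isomorphic M S N T"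
proof -
  have fm[measurable]: "f \<in> measurable M N" and fd: "distr M N f = N"
    using f by (auto simp: measure_preserving_def)
  have X0s: "X0 \<subseteq> space M" and Y0s: "Y0 \<subseteq> space N"
    using X0 Y0 by (auto dest: sets.sets_into_space)
  have inj: "inj_on f X0" and fX0: "f ` X0 = Y0"
    using bij by (auto simp: bij_betw_def)
  let ?MX = "restrict_space M X0" and ?NY = "restrict_space N Y0"
  have spX: "space ?MX = X0" and spY: "space ?NY = Y0"
    using X0s Y0s by (auto simp: space_restrict_space)
  have f0: "f \<in> measurable ?MX ?NY"
    using fX0 X0s by (intro measurable_restrict_space3) auto
  have meas0: "emeasure M (f -` B \<inter> X0) = emeasure N B" if "B \<in> sets N" "B \<subseteq> Y0" for B
  proof -
    have "emeasure N B = emeasure M (f -` B \<inter> space M)"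
      using that fd by (metis emeasure_distr fm)
    also have "\<dots> = emeasure M ((f -` B \<inter> space M) - (space M - X0))"
      using X0 that by (intro emeasure_Diff_null_set[symmetric]) auto
    also have "(f -` B \<inter> space M) - (space M - X0) = f -` B \<inter> X0"
      using X0s by auto
    finally show ?thesis by simp
  qed
  have pres1: "distr ?MX ?NY f = ?NY"
  proof (rule measure_eqI)
    fix B assume "B \<in> sets (distr ?MX ?NY f)"
    then have B: "B \<in> sets N" "B \<subseteq> Y0"
      using Y0 Y0s by (auto simp: sets_restrict_space_iff)
    have "emeasure (distr ?MX ?NY f) B = emeasure ?MX (f -` B \<inter> X0)"
      using f0 B Y0 Y0s by (subst emeasure_distr) (auto simp: sets_restrict_space_iff spX)
    also have "\<dots> = emeasure M (f -` B \<inter> X0)"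
      using X0 X0s by (subst emeasure_restrict_space) auto
    also have "\<dots> = emeasure ?NY B"
      using B Y0 Y0s by (subst emeasure_restrict_space) (auto simp: meas0)
    finally show "emeasure (distr ?MX ?NY f) B = emeasure ?NY B" .
  qed simp
  let ?h = "the_inv_into X0 f"
  have h_range: "?h y \<in> X0" "f (?h y) = y" if "y \<in> Y0" for y
    using that fX0 inj by (auto simp: the_inv_into_into f_the_inv_into_f)
  have hpre: "?h -` V \<inter> Y0 = f ` V" if "V \<subseteq> X0" for V
    using that fX0 inj by (force simp: the_inv_into_f_f subset_iff image_iff)
  have h0: "?h \<in> measurable ?NY ?MX"
  proof (rule measurableI)
    fix V assume "V \<in> sets ?MX"
    then have V: "V \<in> sets M" "V \<subseteq> X0"
      using X0 X0s by (auto simp: sets_restrict_space_iff)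
    then have "f ` V \<in> sets N" "f ` V \<subseteq> Y0"
      using img fX0 by auto
    then show "?h -` V \<inter> space ?NY \<in> sets ?NY"
      using V Y0 Y0s hpre by (simp add: spY sets_restrict_space_iff)
  qed (use h_range spX spY in auto)
  have pres2: "distr ?NY ?MX ?h = ?MX"
  proof -
    have "distr ?NY ?MX ?h = distr (distr ?MX ?NY f) ?MX ?h"
      by (simp add: pres1)
    also have "\<dots> = distr ?MX ?MX (?h \<circ> f)"
      using h0 f0 by (rule distr_distr)
    also have "\<dots> = distr ?MX ?MX (\<lambda>x. x)"
      using inj by (intro distr_cong) (auto simp: spX the_inv_into_f_f)
    finally show ?thesis by (simp add: distr_id)
  qed
  show ?thesis
    unfolding measurably_isomorphic_def measure_preserving_def
    using X0 Y0 bij f0 pres1 h0 pres2 eqv by blast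
qed

section \<open>Lebesgue measure on a subspace\<close>

locale euclidean_subspace =
  fixes P :: "'e::euclidean_space set"
  assumes subspace_P: "subspace P"
begin

abbreviation \<Lambda> :: "'e measure" where "\<Lambda> \<equiv> lborel_subspace P"

lemma P_borel [measurable, simp]: "P \<in> sets borel"
  using closed_subspace[OF subspace_P] by simp

lemma P_add: "x \<in> P \<Longrightarrow> y \<in> P \<Longrightarrow> x + y \<in> P"
  and P_diff: "x \<in> P \<Longrightarrow> y \<in> P \<Longrightarrow> x - y \<in> P"
  and P_uminus: "x \<in> P \<Longrightarrow> - x \<in> P"
  and P_0: "0 \<in> P"
  using subspace_P by (auto simp: subspace_add subspace_diff subspace_neg subspace_0)

lemma sets_\<Lambda>: "sets \<Lambda> = sets (restrict_space borel P)"
  by (simp add: lborel_subspace_def Let_def)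

lemma sets_\<Lambda>_iff: "A \<in> sets \<Lambda> \<longleftrightarrow> A \<in> sets borel \<and> A \<subseteq> P"
  by (auto simp: sets_\<Lambda> sets_restrict_space_iff)

lemma space_\<Lambda> [simp]: "space \<Lambda> = P"
  by (simp add: lborel_subspace_def Let_def space_restrict_space)

lemma measurable_\<Lambda>I: "f \<in> measurable M borel \<Longrightarrow> f \<in> space M \<rightarrow> P \<Longrightarrow> f \<in> measurable M \<Lambda>"
  using measurable_cong_sets[OF refl sets_\<Lambda>, of M]
  by (auto simp: measurable_restrict_space2_iff)

lemma measurable_\<Lambda>_borel: "f \<in> measurable M \<Lambda> \<Longrightarrow> f \<in> measurable M borel"
  using measurable_cong_sets[OF refl sets_\<Lambda>, of M]
  by (simp add: measurable_restrict_space2_iff)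

lemma borel_measurable_\<Lambda>: "f \<in> measurable borel M \<Longrightarrow> f \<in> measurable \<Lambda> M"
  using measurable_cong_sets[OF sets_\<Lambda> refl, of M] by (simp add: measurable_restrict_space1)

text \<open>Unpacks the basis chosen inside \<open>lborel_subspace\<close>. Orthonormality makes the
  coordinates inner products, so questions about \<open>\<Lambda>\<close> become questions about a
  finite product of Lebesgue measures on the line.\<close>

lemma \<Lambda>_coordinates:
  obtains B where "finite B" "B \<subseteq> P" "\<And>b. b \<in> B \<Longrightarrow> norm b = 1"
    "\<Lambda> = distr (\<Pi>\<^sub>M b\<in>B. lborel) (restrict_space borel P) (\<lambda>f. \<Sum>b\<in>B. f b *\<^sub>R b)"
    "\<And>f b. b \<in> B \<Longrightarrow> (\<Sum>c\<in>B. f c *\<^sub>R c) \<bullet> b = f b"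
    "\<And>x. x \<in> P \<Longrightarrow> (\<Sum>b\<in>B. (x \<bullet> b) *\<^sub>R b) = x"
    "(\<lambda>f. \<Sum>b\<in>B. f b *\<^sub>R b) \<in> measurable (\<Pi>\<^sub>M b\<in>B. lborel) (restrict_space borel P)"
proof -
  define B where "B = (SOME B. is_orthonormal_basis P B)"
  have "\<exists>B. is_orthonormal_basis P B"
    using orthonormal_basis_subspace[OF subspace_P] unfolding is_orthonormal_basis_def by metis
  then have B: "is_orthonormal_basis P B"
    unfolding B_def by (rule someI_ex)
  then have BP: "B \<subseteq> P" and spB: "span B = P" and ort: "pairwise orthogonal B"
    and nrm: "\<And>b. b \<in> B \<Longrightarrow> norm b = 1"
    by (auto simp: is_orthonormal_basis_def)
  have finB: "finite B"
    using pairwise_orthogonal_imp_finite[OF ort] .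
  have inner_B: "b \<bullet> c = (if b = c then 1 else 0)" if "b \<in> B" "c \<in> B" for b c
    using that ort nrm by (auto simp: pairwise_def orthogonal_def norm_eq_1)
  have coord: "(\<Sum>c\<in>B. f c *\<^sub>R c) \<bullet> b = f b" if "b \<in> B" for f b
    using that finB by (simp add: inner_sum_left inner_B if_distrib cong: if_cong)
  have repr: "(\<Sum>b\<in>B. (x \<bullet> b) *\<^sub>R b) = x" if x: "x \<in> P" for x
  proof -
    obtain f where f: "x = (\<Sum>b\<in>B. f b *\<^sub>R b)"
      using x spB span_finite[OF finB] by auto
    show ?thesis
      unfolding f by (intro sum.cong refl) (simp add: coord)
  qed
  have "(\<lambda>f. \<Sum>b\<in>B. f b *\<^sub>R b) \<in> measurable (\<Pi>\<^sub>M b\<in>B. lborel) (restrict_space borel P)"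
  proof (rule measurable_restrict_space2)
    show "(\<lambda>f. \<Sum>b\<in>B. f b *\<^sub>R b) \<in> space (\<Pi>\<^sub>M b\<in>B. lborel) \<rightarrow> P"
      using BP subspace_P by (auto intro!: subspace_sum subspace_scale)
    have "(\<lambda>f. f b) \<in> borel_measurable (\<Pi>\<^sub>M b\<in>B. lborel)" if "b \<in> B" for b
      using measurable_component_singleton[OF that, of "\<lambda>_. lborel"] by simp
    then show "(\<lambda>f. \<Sum>b\<in>B. f b *\<^sub>R b) \<in> borel_measurable (\<Pi>\<^sub>M b\<in>B. lborel)"
      by (intro borel_measurable_sum borel_measurable_scaleR) auto
  qed
  then show thesis
    using that[of B] finB BP nrm coord repr by (auto simp: lborel_subspace_def B_def Let_def)
qed

lemma translate_eq_vimage: "(\<lambda>x. x + v) ` A = (\<lambda>x. x - v) -` (A :: 'e set)"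
proof (intro antisym subsetI)
  fix x assume "x \<in> (\<lambda>x. x - v) -` A"
  then have "x - v \<in> A" "x = (x - v) + v" by auto
  then show "x \<in> (\<lambda>x. x + v) ` A" by blast
qed auto

lemma measurable_translate: "v \<in> P \<Longrightarrow> (\<lambda>x. x + v) \<in> measurable \<Lambda> \<Lambda>"
  by (rule measurable_\<Lambda>I, rule borel_measurable_\<Lambda>) (simp_all add: P_add)

text \<open>In orthonormal coordinates translation by \<open>v\<close> adds
  \<open>v \<bullet> b\<close> to the coordinate of \<open>b\<close>, so the claim reduces, box by
  box, to translation invariance of \<open>lborel\<close> on the line.\<close>

lemma distr_\<Lambda>_translate:
  assumes v: "v \<in> P"
  shows "distr \<Lambda> \<Lambda> (\<lambda>x. x + v) = \<Lambda>"
proof -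
  obtain B where finB: "finite B" and BP: "B \<subseteq> P" and nrm: "\<And>b. b \<in> B \<Longrightarrow> norm b = 1" and
    \<Lambda>: "\<Lambda> = distr (\<Pi>\<^sub>M b\<in>B. lborel) (restrict_space borel P) (\<lambda>f. \<Sum>b\<in>B. f b *\<^sub>R b)" and
    coord: "\<And>f b. b \<in> B \<Longrightarrow> (\<Sum>c\<in>B. f c *\<^sub>R c) \<bullet> b = f b" and
    repr: "\<And>x. x \<in> P \<Longrightarrow> (\<Sum>b\<in>B. (x \<bullet> b) *\<^sub>R b) = x" and
    m: "(\<lambda>f. \<Sum>b\<in>B. f b *\<^sub>R b) \<in> measurable (\<Pi>\<^sub>M b\<in>B. lborel) (restrict_space borel P)"
    by (rule \<Lambda>_coordinates, rule that, assumption+)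
  define s where "s = (\<lambda>f. \<Sum>b\<in>B. f b *\<^sub>R b :: 'e)"
  define \<tau> where "\<tau> f = (\<lambda>b\<in>B. f b + v \<bullet> b)" for f :: "'e \<Rightarrow> real"
  let ?M = "(\<Pi>\<^sub>M b\<in>B. lborel) :: ('e \<Rightarrow> real) measure"
  interpret ps: product_sigma_finite "\<lambda>b::'e. lborel :: real measure" ..
  have \<tau>m: "\<tau> \<in> measurable ?M ?M"
    unfolding \<tau>_def
  proof (rule measurable_restrict)
    fix b assume "b \<in> B"
    then show "(\<lambda>f. f b + v \<bullet> b) \<in> measurable ?M lborel"
      using measurable_component_singleton[of b B "\<lambda>_. lborel :: real measure"] by simp
  qed
  have "?M = distr ?M ?M \<tau>"
  proof (rule ps.PiM_eqI[OF finB, symmetric])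
    show "sets (distr ?M ?M \<tau>) = sets ?M" by simp
    fix A :: "'e \<Rightarrow> real set" assume A: "\<And>i. i \<in> B \<Longrightarrow> A i \<in> sets lborel"
    have "\<tau> -` Pi\<^sub>E B A \<inter> space ?M = (\<Pi>\<^sub>E b\<in>B. (\<lambda>x. v \<bullet> b + x) -` A b)"
      by (auto simp: \<tau>_def space_PiM PiE_iff extensional_def add.commute)
    then have "emeasure (distr ?M ?M \<tau>) (Pi\<^sub>E B A) = emeasure ?M (\<Pi>\<^sub>E b\<in>B. (\<lambda>x. v \<bullet> b + x) -` A b)"
      using A finB by (subst emeasure_distr[OF \<tau>m]) (auto intro: sets_PiM_I_finite)
    also have "\<dots> = (\<Prod>b\<in>B. emeasure lborel ((\<lambda>x. v \<bullet> b + x) -` A b))"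
    proof (rule ps.emeasure_PiM[OF finB])
      fix b assume "b \<in> B"
      then have "A b \<in> sets borel" using A by simp
      moreover have "(\<lambda>x. v \<bullet> b + x) \<in> borel_measurable borel" by simp
      ultimately show "(\<lambda>x. v \<bullet> b + x) -` A b \<in> sets lborel"
        by (metis measurable_sets_borel sets_lborel)
    qed
    also have "\<dots> = (\<Prod>b\<in>B. emeasure lborel (A b))"
    proof (rule prod.cong[OF refl])
      fix b assume "b \<in> B"
      then have Ab: "A b \<in> sets borel" using A by simp
      have "emeasure lborel (A b) = emeasure (distr lborel borel ((+) (v \<bullet> b))) (A b)"
        by (simp only: lborel_distr_plus)
      also have "\<dots> = emeasure lborel ((\<lambda>x. v \<bullet> b + x) -` A b)"
        using Ab by (subst emeasure_distr) auto
      finally show "emeasure lborel ((\<lambda>x. v \<bullet> b + x) -` A b) = emeasure lborel (A b)" by simp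
    qed
    finally show "emeasure (distr ?M ?M \<tau>) (Pi\<^sub>E B A) = (\<Prod>b\<in>B. emeasure lborel (A b))" .
  qed
  then have \<tau>: "distr ?M ?M \<tau> = ?M" by simp
  have m': "s \<in> measurable ?M \<Lambda>"
    using m measurable_cong_sets[OF refl sets_\<Lambda>, of ?M] by (simp add: s_def)
  have \<Lambda>': "\<Lambda> = distr ?M \<Lambda> s"
    using trans[OF \<Lambda> distr_cong[OF refl sets_\<Lambda>[symmetric] refl]] by (simp add: s_def)
  have "distr \<Lambda> \<Lambda> (\<lambda>x. x + v) = distr (distr ?M \<Lambda> s) \<Lambda> (\<lambda>x. x + v)"
    using \<Lambda>' by simp
  also have "\<dots> = distr ?M \<Lambda> ((\<lambda>x. x + v) \<circ> s)"
    using measurable_translate[OF v] m' by (rule distr_distr)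
  also have "(\<lambda>x. x + v) \<circ> s = s \<circ> \<tau>"
  proof
    fix f
    have "s (\<tau> f) = (\<Sum>b\<in>B. f b *\<^sub>R b + (v \<bullet> b) *\<^sub>R b)"
      unfolding s_def \<tau>_def by (intro sum.cong) (auto simp: scaleR_add_left)
    also have "\<dots> = s f + v"
      using repr[OF v] by (simp add: sum.distrib s_def)
    finally show "((\<lambda>x. x + v) \<circ> s) f = (s \<circ> \<tau>) f" by simp
  qed
  also have "distr ?M \<Lambda> (s \<circ> \<tau>) = distr (distr ?M ?M \<tau>) \<Lambda> s"
    using m' \<tau>m by (rule distr_distr[symmetric])
  also have "\<dots> = \<Lambda>"
    using \<tau> \<Lambda>' by simp
  finally show ?thesis .
qed

lemma sets_\<Lambda>_translate:
  assumes "v \<in> P" "A \<in> sets \<Lambda>"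
  shows "(\<lambda>x. x + v) ` A \<in> sets \<Lambda>"
proof -
  have "(\<lambda>x. x - v) -` A \<in> sets borel"
    using assms by (intro measurable_sets_borel) (auto simp: sets_\<Lambda>_iff)
  then show ?thesis
    using assms P_add by (auto simp: sets_\<Lambda>_iff translate_eq_vimage[symmetric])
qed

lemma emeasure_\<Lambda>_translate:
  assumes "v \<in> P" "A \<in> sets \<Lambda>"
  shows "emeasure \<Lambda> ((\<lambda>x. x + v) ` A) = emeasure \<Lambda> A"
proof -
  have "emeasure \<Lambda> ((\<lambda>x. x + v) ` A) = emeasure (distr \<Lambda> \<Lambda> (\<lambda>x. x + v)) ((\<lambda>x. x + v) ` A)"
    using assms by (simp add: distr_\<Lambda>_translate)
  also have "\<dots> = emeasure \<Lambda> ((\<lambda>x. x + v) -` ((\<lambda>x. x + v) ` A) \<inter> P)"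
    using assms by (subst emeasure_distr) (auto intro: measurable_translate sets_\<Lambda>_translate)
  also have "(\<lambda>x. x + v) -` ((\<lambda>x. x + v) ` A) \<inter> P = A"
    using assms by (auto simp: sets_\<Lambda>_iff)
  finally show ?thesis .
qed

lemma null_sets_\<Lambda>_translate:
  "v \<in> P \<Longrightarrow> A \<in> null_sets \<Lambda> \<Longrightarrow> (\<lambda>x. x + v) ` A \<in> null_sets \<Lambda>"
  by (intro null_setsI) (simp_all add: null_setsD1 null_setsD2 sets_\<Lambda>_translate emeasure_\<Lambda>_translate)

lemma emeasure_\<Lambda>_P: "emeasure \<Lambda> P \<noteq> 0"
proof -
  obtain B where finB: "finite B" and BP: "B \<subseteq> P" and nrm: "\<And>b. b \<in> B \<Longrightarrow> norm b = 1" and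
    \<Lambda>: "\<Lambda> = distr (\<Pi>\<^sub>M b\<in>B. lborel) (restrict_space borel P) (\<lambda>f. \<Sum>b\<in>B. f b *\<^sub>R b)" and
    coord: "\<And>f b. b \<in> B \<Longrightarrow> (\<Sum>c\<in>B. f c *\<^sub>R c) \<bullet> b = f b" and
    repr: "\<And>x. x \<in> P \<Longrightarrow> (\<Sum>b\<in>B. (x \<bullet> b) *\<^sub>R b) = x" and
    m: "(\<lambda>f. \<Sum>b\<in>B. f b *\<^sub>R b) \<in> measurable (\<Pi>\<^sub>M b\<in>B. lborel) (restrict_space borel P)"
    by (rule \<Lambda>_coordinates, rule that, assumption+)
  interpret ps: product_sigma_finite "\<lambda>b::'e. lborel :: real measure" ..
  have *: "(\<lambda>f. \<Sum>b\<in>B. f b *\<^sub>R b) -` P \<inter> space (\<Pi>\<^sub>M b\<in>B. lborel) = (\<Pi>\<^sub>E b\<in>B. UNIV)"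
    using measurable_space[OF m] by (auto simp: space_PiM space_restrict_space)
  have "emeasure \<Lambda> P = emeasure (\<Pi>\<^sub>M b\<in>B. lborel) ((\<lambda>f. \<Sum>b\<in>B. f b *\<^sub>R b) -` P \<inter> space (\<Pi>\<^sub>M b\<in>B. lborel))"
    by (subst \<Lambda>, rule emeasure_distr[OF m]) (auto simp: sets_restrict_space_iff)
  also have "\<dots> = (\<Prod>b\<in>B. emeasure lborel (UNIV :: real set))"
    unfolding * using finB by (subst ps.emeasure_PiM) auto
  \<comment> \<open>Each factor is infinite; for \<open>P = {0}\<close> the product is empty and
    equals \<open>1\<close>.\<close>
  also have "\<dots> \<noteq> 0"
    using finB by (simp add: emeasure_lborel_UNIV)
  finally show ?thesis .
qed

text \<open>By Cauchy-Schwarz a point of norm at most \<open>C\<close> has all its coordinates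
  between \<open>- C\<close> and \<open>C\<close>, so \<open>A\<close> sits in a cube. A
  non-measurable set has \<open>emeasure\<close> zero by convention, hence the case
  distinction.\<close>

lemma emeasure_\<Lambda>_bounded:
  assumes "bounded A"
  shows "emeasure \<Lambda> A < \<infinity>"
proof (cases "A \<in> sets \<Lambda>")
  case False
  then show ?thesis by (simp add: emeasure_notin_sets)
next
  case A: True
  obtain B where finB: "finite B" and BP: "B \<subseteq> P" and nrm: "\<And>b. b \<in> B \<Longrightarrow> norm b = 1" and
    \<Lambda>: "\<Lambda> = distr (\<Pi>\<^sub>M b\<in>B. lborel) (restrict_space borel P) (\<lambda>f. \<Sum>b\<in>B. f b *\<^sub>R b)" and
    coord: "\<And>f b. b \<in> B \<Longrightarrow> (\<Sum>c\<in>B. f c *\<^sub>R c) \<bullet> b = f b" and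
    repr: "\<And>x. x \<in> P \<Longrightarrow> (\<Sum>b\<in>B. (x \<bullet> b) *\<^sub>R b) = x" and
    m: "(\<lambda>f. \<Sum>b\<in>B. f b *\<^sub>R b) \<in> measurable (\<Pi>\<^sub>M b\<in>B. lborel) (restrict_space borel P)"
    by (rule \<Lambda>_coordinates, rule that, assumption+)
  interpret ps: product_sigma_finite "\<lambda>b::'e. lborel :: real measure" ..
  obtain C where C: "\<And>x. x \<in> A \<Longrightarrow> norm x \<le> C"
    using assms by (auto simp: bounded_iff)
  let ?Q = "\<Pi>\<^sub>E b\<in>B. {- C..C}"
  have sub: "(\<lambda>f. \<Sum>b\<in>B. f b *\<^sub>R b) -` A \<inter> space (\<Pi>\<^sub>M b\<in>B. lborel) \<subseteq> ?Q"
  proof (rule subsetI, rule PiE_I)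
    fix f b assume "f \<in> (\<lambda>f. \<Sum>b\<in>B. f b *\<^sub>R b) -` A \<inter> space (\<Pi>\<^sub>M b\<in>B. lborel)" and b: "b \<in> B"
    then have f: "(\<Sum>b\<in>B. f b *\<^sub>R b) \<in> A" by simp
    have "\<bar>f b\<bar> \<le> norm (\<Sum>b\<in>B. f b *\<^sub>R b)"
      using Cauchy_Schwarz_ineq2[of "\<Sum>b\<in>B. f b *\<^sub>R b" b] nrm[OF b] coord[OF b, of f] by simp
    with C[OF f] show "f b \<in> {- C..C}" by auto
  qed (auto simp: space_PiM)
  have "emeasure \<Lambda> A = emeasure (\<Pi>\<^sub>M b\<in>B. lborel) ((\<lambda>f. \<Sum>b\<in>B. f b *\<^sub>R b) -` A \<inter> space (\<Pi>\<^sub>M b\<in>B. lborel))"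
    using A sets_\<Lambda> by (subst \<Lambda>, intro emeasure_distr[OF m]) auto
  also have "\<dots> \<le> emeasure (\<Pi>\<^sub>M b\<in>B. lborel) ?Q"
    using sub finB by (intro emeasure_mono sets_PiM_I_finite) auto
  also have "\<dots> = (\<Prod>b\<in>B. emeasure lborel {- C..C})"
    using finB by (subst ps.emeasure_PiM) auto
  also have "\<dots> < \<infinity>"
    using finB by (simp add: less_top[symmetric] ennreal_prod_eq_top emeasure_lborel_Icc_eq del: prod_constant)
  finally show ?thesis .
qed

sublocale \<Lambda>: sigma_finite_measure \<Lambda>
proof
  let ?\<A> = "range (\<lambda>n::nat. P \<inter> cball 0 (real n))"
  have "\<Union>?\<A> = P"
  proof (intro antisym subsetI)
    fix x assume "x \<in> P"
    moreover obtain n :: nat where "norm x \<le> real n" using real_arch_simple by blast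
    ultimately show "x \<in> \<Union>?\<A>" by auto
  qed auto
  moreover have "emeasure \<Lambda> (P \<inter> cball 0 (real n)) \<noteq> \<infinity>" for n
    using emeasure_\<Lambda>_bounded[of "P \<inter> cball 0 (real n)"] by (simp add: bounded_Int less_top)
  ultimately show "\<exists>A. countable A \<and> A \<subseteq> sets \<Lambda> \<and> \<Union> A = space \<Lambda> \<and> (\<forall>a\<in>A. emeasure \<Lambda> a \<noteq> \<infinity>)"
    by (intro exI[of _ ?\<A>]) (auto simp: sets_\<Lambda>_iff)
qed

end

section \<open>Lattices and fundamental domains\<close>

text \<open>A discrete subgroup, with nothing said about its rank; finite covolume is derived in
  \<open>emeasure_fundamental_domain\<close> from a set of finite measure that meets every
  coset.\<close>

locale subspace_lattice = euclidean_subspace P for P :: "'e::euclidean_space set" +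
  fixes L :: "'e set"
  assumes L_sub: "L \<subseteq> P" and L_0: "0 \<in> L"
    and L_diff: "\<And>s t. s \<in> L \<Longrightarrow> t \<in> L \<Longrightarrow> s - t \<in> L"
    and L_countable: "countable L"
    and L_discrete: "\<exists>r>0. \<forall>t\<in>L. norm t < r \<longrightarrow> t = 0"
begin

lemma L_uminus: "t \<in> L \<Longrightarrow> - t \<in> L"
  using L_diff[OF L_0] by simp

lemma L_add: "s \<in> L \<Longrightarrow> t \<in> L \<Longrightarrow> s + t \<in> L"
  using L_diff[of s "- t"] L_uminus by simp

lemma L_P: "t \<in> L \<Longrightarrow> t \<in> P"
  using L_sub by blast

lemma coset_eq_iff: "coset L x = coset L y \<longleftrightarrow> x - y \<in> L"
proof
  assume "coset L x = coset L y"
  moreover have "x \<in> coset L x" using L_0 by (force simp: coset_def)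
  ultimately show "x - y \<in> L" by (auto simp: coset_def)
next
  have sub: "coset L x \<subseteq> coset L y" if "x - y \<in> L" for x y
  proof
    fix z assume "z \<in> coset L x"
    then obtain t where "t \<in> L" "z = x + t" by (auto simp: coset_def)
    with that have "(x - y) + t \<in> L" "z = y + ((x - y) + t)" by (auto intro: L_add)
    then show "z \<in> coset L y" unfolding coset_def by blast
  qed
  assume "x - y \<in> L"
  moreover from this have "y - x \<in> L" using L_uminus by fastforce
  ultimately show "coset L x = coset L y" using sub by blast
qed

lemma coset_image_iff:
  "coset L x \<in> coset L ` A \<longleftrightarrow> (\<exists>t\<in>L. x + t \<in> A)"
proof
  assume "coset L x \<in> coset L ` A"
  then obtain y where y: "y \<in> A" "x - y \<in> L" by (auto simp: coset_eq_iff)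
  then have "- (x - y) \<in> L" "x + - (x - y) \<in> A" by (blast intro: L_uminus, simp)
  then show "\<exists>t\<in>L. x + t \<in> A" by blast
next
  assume "\<exists>t\<in>L. x + t \<in> A"
  then obtain t where t: "t \<in> L" "x + t \<in> A" by blast
  then have "coset L x = coset L (x + t)" using L_uminus by (simp add: coset_eq_iff)
  with t show "coset L x \<in> coset L ` A" by blast
qed

section \<open>The quotient map onto the torus and its Borel structure\<close>

lemma continuous_map_coset: "continuous_map (top_of_set P) (torus P L) (coset L)"
  by (auto simp: continuous_map_def topspace_torus openin_torus)

text \<open>A quotient by a group of translations is open, because the saturation of
  \<open>U\<close> is a union of translates of \<open>U\<close>.\<close>

lemma openin_coset_image:
  assumes "openin (top_of_set P) U"
  shows "openin (torus P L) (coset L ` U)"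
proof -
  obtain V where V: "open V" "U = P \<inter> V" using assms by (auto simp: openin_open)
  have "x \<in> (\<lambda>x. - t + x) ` V \<longleftrightarrow> x + t \<in> V" for x t
  proof
    assume "x + t \<in> V"
    moreover have "x = - t + (x + t)" by simp
    ultimately show "x \<in> (\<lambda>x. - t + x) ` V" by blast
  qed (auto simp: add.commute)
  then have "{x \<in> P. coset L x \<in> coset L ` U} = P \<inter> (\<Union>t\<in>L. (\<lambda>x. - t + x) ` V)"
    by (auto simp: coset_image_iff V(2) intro: P_add L_P)
  moreover have "open (\<Union>t\<in>L. (\<lambda>x. - t + x) ` V)"
    using V by (intro open_UN ballI open_translation)
  ultimately show ?thesis
    using V by (auto simp: openin_torus openin_open)
qed

lemma borel_of_P: "sets (borel_of (top_of_set P)) = sets \<Lambda>"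
proof -
  have "sets \<Lambda> = (\<inter>) P ` sigma_sets UNIV {S. open S}"
    by (simp add: sets_\<Lambda> sets_restrict_space borel_def)
  also have "\<dots> = sigma_sets P ((\<inter>) P ` {S. open S})"
    using P_borel by (intro sigma_sets_Int) (auto simp: borel_def)
  also have "(\<inter>) P ` {S. open S} = {U. openin (top_of_set P) U}"
    by (auto simp: openin_open)
  finally show ?thesis
    by (simp add: sets_borel_of)
qed

lemma measurable_coset: "coset L \<in> measurable \<Lambda> (borel_of (torus P L))"
  using continuous_map_measurable_borel_of[OF continuous_map_coset]
    measurable_cong_sets[OF borel_of_P refl] by blast

text \<open>Charts of the torus: balls of radius \<open>r / 2\<close> about a countable dense subset
  of \<open>P\<close>, where \<open>r\<close> separates \<open>0\<close> from the rest of
  \<open>L\<close>.\<close>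

lemma injective_cover:
  obtains W :: "nat \<Rightarrow> 'e set" where
    "\<And>n. openin (top_of_set P) (W n)" "(\<Union>n. W n) = P"
    "\<And>n x y. x \<in> W n \<Longrightarrow> y \<in> W n \<Longrightarrow> x - y \<in> L \<Longrightarrow> x = y"
proof -
  obtain r where r: "r > 0" "\<And>t. t \<in> L \<Longrightarrow> norm t < r \<Longrightarrow> t = 0"
    using L_discrete by blast
  obtain D where D: "countable D" "D \<subseteq> P" "P \<subseteq> closure D"
    by (rule separable)
  then have "D \<noteq> {}" using P_0 by auto
  define W where "W n = P \<inter> ball (from_nat_into D n) (r / 2)" for n
  show thesis
  proof
    show "openin (top_of_set P) (W n)" for n
      unfolding W_def by (simp add: openin_open_Int)
    show "(\<Union>n. W n) = P"
    proof (intro antisym subsetI)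
      fix x assume "x \<in> P"
      then obtain d where "d \<in> D" "dist d x < r / 2"
        using D(3) r(1) closure_approachable[of x D] half_gt_zero by blast
      moreover obtain n where "from_nat_into D n = d"
        using from_nat_into_surj[OF D(1) \<open>d \<in> D\<close>] by blast
      ultimately show "x \<in> (\<Union>n. W n)"
        using \<open>x \<in> P\<close> by (auto simp: W_def)
    qed (auto simp: W_def)
    fix n x y assume "x \<in> W n" "y \<in> W n" "x - y \<in> L"
    then have "dist x y < r"
      unfolding W_def by (auto intro: dist_triangle_half_r)
    then show "x = y"
      using r(2)[OF \<open>x - y \<in> L\<close>] by (simp add: dist_norm)
  qed
qed

text \<open>Direct images respect countable unions, but complements only where the map is injective.
  Hence the induction over Borel sets runs inside one chart of \<open>injective_cover\<close>, and
  the countably many charts are glued afterwards.\<close>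

lemma coset_image_sets:
  assumes "A \<in> sets \<Lambda>"
  shows "coset L ` A \<in> sets (borel_of (torus P L))"
proof -
  obtain W :: "nat \<Rightarrow> 'e set" where
    W: "\<And>n. openin (top_of_set P) (W n)" "(\<Union>n. W n) = P"
    "\<And>n x y. x \<in> W n \<Longrightarrow> y \<in> W n \<Longrightarrow> x - y \<in> L \<Longrightarrow> x = y"
    by (rule injective_cover, rule that, assumption+)
  have "coset L ` (A \<inter> W n) \<in> sets (borel_of (torus P L))" for n
  proof -
    have "A \<in> sigma_sets P {U. openin (top_of_set P) U}"
      using assms borel_of_P sets_borel_of[of "top_of_set P"] by simp
    then show ?thesis
    proof induction
      case (Basic U)
      then show ?case
        using W(1) by (auto intro: borel_of_open openin_coset_image openin_Int)
    next
      case Empty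
      then show ?case by simp
    next
      case (Compl A)
      have "W n \<subseteq> P" using W(2) by blast
      then have "coset L ` ((P - A) \<inter> W n) = coset L ` W n - coset L ` (A \<inter> W n)"
        using W(3)[of _ n] by (auto simp: coset_eq_iff) metis
      also have "\<dots> \<in> sets (borel_of (torus P L))"
        using Compl.IH W(1) by (intro sets.Diff) (auto intro: borel_of_open openin_coset_image)
      finally show ?case .
    next
      case (Union A)
      have "coset L ` (\<Union> (range A) \<inter> W n) = (\<Union>i. coset L ` (A i \<inter> W n))" by auto
      with Union.IH show ?case by simp
    qed
  qed
  moreover have "A = (\<Union>n. A \<inter> W n)"
    using W(2) assms by (auto simp: sets_\<Lambda>_iff)
  then have "coset L ` A = (\<Union>n. coset L ` (A \<inter> W n))"
    by (metis image_UN)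
  ultimately show ?thesis by auto
qed

text \<open>Each point of \<open>P\<close> is attributed to the first chart whose saturation
  \<open>V n\<close> contains it; that chart holds exactly one point of its coset.\<close>

lemma fundamental_domain_exists: "\<exists>F. is_fundamental_domain P L F"
proof -
  obtain W :: "nat \<Rightarrow> 'e set" where
    W: "\<And>n. openin (top_of_set P) (W n)" "(\<Union>n. W n) = P"
    "\<And>n x y. x \<in> W n \<Longrightarrow> y \<in> W n \<Longrightarrow> x - y \<in> L \<Longrightarrow> x = y"
    by (rule injective_cover, rule that, assumption+)
  define V where "V n = (\<Union>t\<in>L. (\<lambda>x. x + t) ` W n)" for n
  have V_iff: "x \<in> V n \<longleftrightarrow> (\<exists>t\<in>L. x - t \<in> W n)" for x n
    unfolding V_def by (force simp: image_iff)
  have V_diff: "x - t \<in> V n \<longleftrightarrow> x \<in> V n" if "t \<in> L" for x t n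
  proof
    assume "x - t \<in> V n"
    then obtain s where "s \<in> L" "x - (t + s) \<in> W n" by (auto simp: V_iff diff_diff_eq)
    then show "x \<in> V n" using that L_add V_iff by blast
  next
    assume "x \<in> V n"
    then obtain s where "s \<in> L" "x - s \<in> W n" by (auto simp: V_iff)
    moreover have "x - t - (s - t) = x - s" by simp
    ultimately show "x - t \<in> V n" using that L_diff V_iff by metis
  qed
  have W_V: "W n \<subseteq> V n" for n
    using L_0 by (force simp: V_iff)
  have Wm: "W n \<in> sets \<Lambda>" for n
    using W(1)[of n] borel_of_open borel_of_P by blast
  have Vm: "V n \<in> sets \<Lambda>" for n
    unfolding V_def using Wm L_countable L_P by (intro sets.countable_UN') (auto intro: sets_\<Lambda>_translate)
  define F where "F = (\<Union>n. W n - (\<Union>m<n. V m))"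
  have "F \<in> sets \<Lambda>"
    unfolding F_def using Wm Vm by (intro sets.countable_UN) auto
  then have F: "F \<in> sets borel" "F \<subseteq> P" by (auto simp: sets_\<Lambda>_iff)
  have "\<exists>!t. t \<in> L \<and> x - t \<in> F" if "x \<in> P" for x
  proof -
    have "\<exists>n. x \<in> V n" using that W(2) W_V by blast
    then obtain n where n: "x \<in> V n" "\<And>m. m < n \<Longrightarrow> x \<notin> V m"
      using exists_least_iff[of "\<lambda>n. x \<in> V n"] by blast
    have F_iff: "x - t \<in> F \<longleftrightarrow> x - t \<in> W n" if "t \<in> L" for t
    proof
      assume "x - t \<in> F"
      then obtain k where k: "x - t \<in> W k" "\<And>m. m < k \<Longrightarrow> x - t \<notin> V m"
        by (auto simp: F_def)
      then have "x \<in> V k" "\<And>m. m < k \<Longrightarrow> x \<notin> V m"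
        using W_V[of k] V_diff[OF that] by blast+
      then have "k = n" using n by (meson linorder_neqE_nat)
      with k show "x - t \<in> W n" by simp
    next
      assume "x - t \<in> W n"
      with n V_diff[OF that] show "x - t \<in> F" by (auto simp: F_def)
    qed
    obtain t where t: "t \<in> L" "x - t \<in> W n" using n by (auto simp: V_iff)
    show ?thesis
    proof (rule ex1I[of _ t])
      show "t \<in> L \<and> x - t \<in> F" using t F_iff by blast
      fix s assume s: "s \<in> L \<and> x - s \<in> F"
      then have "x - s \<in> W n" using F_iff by blast
      moreover have "x - s - (x - t) \<in> L" using s t L_diff[of t s] by simp
      ultimately have "x - s = x - t" using W(3) t by blast
      then show "s = t" by simp
    qed
  qed
  with F have "is_fundamental_domain P L F" by (simp add: is_fundamental_domain_def)
  then show ?thesis by blast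
qed

text \<open>The number of points of \<open>x + L\<close> in \<open>A\<close>, that is, the
  \<open>L\<close>-periodization of the indicator of \<open>A\<close>. As an integral against
  counting measure with values in \<open>ennreal\<close> it admits infinite counts and is open to
  Fubini and Fatou.\<close>

definition hits :: "'e set \<Rightarrow> 'e \<Rightarrow> ennreal" where
  "hits A x = (\<integral>\<^sup>+t. indicator A (x + t) \<partial>count_space L)"

lemma hits_eq_emeasure: "hits A x = emeasure (count_space L) {t \<in> L. x + t \<in> A}"
proof -
  have "hits A x = (\<integral>\<^sup>+t. indicator {t \<in> L. x + t \<in> A} t \<partial>count_space L)"
    unfolding hits_def by (intro nn_integral_cong) (auto simp: indicator_def)
  then show ?thesis by simp
qed

lemma hits_lattice: "l \<in> L \<Longrightarrow> hits A (x + l) = hits A x"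
  unfolding hits_def
proof -
  assume l: "l \<in> L"
  have bij: "bij_betw (\<lambda>t. l + t) L L"
  proof (rule bij_betwI[where g = "\<lambda>t. - l + t"])
  qed (use l L_add L_diff in auto)
  show "(\<integral>\<^sup>+t. indicator A (x + l + t) \<partial>count_space L) = (\<integral>\<^sup>+t. indicator A (x + t) \<partial>count_space L)"
    using nn_integral_bij_count_space[OF bij, of "\<lambda>t. indicator A (x + t)"] by (simp add: add.assoc)
qed

lemma borel_measurable_hits [measurable]:
  assumes [measurable]: "A \<in> sets borel"
  shows "hits A \<in> borel_measurable borel"
proof -
  interpret c: sigma_finite_measure "count_space L"
    using L_countable by (rule sigma_finite_measure_count_space_countable)
  have [measurable]: "(\<lambda>t. t) \<in> measurable (count_space L) (borel :: 'e measure)"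
    by simp
  have [measurable]: "snd \<in> measurable (borel \<Otimes>\<^sub>M count_space L) (borel :: 'e measure)"
    using measurable_compose[OF measurable_snd, of "\<lambda>t. t"] by simp
  have "(\<lambda>p. indicator A (fst p + snd p) :: ennreal) \<in> borel_measurable (borel \<Otimes>\<^sub>M count_space L)"
    by measurable
  then show ?thesis
    unfolding hits_def[abs_def]
    by (intro c.borel_measurable_nn_integral) (simp add: case_prod_beta')
qed

lemma hits_fundamental_domain:
  assumes "is_fundamental_domain P L F" "x \<in> P"
  shows "hits F x = 1"
proof -
  obtain t where t: "t \<in> L" "x - t \<in> F" and u: "\<And>s. s \<in> L \<Longrightarrow> x - s \<in> F \<Longrightarrow> s = t"
    using assms unfolding is_fundamental_domain_def by metis
  have "{s \<in> L. x + s \<in> F} = {- t}"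
  proof (intro antisym subsetI)
    fix s assume "s \<in> {s \<in> L. x + s \<in> F}"
    then have "- s = t" using u[of "- s"] L_uminus by simp
    then show "s \<in> {- t}" by auto
  qed (use t L_uminus in auto)
  moreover have "- t \<in> L" using t L_uminus by blast
  ultimately show ?thesis by (simp add: hits_eq_emeasure)
qed

text \<open>Both sides are sums over \<open>t\<close> in \<open>L\<close> of the measure of the
  points of one set that \<open>t\<close> carries into the other. Translation by \<open>t\<close>
  exchanges the two sets and replaces \<open>t\<close> by \<open>- t\<close>, which permutes
  \<open>L\<close>.\<close>

lemma nn_integral_hits_swap:
  assumes A: "A \<in> sets \<Lambda>" and B: "B \<in> sets \<Lambda>"
  shows "(\<integral>\<^sup>+x. hits A x * indicator B x \<partial>\<Lambda>) = (\<integral>\<^sup>+x. hits B x * indicator A x \<partial>\<Lambda>)"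
proof -
  have AB [measurable]: "A \<in> sets borel" "B \<in> sets borel"
    using A B by (auto simp: sets_\<Lambda>_iff)
  have m: "(\<lambda>x. indicator A (x + t) * indicator B (x + s) :: ennreal) \<in> borel_measurable \<Lambda>"
    if [measurable]: "A \<in> sets borel" "B \<in> sets borel" for A B :: "'e set" and s t
    by (rule borel_measurable_\<Lambda>) measurable
  have expand: "(\<integral>\<^sup>+x. hits A x * indicator B x \<partial>\<Lambda>)
      = (\<integral>\<^sup>+t. \<integral>\<^sup>+x. indicator A (x + t) * indicator B x \<partial>\<Lambda> \<partial>count_space L)"
    if [measurable]: "A \<in> sets borel" "B \<in> sets borel" for A B
  proof -
    have "(\<integral>\<^sup>+x. hits A x * indicator B x \<partial>\<Lambda>)
        = (\<integral>\<^sup>+x. \<integral>\<^sup>+t. indicator A (x + t) * indicator B x \<partial>count_space L \<partial>\<Lambda>)"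
      unfolding hits_def by (simp add: nn_integral_multc)
    also have "\<dots> = (\<integral>\<^sup>+t. \<integral>\<^sup>+x. indicator A (x + t) * indicator B x \<partial>\<Lambda> \<partial>count_space L)"
      using m[of A B _ 0] that by (intro nn_integral_count_space_nn_integral L_countable) simp
    finally show ?thesis .
  qed
  have bij: "bij_betw uminus L L"
    by (rule bij_betwI[where g = uminus]) (auto intro: L_uminus)
  have "(\<integral>\<^sup>+x. indicator A (x + t) * indicator B x \<partial>\<Lambda>)
      = (\<integral>\<^sup>+x. indicator B (x + - t) * indicator A x \<partial>\<Lambda>)" if "t \<in> L" for t
  proof -
    have t: "t \<in> P" using that L_P by blast
    have "(\<integral>\<^sup>+x. indicator B (x + - t) * indicator A x \<partial>\<Lambda>)
        = (\<integral>\<^sup>+x. indicator B (x + - t) * indicator A x \<partial>distr \<Lambda> \<Lambda> (\<lambda>x. x + t))"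
      by (simp add: distr_\<Lambda>_translate[OF t])
    also have "\<dots> = (\<integral>\<^sup>+x. indicator B x * indicator A (x + t) \<partial>\<Lambda>)"
      using m[of B A "- t" 0] measurable_translate[OF t]
      by (subst nn_integral_distr) simp_all
    finally show ?thesis by (simp add: mult.commute)
  qed
  then have "(\<integral>\<^sup>+t. \<integral>\<^sup>+x. indicator A (x + t) * indicator B x \<partial>\<Lambda> \<partial>count_space L)
      = (\<integral>\<^sup>+t. \<integral>\<^sup>+x. indicator B (x + - t) * indicator A x \<partial>\<Lambda> \<partial>count_space L)"
    by (intro nn_integral_cong_simp) simp
  also have "\<dots> = (\<integral>\<^sup>+t. \<integral>\<^sup>+x. indicator B (x + t) * indicator A x \<partial>\<Lambda> \<partial>count_space L)"
    by (rule nn_integral_bij_count_space[OF bij])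
  finally show ?thesis
    by (simp add: expand)
qed

text \<open>The swap, combined with the fact that \<open>hits F\<close> is \<open>1\<close> on
  \<open>P\<close>: counting over one period recovers the full measure.\<close>

lemma nn_integral_hits_fundamental_domain:
  assumes F: "is_fundamental_domain P L F" and A: "A \<in> sets \<Lambda>"
  shows "(\<integral>\<^sup>+x. hits A x * indicator F x \<partial>\<Lambda>) = emeasure \<Lambda> A"
proof -
  have "F \<in> sets \<Lambda>" using F by (auto simp: is_fundamental_domain_def sets_\<Lambda>_iff)
  then have "(\<integral>\<^sup>+x. hits A x * indicator F x \<partial>\<Lambda>) = (\<integral>\<^sup>+x. hits F x * indicator A x \<partial>\<Lambda>)"
    using A by (intro nn_integral_hits_swap)
  also have "\<dots> = (\<integral>\<^sup>+x. indicator A x \<partial>\<Lambda>)"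
    using hits_fundamental_domain[OF F] by (intro nn_integral_cong) simp
  finally show ?thesis using A by simp
qed

lemma hits_ge_1: "t \<in> L \<Longrightarrow> x + t \<in> A \<Longrightarrow> 1 \<le> hits A x"
proof -
  assume t: "t \<in> L" "x + t \<in> A"
  have "emeasure (count_space L) {t} \<le> hits A x"
    unfolding hits_eq_emeasure using t by (intro emeasure_mono) auto
  then show ?thesis using t by simp
qed

text \<open>Otherwise countably many null translates of \<open>A\<close> would cover
  \<open>P\<close>, which is not null.\<close>

lemma emeasure_cover_nonzero:
  assumes A: "A \<in> sets \<Lambda>" and cover: "\<And>x. x \<in> P \<Longrightarrow> \<exists>t\<in>L. x + t \<in> A"
  shows "emeasure \<Lambda> A \<noteq> 0"
proof
  assume "emeasure \<Lambda> A = 0"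
  then have "A \<in> null_sets \<Lambda>" using A by (simp add: null_sets_def)
  then have "(\<Union>t\<in>L. (\<lambda>x. x + t) ` A) \<in> null_sets \<Lambda>"
    using L_countable L_P by (intro null_sets_UN') (auto intro: null_sets_\<Lambda>_translate)
  moreover have "P \<subseteq> (\<Union>t\<in>L. (\<lambda>x. x + t) ` A)"
  proof
    fix x assume "x \<in> P"
    then obtain t where "t \<in> L" "x + t \<in> A" using cover by blast
    moreover have "x = (x + t) + - t" by simp
    ultimately show "x \<in> (\<Union>t\<in>L. (\<lambda>x. x + t) ` A)" using L_uminus by blast
  qed
  moreover have "P \<in> sets \<Lambda>" by (simp add: sets_\<Lambda>_iff)
  ultimately have "P \<in> null_sets \<Lambda>" using null_sets_subset by blast
  with emeasure_\<Lambda>_P show False by auto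
qed

text \<open>Since \<open>hits A\<close> is at least \<open>1\<close> on \<open>P\<close> and its
  integral over \<open>F\<close> is the measure of \<open>A\<close>, the set \<open>F\<close> is no
  larger than \<open>A\<close>.\<close>

lemma emeasure_fundamental_domain:
  assumes F: "is_fundamental_domain P L F"
    and A: "A \<in> sets \<Lambda>" "emeasure \<Lambda> A < \<infinity>" "\<And>x. x \<in> P \<Longrightarrow> \<exists>t\<in>L. x + t \<in> A"
  shows "emeasure \<Lambda> F < \<infinity>" "emeasure \<Lambda> F \<noteq> 0" "F \<in> sets \<Lambda>"
proof -
  show Fm: "F \<in> sets \<Lambda>"
    using F by (auto simp: is_fundamental_domain_def sets_\<Lambda>_iff)
  have "emeasure \<Lambda> F = (\<integral>\<^sup>+x. indicator F x \<partial>\<Lambda>)" using Fm by simp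
  also have "\<dots> \<le> (\<integral>\<^sup>+x. hits A x * indicator F x \<partial>\<Lambda>)"
    using A(3) hits_ge_1 by (intro nn_integral_mono) (auto simp: indicator_def)
  also have "\<dots> = emeasure \<Lambda> A"
    using F A by (intro nn_integral_hits_fundamental_domain)
  finally show "emeasure \<Lambda> F < \<infinity>" using A(2) by simp
  show "emeasure \<Lambda> F \<noteq> 0"
    using Fm
  proof (rule emeasure_cover_nonzero)
    fix x assume "x \<in> P"
    then obtain t where "t \<in> L" "x - t \<in> F"
      using F unfolding is_fundamental_domain_def by metis
    then show "\<exists>t\<in>L. x + t \<in> F"
      using L_uminus by (intro bexI[of _ "- t"]) auto
  qed
qed

end

section \<open>Equidistribution of minimal translations\<close>

text \<open>\<open>dense_orbit\<close> says, upstairs in \<open>P\<close>, that the orbit of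
  \<open>0\<close> under translation by \<open>e\<close>, over all integer times, is dense in the
  torus; for a translation this amounts to minimality.\<close>

locale minimal_translation = subspace_lattice P L for P L :: "'e::euclidean_space set" +
  fixes e :: 'e
  assumes e_P: "e \<in> P"
    and dense_orbit: "P \<subseteq> closure {l + of_int k *\<^sub>R e | l k. l \<in> L}"
begin

lemma hits_translate: "hits A (x + v) = hits ((\<lambda>y. y + - v) ` A) x"
proof -
  have "x + t \<in> (\<lambda>y. y + - v) ` A \<longleftrightarrow> x + v + t \<in> A" for t
    by (simp only: translate_eq_vimage) (simp add: algebra_simps)
  then show ?thesis by (simp add: hits_eq_emeasure)
qed

text \<open>The hypothesis \<open>inv\<close> is invariance of the image of \<open>\<kappa>\<close>
  on the torus, phrased upstairs so that measures carried by a bounded set qualify. The conclusion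
  is multiplied out to avoid division in \<open>ennreal\<close>.\<close>

theorem equidistribution:
  assumes \<kappa>: "sets \<kappa> = sets \<Lambda>" "finite_measure \<kappa>"
    and inv: "\<And>A. A \<in> sets \<Lambda> \<Longrightarrow> (\<integral>\<^sup>+x. hits A (x + e) \<partial>\<kappa>) = (\<integral>\<^sup>+x. hits A x \<partial>\<kappa>)"
    and F: "is_fundamental_domain P L F"
    and A: "A \<in> sets \<Lambda>"
  shows "(\<integral>\<^sup>+x. hits A x \<partial>\<kappa>) * emeasure \<Lambda> F = emeasure \<kappa> P * emeasure \<Lambda> A"
proof -
  interpret \<kappa>: finite_measure \<kappa> by fact
  interpret pair: pair_sigma_finite \<Lambda> \<kappa> ..
  have sp\<kappa>: "space \<kappa> = P" using sets_eq_imp_space_eq[OF \<kappa>(1)] by simp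
  have Fm: "F \<in> sets \<Lambda>" using F by (auto simp: is_fundamental_domain_def sets_\<Lambda>_iff)
  have \<kappa>_meas: "f \<in> borel_measurable \<kappa>" if "f \<in> borel_measurable borel" for f :: "'e \<Rightarrow> ennreal"
    using borel_measurable_\<Lambda>[OF that] measurable_cong_sets[OF \<kappa>(1) refl] by blast
  have sets_shift: "(\<lambda>y. y + - v) ` A \<in> sets \<Lambda>" if "v \<in> P" "A \<in> sets \<Lambda>" for v A
    using that P_uminus by (intro sets_\<Lambda>_translate) auto
  \<comment> \<open>As a function of \<open>t\<close> this has the periods \<open>L\<close>, because
    \<open>hits\<close> has them, and the period \<open>e\<close>, because of \<open>inv\<close>;
    together they generate a dense group.\<close>
  define f where "f A t = (\<integral>\<^sup>+x. hits A (x + t) \<partial>\<kappa>)" for A t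
  have f_L: "f A (t + l) = f A t" if "l \<in> L" for A t l
    unfolding f_def using hits_lattice[OF that] by (simp flip: add.assoc)
  have f_e: "f A (t + e) = f A t" if "A \<in> sets \<Lambda>" "t \<in> P" for A t
  proof -
    have "f A (t + e) = (\<integral>\<^sup>+x. hits A ((x + e) + t) \<partial>\<kappa>)"
      by (simp add: f_def algebra_simps)
    also have "\<dots> = f A t"
      unfolding f_def hits_translate[of A _ t] using that by (intro inv sets_shift)
    finally show ?thesis .
  qed
  have f_ke: "f A (t + of_nat k *\<^sub>R e) = f A t" if "A \<in> sets \<Lambda>" "t \<in> P" for A t and k :: nat
  proof (induction k)
    case (Suc k)
    have "t + of_nat k *\<^sub>R e \<in> P"
      using that e_P subspace_P by (simp add: subspace_add subspace_scale)
    then have "f A ((t + of_nat k *\<^sub>R e) + e) = f A (t + of_nat k *\<^sub>R e)"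
      using that by (intro f_e)
    then show ?case using Suc by (simp add: algebra_simps)
  qed simp
  have f_ie: "f A (t + of_int k *\<^sub>R e) = f A t" if "A \<in> sets \<Lambda>" "t \<in> P" for A t and k :: int
  proof (cases "k \<ge> 0")
    case True
    then show ?thesis using f_ke[OF that, of "nat k"] by simp
  next
    case False
    have "t + of_int k *\<^sub>R e \<in> P"
      using that e_P subspace_P by (simp add: subspace_add subspace_scale)
    then have "f A (t + of_int k *\<^sub>R e + of_nat (nat (- k)) *\<^sub>R e) = f A (t + of_int k *\<^sub>R e)"
      using that by (intro f_ke)
    then show ?thesis using False by (simp add: algebra_simps)
  qed
  have eq_open: "f (P \<inter> V) 0 * emeasure \<Lambda> F = emeasure \<kappa> P * emeasure \<Lambda> (P \<inter> V)"
    if V: "open V" for V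
  proof -
    let ?A = "P \<inter> V"
    have A: "?A \<in> sets \<Lambda>" using V by (auto simp: sets_\<Lambda>_iff)
    then have A' [measurable]: "?A \<in> sets borel" by (auto simp: sets_\<Lambda>_iff)
    \<comment> \<open>Lower semicontinuity of \<open>f ?A\<close>, by Fatou's lemma, against its dense group of periods.\<close>
    have f_le: "f ?A t \<le> f ?A s" if st: "s \<in> P" "t \<in> P" for s t
    proof -
      \<comment> \<open>Periods \<open>d n\<close> tending to \<open>t - s\<close> give points
        \<open>s + d n\<close> that approach \<open>t\<close> while \<open>f\<close> keeps its value
        at \<open>s\<close>.\<close>
      have "t - s \<in> closure {l + of_int k *\<^sub>R e | l k. l \<in> L}"
        using P_diff[OF st(2,1)] dense_orbit by blast
      then obtain d where d: "\<And>n. d n \<in> {l + of_int k *\<^sub>R e | l k. l \<in> L}" "d \<longlonglongrightarrow> t - s"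
        unfolding closure_sequential by blast
      have f_d: "f ?A (s + d n) = f ?A s" and d_P: "d n \<in> P" for n
      proof -
        obtain l k where lk: "l \<in> L" "d n = l + of_int k *\<^sub>R e"
          using d(1)[of n] by blast
        then show "f ?A (s + d n) = f ?A s"
          using f_L[of l ?A "s + of_int k *\<^sub>R e"] f_ie[OF A st(1)] by (simp add: algebra_simps)
        show "d n \<in> P"
          using lk L_P e_P subspace_P by (simp add: subspace_add subspace_scale)
      qed
      have "hits ?A (x + t) \<le> liminf (\<lambda>n. hits ?A (x + (s + d n)))" if x: "x \<in> P" for x
      proof -
        have "hits ?A (x + t) \<le> (\<integral>\<^sup>+r. liminf (\<lambda>n. indicator ?A (x + (s + d n) + r)) \<partial>count_space L)"
          unfolding hits_def
        proof (rule nn_integral_mono)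
          fix r assume "r \<in> space (count_space L)"
          then have r: "r \<in> L" by simp
          show "(indicator ?A (x + t + r) :: ennreal) \<le> liminf (\<lambda>n. indicator ?A (x + (s + d n) + r))"
          proof (cases "x + t + r \<in> ?A")
            case True
            have "(\<lambda>n. x + (s + d n) + r) \<longlonglongrightarrow> x + (s + (t - s)) + r"
              by (intro tendsto_intros d)
            then have "\<forall>\<^sub>F n in sequentially. x + (s + d n) + r \<in> V"
              using True V by (auto dest: topological_tendstoD)
            then have "\<forall>\<^sub>F n in sequentially. (1::ennreal) \<le> indicator ?A (x + (s + d n) + r)"
              by eventually_elim (use x st r d_P L_P P_add in auto)
            then show ?thesis
              using True by (auto intro: Liminf_bounded)
          qed simp
        qed
        also have "\<dots> \<le> liminf (\<lambda>n. hits ?A (x + (s + d n)))"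
          unfolding hits_def by (intro nn_integral_liminf) simp
        finally show ?thesis .
      qed
      then have "f ?A t \<le> (\<integral>\<^sup>+x. liminf (\<lambda>n. hits ?A (x + (s + d n))) \<partial>\<kappa>)"
        unfolding f_def by (intro nn_integral_mono) (simp add: sp\<kappa>)
      also have "\<dots> \<le> liminf (\<lambda>n. f ?A (s + d n))"
        unfolding f_def by (intro nn_integral_liminf \<kappa>_meas) measurable
      also have "\<dots> = f ?A s" by (simp add: f_d Liminf_const)
      finally show ?thesis .
    qed
    have f_const: "f ?A t = f ?A 0" if "t \<in> P" for t
      using f_le that P_0 by (meson antisym)
    \<comment> \<open>The constant is found by averaging over one period: after exchanging the
      integrals, each \<open>x\<close> contributes the measure of a translate of
      \<open>?A\<close>.\<close>
    have "f ?A 0 * emeasure \<Lambda> F = (\<integral>\<^sup>+t. f ?A t * indicator F t \<partial>\<Lambda>)"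
      using Fm f_const by (subst nn_integral_cmult_indicator[symmetric]) (auto intro!: nn_integral_cong)
    also have "\<dots> = (\<integral>\<^sup>+t. \<integral>\<^sup>+x. hits ?A (x + t) * indicator F t \<partial>\<kappa> \<partial>\<Lambda>)"
      unfolding f_def by (intro nn_integral_cong nn_integral_multc[symmetric] \<kappa>_meas) measurable
    also have "\<dots> = (\<integral>\<^sup>+x. \<integral>\<^sup>+t. hits ?A (x + t) * indicator F t \<partial>\<Lambda> \<partial>\<kappa>)"
    proof (rule pair.Fubini'[symmetric])
      have F' [measurable]: "F \<in> sets borel" using Fm by (simp add: sets_\<Lambda>_iff)
      have [measurable]: "(\<lambda>x. x) \<in> measurable \<Lambda> borel" "(\<lambda>x. x) \<in> measurable \<kappa> borel"
        using borel_measurable_\<Lambda>[of "\<lambda>x. x" borel] measurable_cong_sets[OF \<kappa>(1) refl] by auto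
      have [measurable]: "fst \<in> measurable (\<Lambda> \<Otimes>\<^sub>M \<kappa>) borel" "snd \<in> measurable (\<Lambda> \<Otimes>\<^sub>M \<kappa>) borel"
        using measurable_compose[OF measurable_fst, of "\<lambda>x. x" \<Lambda> borel]
          measurable_compose[OF measurable_snd, of "\<lambda>x. x" \<kappa> borel] by auto
      show "(\<lambda>(t, x). hits ?A (x + t) * indicator F t) \<in> borel_measurable (\<Lambda> \<Otimes>\<^sub>M \<kappa>)"
        unfolding case_prod_beta' by measurable
    qed
    also have "\<dots> = (\<integral>\<^sup>+x. emeasure \<Lambda> ?A \<partial>\<kappa>)"
    proof (rule nn_integral_cong)
      fix x assume "x \<in> space \<kappa>"
      then have x: "x \<in> P" by (simp add: sp\<kappa>)
      have "(\<integral>\<^sup>+t. hits ?A (x + t) * indicator F t \<partial>\<Lambda>)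
          = (\<integral>\<^sup>+t. hits ((\<lambda>y. y + - x) ` ?A) t * indicator F t \<partial>\<Lambda>)"
        by (simp add: hits_translate add.commute[of x])
      also have "\<dots> = emeasure \<Lambda> ((\<lambda>y. y + - x) ` ?A)"
        using F x A by (intro nn_integral_hits_fundamental_domain sets_shift)
      also have "\<dots> = emeasure \<Lambda> ?A"
        using x A P_uminus by (intro emeasure_\<Lambda>_translate) auto
      finally show "(\<integral>\<^sup>+t. hits ?A (x + t) * indicator F t \<partial>\<Lambda>) = emeasure \<Lambda> ?A" .
    qed
    also have "\<dots> = emeasure \<kappa> P * emeasure \<Lambda> ?A"
      by (simp add: sp\<kappa> mult.commute)
    finally show ?thesis .
  qed
  interpret c: sigma_finite_measure "count_space L"
    using L_countable by (rule sigma_finite_measure_count_space_countable)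
  \<comment> \<open>The convolution of \<open>\<kappa>\<close> with counting measure on
    \<open>L\<close>. Packaging \<open>f A 0\<close> as a measure in \<open>A\<close> lets the
    identity pass from open sets to Borel sets.\<close>
  define K where "K = distr (\<kappa> \<Otimes>\<^sub>M count_space L) \<Lambda> (\<lambda>p. fst p + snd p)"
  have "(\<lambda>x. x) \<in> measurable \<kappa> borel" "(\<lambda>x. x) \<in> measurable (count_space L) borel"
    using borel_measurable_\<Lambda>[of "\<lambda>x. x" borel] measurable_cong_sets[OF \<kappa>(1) refl] by auto
  then have [measurable]: "fst \<in> measurable (\<kappa> \<Otimes>\<^sub>M count_space L) borel"
      "snd \<in> measurable (\<kappa> \<Otimes>\<^sub>M count_space L) borel"
    using measurable_compose[OF measurable_fst, of "\<lambda>x. x" \<kappa> borel]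
      measurable_compose[OF measurable_snd, of "\<lambda>x. x" "count_space L" borel] by auto
  have add_m: "(\<lambda>p. fst p + snd p) \<in> measurable (\<kappa> \<Otimes>\<^sub>M count_space L) \<Lambda>"
    by (rule measurable_\<Lambda>I) (auto simp: space_pair_measure sp\<kappa> P_add L_P)
  have K: "emeasure K A = f A 0" if "A \<in> sets \<Lambda>" for A
  proof -
    have "emeasure K A = emeasure (\<kappa> \<Otimes>\<^sub>M count_space L) ((\<lambda>p. fst p + snd p) -` A \<inter> space (\<kappa> \<Otimes>\<^sub>M count_space L))"
      unfolding K_def using add_m that by (rule emeasure_distr)
    also have "\<dots> = (\<integral>\<^sup>+x. \<integral>\<^sup>+t. indicator ((\<lambda>p. fst p + snd p) -` A \<inter> space (\<kappa> \<Otimes>\<^sub>M count_space L)) (x, t) \<partial>count_space L \<partial>\<kappa>)"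
      using measurable_sets[OF add_m that] by (rule c.emeasure_pair_measure)
    also have "\<dots> = f A 0"
      unfolding f_def hits_def
      by (intro nn_integral_cong) (auto simp: indicator_def space_pair_measure)
    finally show ?thesis .
  qed
  \<comment> \<open>Relatively open sets are an intersection-stable generator; the balls provide the
    exhaustion by sets of finite measure, as \<open>\<kappa>\<close> is finite and
    \<open>\<Lambda>\<close> is finite on bounded sets.\<close>
  have "scale_measure (emeasure \<kappa> P) \<Lambda> = scale_measure (emeasure \<Lambda> F) K"
  proof (rule measure_eqI_generator_eq[where \<Omega> = P and E = "{U. openin (top_of_set P) U}"
        and A = "\<lambda>n. P \<inter> ball 0 (real n)"])
    show "Int_stable {U. openin (top_of_set P) U}"
      by (auto simp: Int_stable_def)
    show "{U. openin (top_of_set P) U} \<subseteq> Pow P"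
      by (auto dest!: openin_imp_subset)
    show "emeasure (scale_measure (emeasure \<kappa> P) \<Lambda>) U = emeasure (scale_measure (emeasure \<Lambda> F) K) U"
      if U: "U \<in> {U. openin (top_of_set P) U}" for U
    proof -
      obtain V where V: "open V" "U = P \<inter> V" using U by (auto simp: openin_open)
      then have "U \<in> sets \<Lambda>" by (auto simp: sets_\<Lambda>_iff)
      then show ?thesis using V eq_open[of V] K by (simp add: mult.commute)
    qed
    have "sets \<Lambda> = sigma_sets P {U. openin (top_of_set P) U}"
      using borel_of_P sets_borel_of[of "top_of_set P"] by simp
    then show "sets (scale_measure (emeasure \<kappa> P) \<Lambda>) = sigma_sets P {U. openin (top_of_set P) U}"
      and "sets (scale_measure (emeasure \<Lambda> F) K) = sigma_sets P {U. openin (top_of_set P) U}"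
      by (simp_all add: K_def)
    show "range (\<lambda>n. P \<inter> ball 0 (real n)) \<subseteq> {U. openin (top_of_set P) U}"
      by (auto simp: openin_open_Int)
    show "(\<Union>n. P \<inter> ball 0 (real n)) = P"
    proof (intro antisym subsetI)
      fix x assume "x \<in> P"
      moreover obtain n :: nat where "norm x < real n" using reals_Archimedean2 by blast
      ultimately show "x \<in> (\<Union>n. P \<inter> ball 0 (real n))" by auto
    qed auto
    show "emeasure (scale_measure (emeasure \<kappa> P) \<Lambda>) (P \<inter> ball 0 (real n)) \<noteq> \<infinity>" for n
      using emeasure_\<Lambda>_bounded[of "P \<inter> ball 0 (real n)"] \<kappa>.emeasure_finite[of P]
      by (simp add: bounded_Int ennreal_mult_eq_top_iff less_top)
  qed
  then have "emeasure (scale_measure (emeasure \<kappa> P) \<Lambda>) A = emeasure (scale_measure (emeasure \<Lambda> F) K) A"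
    by simp
  then show ?thesis
    using K[OF A] by (simp add: f_def mult.commute)
qed

end

section \<open>Minimal subshifts and bounded cocycles\<close>

lemma openin_word_topology:
  "openin word_topology U \<longleftrightarrow> (\<forall>x\<in>U. \<exists>n. \<forall>y. (\<forall>i<n. y i = x i) \<longrightarrow> y \<in> U)"
proof
  assume "openin word_topology U"
  show "\<forall>x\<in>U. \<exists>n. \<forall>y. (\<forall>i<n. y i = x i) \<longrightarrow> y \<in> U"
  proof
    fix x assume "x \<in> U"
    then obtain V where V: "finite {i. V i \<noteq> UNIV}" "x \<in> Pi\<^sub>E UNIV V" "Pi\<^sub>E UNIV V \<subseteq> U"
      using \<open>openin word_topology U\<close>
      unfolding word_topology_def openin_product_topology_alt by auto
    obtain n where n: "\<And>i. V i \<noteq> UNIV \<Longrightarrow> i < n"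
      using V(1) finite_nat_set_iff_bounded by auto
    have "y \<in> U" if "\<forall>i<n. y i = x i" for y
    proof -
      have "y i \<in> V i" for i
        using n[of i] that V(2) by (cases "V i = UNIV") auto
      then show ?thesis using V(3) by auto
    qed
    then show "\<exists>n. \<forall>y. (\<forall>i<n. y i = x i) \<longrightarrow> y \<in> U" by blast
  qed
next
  assume *: "\<forall>x\<in>U. \<exists>n. \<forall>y. (\<forall>i<n. y i = x i) \<longrightarrow> y \<in> U"
  show "openin word_topology U"
    unfolding word_topology_def openin_product_topology_alt
  proof
    fix x assume "x \<in> U"
    then obtain n where n: "\<And>y. (\<forall>i<n. y i = x i) \<Longrightarrow> y \<in> U" using * by blast
    let ?V = "\<lambda>i. if i < n then {x i} else UNIV"
    have "finite {i \<in> UNIV. ?V i \<noteq> topspace (discrete_topology UNIV)}"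
      by (rule finite_subset[of _ "{..<n}"]) auto
    moreover have "x \<in> Pi\<^sub>E UNIV ?V" "Pi\<^sub>E UNIV ?V \<subseteq> U"
      using n by (auto simp: PiE_iff split: if_splits)
    ultimately show "\<exists>V. finite {i \<in> UNIV. V i \<noteq> topspace (discrete_topology UNIV)} \<and>
        (\<forall>i\<in>UNIV. openin (discrete_topology UNIV) (V i)) \<and> x \<in> Pi\<^sub>E UNIV V \<and> Pi\<^sub>E UNIV V \<subseteq> U"
      by (intro exI[of _ ?V]) auto
  qed
qed

lemma topspace_word_topology [simp]: "topspace word_topology = UNIV"
  by (simp add: word_topology_def)

lemma funpow_word_shift: "(word_shift ^^ n) x = (\<lambda>i. x (n + i))"
  by (induction n) (simp_all add: word_shift_def)

lemma topspace_subshift: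
  "topspace (subshift u) = {x. \<forall>n. \<exists>m. \<forall>i<n. x i = u (m + i)}" (is "_ = ?X")
proof -
  have "topspace (subshift u) = word_topology closure_of {(word_shift ^^ n) u | n. True}"
    by (simp add: subshift_def)
  also have "\<dots> = ?X"
  proof (intro antisym subsetI CollectI allI)
    fix x n assume x: "x \<in> word_topology closure_of {(word_shift ^^ n) u | n. True}"
    have "openin word_topology {y. \<forall>i<n. y i = x i}"
      unfolding openin_word_topology by (auto intro: exI[of _ n])
    moreover have "x \<in> {y. \<forall>i<n. y i = x i}" by simp
    ultimately have "\<exists>y \<in> {(word_shift ^^ n) u | n. True}. y \<in> {y. \<forall>i<n. y i = x i}"
      using x unfolding in_closure_of by meson
    then obtain m where "\<forall>i<n. (word_shift ^^ m) u i = x i" by blast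
    then have "\<forall>i<n. x i = u (m + i)" by (simp add: funpow_word_shift)
    then show "\<exists>m. \<forall>i<n. x i = u (m + i)" by blast
  next
    fix x assume x: "x \<in> ?X"
    have "\<exists>y \<in> {(word_shift ^^ n) u | n. True}. y \<in> V" if V: "x \<in> V" "openin word_topology V" for V
    proof -
      obtain n where n: "\<And>y. (\<forall>i<n. y i = x i) \<Longrightarrow> y \<in> V"
        using V unfolding openin_word_topology by blast
      obtain m where "\<forall>i<n. x i = u (m + i)" using x by blast
      then have "(word_shift ^^ m) u \<in> V" by (intro n) (simp add: funpow_word_shift)
      then show ?thesis by blast
    qed
    then show "x \<in> word_topology closure_of {(word_shift ^^ n) u | n. True}"
      by (auto simp: in_closure_of)
  qed
  finally show ?thesis .
qed

lemma shift_in_subshift: "x \<in> topspace (subshift u) \<Longrightarrow> word_shift x \<in> topspace (subshift u)"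
proof -
  assume x: "x \<in> topspace (subshift u)"
  have "\<exists>m. \<forall>i<n. word_shift x i = u (m + i)" for n
  proof -
    obtain m where "\<forall>i<Suc n. x i = u (m + i)" using x by (auto simp: topspace_subshift)
    then have "\<forall>i<n. word_shift x i = u (Suc m + i)" by (auto simp: word_shift_def)
    then show ?thesis by blast
  qed
  then show ?thesis by (simp add: topspace_subshift)
qed

lemma orbit_in_subshift: "(\<lambda>i. u (m + i)) \<in> topspace (subshift u)"
  by (auto simp: topspace_subshift)

lemma in_subshift_self: "u \<in> topspace (subshift u)"
  using orbit_in_subshift[of u 0] by simp

lemma openin_subshift:
  "openin (subshift u) U \<longleftrightarrow> U \<subseteq> topspace (subshift u) \<and>
    (\<forall>x\<in>U. \<exists>n. \<forall>y\<in>topspace (subshift u). (\<forall>i<n. y i = x i) \<longrightarrow> y \<in> U)" (is "_ \<longleftrightarrow> ?R")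
proof -
  let ?X = "topspace (subshift u)"
  have op: "openin (subshift u) U \<longleftrightarrow> (\<exists>V. openin word_topology V \<and> U = V \<inter> ?X)" for U
    by (simp add: subshift_def openin_subtopology)
  show ?thesis
  proof
    assume "openin (subshift u) U"
    then obtain V where V: "openin word_topology V" "U = V \<inter> ?X" using op by blast
    show ?R
    proof (intro conjI ballI)
      fix x assume "x \<in> U"
      then obtain n where "\<forall>y. (\<forall>i<n. y i = x i) \<longrightarrow> y \<in> V"
        using V unfolding openin_word_topology by blast
      then show "\<exists>n. \<forall>y\<in>?X. (\<forall>i<n. y i = x i) \<longrightarrow> y \<in> U"
        using V(2) by (intro exI[of _ n]) simp
    qed (use V in auto)
  next
    assume R: ?R
    \<comment> \<open>The union of the cylinders that witness the right-hand side.\<close>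
    define V where "V = {y. \<exists>x\<in>U. \<exists>n. (\<forall>i<n. y i = x i) \<and> (\<forall>z\<in>?X. (\<forall>i<n. z i = x i) \<longrightarrow> z \<in> U)}"
    have "openin word_topology V"
      unfolding openin_word_topology
    proof
      fix y assume "y \<in> V"
      then obtain x n where "x \<in> U" "\<forall>i<n. y i = x i" "\<forall>z\<in>?X. (\<forall>i<n. z i = x i) \<longrightarrow> z \<in> U"
        by (auto simp: V_def)
      then show "\<exists>n. \<forall>z. (\<forall>i<n. z i = y i) \<longrightarrow> z \<in> V"
        unfolding V_def by (intro exI[of _ n]) auto
    qed
    moreover have "U = V \<inter> ?X"
    proof (intro antisym subsetI IntI)
      fix y assume y: "y \<in> U"
      then obtain n where "\<forall>z\<in>?X. (\<forall>i<n. z i = y i) \<longrightarrow> z \<in> U" using R by blast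
      then show "y \<in> V" unfolding V_def using y by (intro CollectI bexI[of _ y] exI[of _ n]) auto
      show "y \<in> ?X" using y R by blast
    next
      fix y assume "y \<in> V \<inter> ?X"
      then show "y \<in> U" by (auto simp: V_def)
    qed
    ultimately show "openin (subshift u) U" using op by blast
  qed
qed

lemma compact_space_subshift: "compact_space (subshift u)" for u :: "nat \<Rightarrow> 'a::finite"
proof -
  have "compact_space (word_topology :: (nat \<Rightarrow> 'a) topology)"
    unfolding word_topology_def compact_space_product_topology by (simp add: compact_space_discrete_topology)
  then show ?thesis
    unfolding subshift_def
    by (intro compact_space_subtopology closedin_compact_space) auto
qed

lemma Hausdorff_space_subshift: "Hausdorff_space (subshift u)"
  unfolding subshift_def word_topology_def
  by (intro Hausdorff_space_subtopology) (simp add: Hausdorff_space_product_topology)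

lemma continuous_map_word_shift: "continuous_map (subshift u) (subshift u) word_shift"
  unfolding continuous_map_def
proof (intro conjI allI impI)
  fix U assume U: "openin (subshift u) U"
  show "openin (subshift u) {x \<in> topspace (subshift u). word_shift x \<in> U}"
    unfolding openin_subshift
  proof (intro conjI ballI)
    fix x assume x: "x \<in> {x \<in> topspace (subshift u). word_shift x \<in> U}"
    then obtain n where n: "\<And>y. y \<in> topspace (subshift u) \<Longrightarrow> (\<forall>i<n. y i = word_shift x i) \<Longrightarrow> y \<in> U"
      using U unfolding openin_subshift by blast
    have "word_shift y \<in> U" if "y \<in> topspace (subshift u)" "\<forall>i<Suc n. y i = x i" for y
      using that by (intro n shift_in_subshift) (auto simp: word_shift_def)
    then show "\<exists>n. \<forall>y\<in>topspace (subshift u). (\<forall>i<n. y i = x i) \<longrightarrow>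
        y \<in> {x \<in> topspace (subshift u). word_shift x \<in> U}"
      by (intro exI[of _ "Suc n"]) blast
  qed auto
qed (auto intro: shift_in_subshift)

section \<open>Uniform recurrence and the solution of the coboundary equation\<close>

locale minimal_word =
  fixes u :: "nat \<Rightarrow> 'a::finite"
  assumes minimal: "minimal_system (subshift u) word_shift"
begin

abbreviation X :: "(nat \<Rightarrow> 'a) set" where "X \<equiv> topspace (subshift u)"

text \<open>Compactness makes the image closed, and by minimality a nonempty closed shift-stable set
  is the whole space.\<close>

lemma shift_surj: "word_shift ` X = X"
proof -
  have "closed_map (subshift u) (subshift u) word_shift"
    by (intro continuous_imp_closed_map continuous_map_word_shift compact_space_subshift Hausdorff_space_subshift)
  then have "closedin (subshift u) (word_shift ` X)"
    by (simp add: closed_map_def)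
  moreover have "word_shift ` X \<noteq> {}"
    using in_subshift_self by blast
  moreover have "word_shift ` word_shift ` X \<subseteq> word_shift ` X"
    using shift_in_subshift by (intro image_mono) blast
  ultimately show ?thesis
    using minimal by (simp add: minimal_system_def)
qed

text \<open>The words in which the prefix of length \<open>K\<close> never occurs form a closed
  shift-stable set that misses \<open>u\<close>, so minimality makes it empty; compactness then
  bounds the waiting time.\<close>

lemma prefix_recurrence:
  "\<exists>N. \<forall>x\<in>X. \<exists>k\<le>N. \<forall>i<K. x (k + i) = u i"
proof -
  define U where "U k = {x \<in> X. \<forall>i<K. x (k + i) = u i}" for k
  have op: "openin (subshift u) (U k)" for k
    unfolding openin_subshift
  proof (intro conjI ballI)
    fix x assume "x \<in> U k"
    then show "\<exists>n. \<forall>y\<in>X. (\<forall>i<n. y i = x i) \<longrightarrow> y \<in> U k"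
      by (intro exI[of _ "k + K"]) (auto simp: U_def)
  qed (auto simp: U_def)
  have "X - (\<Union>k. U k) = {}"
  proof (rule ccontr)
    assume "X - (\<Union>k. U k) \<noteq> {}"
    moreover have "closedin (subshift u) (X - (\<Union>k. U k))"
      using op by (intro closedin_diff) auto
    moreover have "word_shift x \<in> X - (\<Union>k. U k)" if x: "x \<in> X - (\<Union>k. U k)" for x
    proof -
      have "word_shift x \<notin> U k" for k
      proof
        assume "word_shift x \<in> U k"
        then have "x \<in> U (Suc k)" using x by (auto simp: U_def word_shift_def)
        with x show False by blast
      qed
      then show ?thesis using x shift_in_subshift by blast
    qed
    ultimately have "X - (\<Union>k. U k) = X"
      using minimal by (simp add: minimal_system_def image_subset_iff)
    moreover have "u \<in> U 0" using in_subshift_self by (auto simp: U_def)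
    ultimately show False using in_subshift_self by blast
  qed
  then have "X \<subseteq> \<Union>(range U)" by blast
  then obtain \<F> where \<F>: "finite \<F>" "\<F> \<subseteq> range U" "X \<subseteq> \<Union>\<F>"
    using compact_space_subshift[of u] op unfolding compact_space_alt by (metis (no_types, lifting) rangeE)
  then obtain J where J: "finite J" "\<F> = U ` J"
    using finite_subset_image[of \<F> U UNIV] by auto
  obtain N where N: "\<And>k. k \<in> J \<Longrightarrow> k \<le> N"
    using J(1) finite_nat_set_iff_bounded_le by auto
  have "\<exists>k\<le>N. \<forall>i<K. x (k + i) = u i" if x: "x \<in> X" for x
  proof -
    obtain k where "k \<in> J" "x \<in> U k" using x \<F>(3) J(2) by auto
    then show ?thesis using N[of k] by (auto simp: U_def)
  qed
  then show ?thesis by blast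
qed

text \<open>
  A bounded cocycle over a minimal system is a coboundary (Gottschalk--Hedlund). The key point:
  if the sums up to \<open>p\<close> and \<open>q\<close> almost realise the supremum and the infimum, then an occurrence of a
  prefix containing both positions can only start where the sum is almost \<open>0\<close>.
\<close>

lemma bounded_sums_modulus_real:
  fixes f :: "'a \<Rightarrow> real"
  assumes bd: "bounded (range (\<lambda>m. \<Sum>k<m. f (u k)))" and "\<epsilon> > 0"
  shows "\<exists>N. \<forall>m m'. (\<forall>i<N. u (m + i) = u (m' + i)) \<longrightarrow>
    \<bar>(\<Sum>k<m. f (u k)) - (\<Sum>k<m'. f (u k))\<bar> \<le> \<epsilon>"
proof -
  define F where "F m = (\<Sum>k<m. f (u k))" for m
  have F_add: "F (m + k) = F m + (\<Sum>i<k. f (u (m + i)))" for m k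
    unfolding F_def by (induction k) simp_all
  have bdd: "bdd_above (range F)" "bdd_below (range F)"
    using bounded_imp_bdd_above[OF bd] bounded_imp_bdd_below[OF bd] by (simp_all add: F_def[abs_def])
  have "\<exists>p. Sup (range F) - \<epsilon> / 2 < F p"
    using less_cSupD[of "range F" "Sup (range F) - \<epsilon> / 2"] \<open>\<epsilon> > 0\<close> by auto
  then obtain p where p: "Sup (range F) - \<epsilon> / 2 < F p" by blast
  have "\<exists>q. F q < Inf (range F) + \<epsilon> / 2"
    using cInf_lessD[of "range F" "Inf (range F) + \<epsilon> / 2"] \<open>\<epsilon> > 0\<close> by auto
  then obtain q where q: "F q < Inf (range F) + \<epsilon> / 2" by blast
  \<comment> \<open>The first \<open>K\<close> letters determine both the sum up to \<open>p\<close>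
    and the sum up to \<open>q\<close>.\<close>
  define K where "K = max p q"
  obtain N where "\<forall>x\<in>X. \<exists>k\<le>N. \<forall>i<K. x (k + i) = u i"
    using prefix_recurrence[of K] by (rule exE)
  note N = bspec[OF this]
  have small: "\<bar>F m\<bar> \<le> \<epsilon> / 2" if "\<forall>i<K. u (m + i) = u i" for m
  proof -
    have "(\<Sum>i<p. f (u (m + i))) = F p" "(\<Sum>i<q. f (u (m + i))) = F q"
      unfolding F_def using that by (auto simp: K_def intro!: sum.cong)
    then have "F (m + p) = F m + F p" "F (m + q) = F m + F q"
      by (simp_all add: F_add)
    moreover have "F (m + p) \<le> Sup (range F)" "Inf (range F) \<le> F (m + q)"
      using bdd by (auto intro: cSup_upper cInf_lower)
    ultimately show ?thesis using p q by linarith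
  qed
  \<comment> \<open>The window \<open>N + K\<close> holds a whole occurrence of the prefix, since
    one starts at some \<open>k \<le> N\<close>. Both words see it at the same offset, with equal
    sums before it.\<close>
  have "\<bar>F m - F m'\<bar> \<le> \<epsilon>" if agree: "\<forall>i<N + K. u (m + i) = u (m' + i)" for m m'
  proof -
    obtain k where k: "k \<le> N" "\<forall>i<K. u (m + (k + i)) = u i"
      using N[OF orbit_in_subshift] by blast
    then have "\<forall>i<K. u (m' + (k + i)) = u i" using agree by auto
    with k have "\<bar>F (m + k)\<bar> \<le> \<epsilon> / 2" "\<bar>F (m' + k)\<bar> \<le> \<epsilon> / 2"
      using small[of "m + k"] small[of "m' + k"] by (simp_all add: add.assoc)
    moreover have "(\<Sum>i<k. f (u (m + i))) = (\<Sum>i<k. f (u (m' + i)))"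
      using agree k(1) by (intro sum.cong) auto
    ultimately show ?thesis unfolding F_add by linarith
  qed
  then show ?thesis unfolding F_def by blast
qed

lemma bounded_sums_modulus:
  fixes f :: "'a \<Rightarrow> 'e::euclidean_space"
  assumes bd: "bounded (range (\<lambda>m. \<Sum>k<m. f (u k)))" and "\<epsilon> > 0"
  shows "\<exists>N. \<forall>m m'. (\<forall>i<N. u (m + i) = u (m' + i)) \<longrightarrow>
    norm ((\<Sum>k<m. f (u k)) - (\<Sum>k<m'. f (u k))) \<le> \<epsilon>"
proof -
  let ?F = "\<lambda>m. \<Sum>k<m. f (u k)"
  \<comment> \<open>The norm is at most the sum of the absolute coordinates, each of which receives
    an equal share of \<open>\<epsilon>\<close>.\<close>
  define \<delta> where "\<delta> = \<epsilon> / real DIM('e)"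
  have "\<delta> > 0" using \<open>\<epsilon> > 0\<close> by (simp add: \<delta>_def)
  have "\<exists>N. \<forall>m m'. (\<forall>i<N. u (m + i) = u (m' + i)) \<longrightarrow> \<bar>?F m \<bullet> b - ?F m' \<bullet> b\<bar> \<le> \<delta>"
    if b: "b \<in> Basis" for b
  proof -
    have "bounded ((\<lambda>x. x \<bullet> b) ` range ?F)"
      using bd by (rule bounded_linear_image) (rule bounded_linear_inner_left)
    then have "bounded (range (\<lambda>m. \<Sum>k<m. f (u k) \<bullet> b))"
      by (simp add: image_image inner_sum_left)
    then show ?thesis
      using bounded_sums_modulus_real[of "\<lambda>a. f a \<bullet> b" \<delta>] \<open>\<delta> > 0\<close> by (simp add: inner_sum_left)
  qed
  then obtain N where N: "\<And>b m m'. b \<in> Basis \<Longrightarrow> (\<forall>i<N b. u (m + i) = u (m' + i)) \<Longrightarrow>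
      \<bar>?F m \<bullet> b - ?F m' \<bullet> b\<bar> \<le> \<delta>"
    by metis
  have "norm (?F m - ?F m') \<le> \<epsilon>" if "\<forall>i<Max (N ` Basis). u (m + i) = u (m' + i)" for m m'
  proof -
    have "norm (?F m - ?F m') \<le> (\<Sum>b\<in>Basis. \<bar>(?F m - ?F m') \<bullet> b\<bar>)"
      by (rule norm_le_l1)
    also have "\<dots> \<le> (\<Sum>b\<in>(Basis :: 'e set). \<delta>)"
    proof (rule sum_mono)
      fix b :: 'e assume b: "b \<in> Basis"
      have "N b \<le> Max (N ` Basis)" using b by simp
      then show "\<bar>(?F m - ?F m') \<bullet> b\<bar> \<le> \<delta>"
        using that by (simp add: inner_diff_left) (intro N b, auto)
    qed
    also have "\<dots> = \<epsilon>" by (simp add: \<delta>_def)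
    finally show ?thesis .
  qed
  then show ?thesis by blast
qed

text \<open>By \<open>bounded_sums_modulus\<close> the partial sum at time \<open>m\<close> is
  determined up to \<open>\<epsilon>\<close> by finitely many letters of \<open>u\<close> from
  \<open>m\<close> on. The sums are therefore uniformly continuous along the orbit of
  \<open>u\<close> and extend to its closure; \<open>g\<close> is this extension.\<close>

lemma coboundary:
  fixes f :: "'a \<Rightarrow> 'e::euclidean_space"
  assumes bd: "bounded (range (\<lambda>m. \<Sum>k<m. f (u k)))"
  obtains g where "continuous_map (subshift u) euclidean g"
    "\<And>x. x \<in> X \<Longrightarrow> g (word_shift x) = g x + f (x 0)"
    "\<And>A. g ` {x \<in> X. x 0 \<in> A} = closure {\<Sum>k<m. f (u k) | m. u m \<in> A}"
proof -
  define F where "F m = (\<Sum>k<m. f (u k))" for m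
  have F_Suc: "F (Suc m) = F m + f (u m)" for m by (simp add: F_def)
  have mod: "\<exists>N. \<forall>m m'. (\<forall>i<N. u (m + i) = u (m' + i)) \<longrightarrow> norm (F m - F m') \<le> \<epsilon>" if "\<epsilon> > 0" for \<epsilon>
    using bounded_sums_modulus[OF bd that] by (simp add: F_def)
  \<comment> \<open>A place in \<open>u\<close> where the first \<open>n\<close> letters of
    \<open>x\<close> occur; which one is chosen does not matter in the limit.\<close>
  define pos where "pos x n = (SOME m. \<forall>i<n. x i = u (m + i))" for x n
  have pos: "\<forall>i<n. x i = u (pos x n + i)" if "x \<in> X" for x n
    unfolding pos_def by (rule someI_ex) (use that in \<open>auto simp: topspace_subshift\<close>)
  define g where "g x = lim (\<lambda>n. F (pos x n))" for x
  \<comment> \<open>The estimate is uniform in \<open>x\<close> and in the occurrence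
    \<open>m\<close>; all properties of \<open>g\<close> below rest on it rather than on the
    limit.\<close>
  have approx: "\<exists>N. \<forall>x\<in>X. \<forall>m. (\<forall>i<N. x i = u (m + i)) \<longrightarrow> norm (F m - g x) \<le> \<epsilon>"
    if \<epsilon>: "\<epsilon> > 0" for \<epsilon>
  proof -
    obtain N where N: "\<And>m m'. (\<forall>i<N. u (m + i) = u (m' + i)) \<Longrightarrow> norm (F m - F m') \<le> \<epsilon>"
      using mod[OF \<epsilon>] by blast
    have "norm (F m - g x) \<le> \<epsilon>" if x: "x \<in> X" and m: "\<forall>i<N. x i = u (m + i)" for x m
    proof -
      have "Cauchy (\<lambda>n. F (pos x n))"
        unfolding Cauchy_iff
      proof (intro allI impI)
        fix \<delta> :: real assume "\<delta> > 0"
        then obtain M where M: "\<And>m m'. (\<forall>i<M. u (m + i) = u (m' + i)) \<Longrightarrow> norm (F m - F m') \<le> \<delta> / 2"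
          using mod[of "\<delta> / 2"] by auto
        have "norm (F (pos x n) - F (pos x n')) < \<delta>" if "n \<ge> M" "n' \<ge> M" for n n'
        proof -
          have "\<forall>i<M. u (pos x n + i) = u (pos x n' + i)"
            using that pos[OF x, of n] pos[OF x, of n'] by (metis order_less_le_trans)
          then have "norm (F (pos x n) - F (pos x n')) \<le> \<delta> / 2" by (rule M)
          then show ?thesis using \<open>\<delta> > 0\<close> by linarith
        qed
        then show "\<exists>M. \<forall>m\<ge>M. \<forall>n\<ge>M. norm (F (pos x m) - F (pos x n)) < \<delta>" by blast
      qed
      then have "(\<lambda>n. F (pos x n)) \<longlonglongrightarrow> g x"
        unfolding g_def by (simp add: Cauchy_convergent convergent_LIMSEQ_iff[symmetric])
      then have "(\<lambda>n. norm (F m - F (pos x n))) \<longlonglongrightarrow> norm (F m - g x)"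
        by (intro tendsto_intros)
      moreover have "\<forall>n\<ge>N. norm (F m - F (pos x n)) \<le> \<epsilon>"
      proof (intro allI impI N)
        fix n i assume "N \<le> n" "i < N"
        then show "u (m + i) = u (pos x n + i)"
          using m pos[OF x, of n] by (metis order_less_le_trans)
      qed
      ultimately show ?thesis
        by (rule Lim_bounded)
    qed
    then show ?thesis by blast
  qed
  have g_orbit: "g (\<lambda>i. u (m + i)) = F m" for m
  proof -
    have "norm (F m - g (\<lambda>i. u (m + i))) \<le> 0"
    proof (rule field_le_epsilon)
      fix \<epsilon> :: real assume "\<epsilon> > 0"
      then obtain N where "\<forall>x\<in>X. \<forall>m. (\<forall>i<N. x i = u (m + i)) \<longrightarrow> norm (F m - g x) \<le> \<epsilon>"
        using approx by blast
      from bspec[OF this orbit_in_subshift[of u m]]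
      show "norm (F m - g (\<lambda>i. u (m + i))) \<le> 0 + \<epsilon>" by simp
    qed
    then show ?thesis by simp
  qed
  have cont: "continuous_map (subshift u) euclidean g"
    unfolding continuous_map_def
  proof (intro conjI allI impI)
    fix U :: "'e set" assume "openin euclidean U"
    then have U: "open U" by simp
    show "openin (subshift u) {x \<in> X. g x \<in> U}"
      unfolding openin_subshift
    proof (intro conjI ballI)
      fix x assume x: "x \<in> {x \<in> X. g x \<in> U}"
      then obtain \<epsilon> where \<epsilon>: "\<epsilon> > 0" "ball (g x) \<epsilon> \<subseteq> U"
        using U open_contains_ball by blast
      \<comment> \<open>With a third of \<open>\<epsilon>\<close>, the two errors below add up to
        strictly less than \<open>\<epsilon>\<close>.\<close>
      then obtain N where N: "\<And>x m. x \<in> X \<Longrightarrow> (\<forall>i<N. x i = u (m + i)) \<Longrightarrow> norm (F m - g x) \<le> \<epsilon> / 3"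
        using approx[of "\<epsilon> / 3"] by (meson divide_pos_pos zero_less_numeral)
      have "g y \<in> U" if y: "y \<in> X" "\<forall>i<N. y i = x i" for y
      proof -
        have "norm (F (pos x N) - g x) \<le> \<epsilon> / 3" "norm (F (pos x N) - g y) \<le> \<epsilon> / 3"
          using N[of x "pos x N"] N[of y "pos x N"] pos[of x N] x y by simp_all
        then have "dist (g x) (g y) \<le> \<epsilon> / 3 + \<epsilon> / 3"
          by (metis dist_norm dist_commute dist_triangle_le add_mono)
        then have "g y \<in> ball (g x) \<epsilon>" using \<epsilon>(1) by simp
        then show ?thesis using \<epsilon>(2) by blast
      qed
      then show "\<exists>n. \<forall>y\<in>X. (\<forall>i<n. y i = x i) \<longrightarrow> y \<in> {x \<in> X. g x \<in> U}"
        by (intro exI[of _ N]) auto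
    qed auto
  qed auto
  have shift: "g (word_shift x) = g x + f (x 0)" if x: "x \<in> X" for x
  proof -
    have "norm (g (word_shift x) - (g x + f (x 0))) \<le> 0"
    proof (rule field_le_epsilon)
      fix \<epsilon> :: real assume "\<epsilon> > 0"
      then obtain N where N: "\<And>x m. x \<in> X \<Longrightarrow> (\<forall>i<N. x i = u (m + i)) \<Longrightarrow> norm (F m - g x) \<le> \<epsilon> / 2"
        using approx[of "\<epsilon> / 2"] by (meson divide_pos_pos zero_less_numeral)
      \<comment> \<open>One letter more than \<open>N\<close>: after the shift \<open>N\<close>
        letters still agree, and \<open>x 0 = u m\<close> even when \<open>N = 0\<close>.\<close>
      define m where "m = pos x (Suc N)"
      have m: "\<forall>i<Suc N. x i = u (m + i)" unfolding m_def by (rule pos[OF x])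
      have "norm (F m - g x) \<le> \<epsilon> / 2"
        using m by (intro N x) auto
      moreover have "norm (F (Suc m) - g (word_shift x)) \<le> \<epsilon> / 2"
        using m by (intro N shift_in_subshift x) (auto simp: word_shift_def)
      moreover have "g (word_shift x) - (g x + f (x 0)) = (F m - g x) - (F (Suc m) - g (word_shift x))"
        using m by (simp add: F_Suc)
      ultimately show "norm (g (word_shift x) - (g x + f (x 0))) \<le> 0 + \<epsilon>"
        using norm_triangle_ineq4[of "F m - g x" "F (Suc m) - g (word_shift x)"] by (simp only:)
    qed
    then show ?thesis by simp
  qed
  have image: "g ` {x \<in> X. x 0 \<in> A} = closure {F m | m. u m \<in> A}" for A
  proof (intro antisym subsetI)
    fix y assume "y \<in> g ` {x \<in> X. x 0 \<in> A}"
    then obtain x where x: "x \<in> X" "x 0 \<in> A" "y = g x" by blast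
    show "y \<in> closure {F m | m. u m \<in> A}"
      unfolding closure_approachable
    proof (intro allI impI)
      fix \<epsilon> :: real assume "\<epsilon> > 0"
      then obtain N where N: "\<And>x m. x \<in> X \<Longrightarrow> (\<forall>i<N. x i = u (m + i)) \<Longrightarrow> norm (F m - g x) \<le> \<epsilon> / 2"
        using approx[of "\<epsilon> / 2"] by (meson divide_pos_pos zero_less_numeral)
      \<comment> \<open>The extra letter ensures that position \<open>0\<close> is compared, so that
        \<open>u m\<close> lies in \<open>A\<close>.\<close>
      define m where "m = pos x (Suc N)"
      have m: "\<forall>i<Suc N. x i = u (m + i)" unfolding m_def by (rule pos[OF x(1)])
      have "norm (F m - g x) \<le> \<epsilon> / 2"
        using m by (intro N x) auto
      moreover have "u m \<in> A" using m x(2) by auto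
      ultimately show "\<exists>z\<in>{F m | m. u m \<in> A}. dist z y < \<epsilon>"
        using \<open>\<epsilon> > 0\<close> x(3) by (intro bexI[of _ "F m"]) (auto simp: dist_norm)
    qed
  next
    \<comment> \<open>The cylinder is compact, so its image is closed; along the orbit of
      \<open>u\<close> the map \<open>g\<close> takes the partial sums as values, so the image
      contains them.\<close>
    have "closedin (subshift u) {x \<in> X. x 0 \<in> A}"
    proof -
      have "openin (subshift u) {x \<in> X. x 0 \<notin> A}"
        unfolding openin_subshift by (auto intro!: exI[of _ 1])
      moreover have "X - {x \<in> X. x 0 \<in> A} = {x \<in> X. x 0 \<notin> A}" by auto
      ultimately show ?thesis by (auto simp: closedin_def)
    qed
    then have "compactin (subshift u) {x \<in> X. x 0 \<in> A}"
      by (intro closedin_compact_space compact_space_subshift)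
    then have "compact (g ` {x \<in> X. x 0 \<in> A})"
      using image_compactin[OF _ cont] by simp
    moreover have "{F m | m. u m \<in> A} \<subseteq> g ` {x \<in> X. x 0 \<in> A}"
    proof
      fix y assume "y \<in> {F m | m. u m \<in> A}"
      then obtain m where "u m \<in> A" "y = g (\<lambda>i. u (m + i))" by (auto simp: g_orbit)
      then show "y \<in> g ` {x \<in> X. x 0 \<in> A}"
        using orbit_in_subshift[of u m] by (intro image_eqI[of _ _ "\<lambda>i. u (m + i)"]) auto
    qed
    ultimately have "closure {F m | m. u m \<in> A} \<subseteq> g ` {x \<in> X. x 0 \<in> A}"
      by (intro closure_minimal compact_imp_closed)
    then show "y \<in> g ` {x \<in> X. x 0 \<in> A}" if "y \<in> closure {F m | m. u m \<in> A}" for y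
      using that by blast
  qed
  show thesis
    using that[OF cont shift] image unfolding F_def by blast
qed

end

section \<open>Projections with dense integer points\<close>

text \<open>The linear form with value \<open>1\<close> on every basis vector. Among the integer
  vectors its kernel is \<open>Gamma0\<close>.\<close>

definition coord_sum :: "real ^ 'a::finite \<Rightarrow> real" where
  "coord_sum x = (\<Sum>a\<in>UNIV. x $ a)"

lemma linear_coord_sum: "linear coord_sum"
  unfolding coord_sum_def
  by (rule linearI) (simp_all add: sum.distrib sum_distrib_left)

lemma coord_sum_unit_vec [simp]: "coord_sum (unit_vec a) = 1"
  by (simp add: coord_sum_def axis_def)

lemma unit_vec_integer: "unit_vec a \<in> integer_vectors"
  by (simp add: integer_vectors_def axis_def)

lemma integer_vectors_add: "x \<in> integer_vectors \<Longrightarrow> y \<in> integer_vectors \<Longrightarrow> x + y \<in> integer_vectors"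
  and integer_vectors_diff: "x \<in> integer_vectors \<Longrightarrow> y \<in> integer_vectors \<Longrightarrow> x - y \<in> integer_vectors"
  by (simp_all add: integer_vectors_def)

lemma countable_integer_vectors: "countable (integer_vectors :: (real ^ 'a::finite) set)"
proof -
  have "(integer_vectors :: (real ^ 'a) set) \<subseteq> range (\<lambda>f. \<chi> a. real_of_int (f a))"
  proof
    fix x :: "real ^ 'a" assume "x \<in> integer_vectors"
    then have "x = (\<chi> a. real_of_int \<lfloor>x $ a\<rfloor>)"
      by (simp add: vec_eq_iff integer_vectors_def)
    then show "x \<in> range (\<lambda>f. \<chi> a. real_of_int (f a))"
      by (intro image_eqI[of _ _ "\<lambda>a. \<lfloor>x $ a\<rfloor>"]) simp_all
  qed
  moreover have "countable (range (\<lambda>f. (\<chi> a. real_of_int (f a)) :: real ^ 'a))"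
    by simp
  ultimately show ?thesis by (rule countable_subset)
qed

lemma Gamma0_subset: "x \<in> Gamma0 \<Longrightarrow> x \<in> integer_vectors \<and> coord_sum x = 0"
  unfolding Gamma0_def
proof (induction rule: group_closure.induct)
  case (base s)
  then show ?case
    by (auto simp: linear_diff[OF linear_coord_sum] linear_0[OF linear_coord_sum]
        intro: integer_vectors_diff unit_vec_integer) (simp add: integer_vectors_def)
next
  case (diff s t)
  then show ?case
    by (simp add: linear_diff[OF linear_coord_sum] integer_vectors_diff)
qed

lemma group_closure_finite_sum:
  assumes "\<And>i. i \<in> I \<Longrightarrow> f i \<in> group_closure S"
  shows "sum f I \<in> group_closure S"
  using assms by (induction I rule: infinite_finite_induct) (auto intro: group_closure_add)

lemma group_closure_of_int_scaleR:
  fixes s :: "'v::real_vector"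
  assumes "s \<in> group_closure S"
  shows "of_int k *\<^sub>R s \<in> group_closure S"
proof -
  have nat: "of_nat n *\<^sub>R s \<in> group_closure S" for n
    using assms by (induction n) (auto simp: scaleR_add_left intro: group_closure_add)
  show ?thesis
  proof (cases "k \<ge> 0")
    case True
    then show ?thesis using nat[of "nat k"] by simp
  next
    case False
    then have "of_int k *\<^sub>R s = - (of_nat (nat (- k)) *\<^sub>R s)" by simp
    then show ?thesis using nat by (metis group_closure_minus_iff)
  qed
qed

text \<open>Each \<open>unit_vec b\<close> is \<open>(unit_vec b - unit_vec a) + unit_vec a\<close>,
  which splits off a part in \<open>Gamma0\<close>; \<open>k\<close> is the sum of the coordinates
  of \<open>x\<close>.\<close>

lemma integer_vector_decompose:
  fixes x :: "real ^ 'a::finite"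
  assumes "x \<in> integer_vectors"
  obtains k l where "l \<in> Gamma0" "x = l + of_int k *\<^sub>R unit_vec a"
proof -
  define n where "n b = \<lfloor>x $ b\<rfloor>" for b
  have n: "x $ b = of_int (n b)" for b
    using assms by (simp add: integer_vectors_def n_def)
  define l where "l = (\<Sum>b\<in>UNIV. of_int (n b) *\<^sub>R (unit_vec b - unit_vec a))"
  have "l \<in> Gamma0"
    unfolding l_def Gamma0_def
    by (intro group_closure_finite_sum group_closure_of_int_scaleR group_closure.base) blast
  moreover have "x = (\<Sum>b\<in>UNIV. of_int (n b) *\<^sub>R unit_vec b)"
    using basis_expansion[of x] n by (simp add: scalar_mult_eq_scaleR)
  then have "x = l + of_int (\<Sum>b\<in>UNIV. n b) *\<^sub>R unit_vec a"
    by (simp add: l_def scaleR_diff_right sum_subtractf scaleR_sum_left of_int_sum)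
  ultimately show thesis using that by blast
qed

locale hyperplane_projection =
  fixes \<pi> :: "real ^ 'a \<Rightarrow> real ^ 'a::finite" and P
  assumes proj: "projection_onto_hyperplane \<pi> P"
    and dense: "closure (\<pi> ` integer_vectors) = P"
begin

lemma linear_\<pi>: "linear \<pi>" and range_\<pi>: "range \<pi> = P" and \<pi>_idem: "x \<in> P \<Longrightarrow> \<pi> x = x"
  and dim_P: "Suc (dim P) = CARD('a)"
  using proj by (auto simp: projection_onto_hyperplane_def)

lemma \<pi>_in_P: "\<pi> x \<in> P"
  using range_\<pi> by blast

lemma subspace_P: "subspace P"
  using linear_subspace_image[OF linear_\<pi> subspace_UNIV] range_\<pi> by simp

text \<open>The kernel meets \<open>P\<close> only in \<open>0\<close>, so two independent kernel
  vectors adjoined to \<open>P\<close> would exceed the dimension of the whole space.\<close>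

lemma kernel_1_dim:
  assumes "\<pi> x = 0" "x \<noteq> 0" "\<pi> y = 0"
  shows "y \<in> span {x}"
proof (rule ccontr)
  assume y: "y \<notin> span {x}"
  have x: "x \<notin> span P"
    using assms(1,2) \<pi>_idem[of x] by (auto simp: span_eq_iff[THEN iffD2, OF subspace_P])
  have "y \<notin> span (insert x P)"
  proof
    assume "y \<in> span (insert x P)"
    then obtain k where k: "y - k *\<^sub>R x \<in> P"
      unfolding span_breakdown_eq by (auto simp: span_eq_iff[THEN iffD2, OF subspace_P])
    have "y - k *\<^sub>R x = \<pi> (y - k *\<^sub>R x)"
      using \<pi>_idem[OF k] by simp
    also have "\<dots> = 0"
      using assms by (simp add: linear_diff[OF linear_\<pi>] linear_scale[OF linear_\<pi>])
    finally have "y = k *\<^sub>R x" by simp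
    with y show False by (simp add: span_base span_scale)
  qed
  then have "dim (insert y (insert x P)) = dim P + 2"
    using x by (simp add: dim_insert)
  then show False
    using dim_P dim_subset_UNIV[of "insert y (insert x P)"] by simp
qed

text \<open>If the kernel of \<open>\<pi>\<close> met the hyperplane \<open>coord_sum = 0\<close>, then \<open>coord_sum\<close> would factor through
  \<open>\<pi>\<close>, so it would take integral values on a dense subset of the subspace \<open>P\<close>.\<close>

lemma inj_on_coord_sum_0:
  assumes "coord_sum x = 0" "\<pi> x = 0"
  shows "x = 0"
proof (rule ccontr)
  assume "x \<noteq> 0"
  have factor: "coord_sum (\<pi> y) = coord_sum y" for y
  proof -
    have "\<pi> (\<pi> y - y) = 0"
      by (simp add: linear_diff[OF linear_\<pi>] \<pi>_idem[OF \<pi>_in_P])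
    then have "\<pi> y - y \<in> span {x}"
      using kernel_1_dim assms(2) \<open>x \<noteq> 0\<close> by blast
    then obtain k where "\<pi> y - y = k *\<^sub>R x" by (auto simp: span_singleton)
    then have "coord_sum (\<pi> y - y) = 0"
      using assms(1) by (simp add: linear_scale[OF linear_coord_sum])
    then show ?thesis by (simp add: linear_diff[OF linear_coord_sum])
  qed
  have "coord_sum ` closure (\<pi> ` integer_vectors) \<subseteq> \<int>"
  proof (rule image_closure_subset)
    show "continuous_on (closure (\<pi> ` integer_vectors)) coord_sum"
      using linear_coord_sum by (intro linear_continuous_on) (simp add: linear_conv_bounded_linear)
    show "closed (\<int> :: real set)" by (rule closed_Ints)
    have "coord_sum y \<in> \<int>" if "y \<in> integer_vectors" for y :: "real ^ 'a"
      using that by (auto simp: coord_sum_def integer_vectors_def)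
    then show "coord_sum ` \<pi> ` integer_vectors \<subseteq> \<int>"
      using factor by auto
  qed
  \<comment> \<open>The subspace \<open>P\<close> allows halving, but \<open>coord_sum\<close> of
    this vector is \<open>1 / 2\<close>; \<open>undefined\<close> stands for some letter.\<close>
  moreover have "(1 / 2) *\<^sub>R \<pi> (unit_vec undefined) \<in> P"
    using subspace_P \<pi>_in_P by (rule subspace_scale)
  ultimately have "coord_sum ((1 / 2) *\<^sub>R \<pi> (unit_vec undefined)) \<in> \<int>"
    using dense by blast
  then have "(1 / 2 :: real) \<in> \<int>"
    by (simp add: linear_scale[OF linear_coord_sum] factor)
  then obtain k :: int where "(1 / 2 :: real) = of_int k" by (auto elim: Ints_cases)
  then have "(1 :: real) = of_int (2 * k)" by simp
  then have "1 = 2 * k" by (metis of_int_1 of_int_eq_iff)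
  then show False by presburger
qed

lemma \<pi>_unit_vec_diff: "\<pi> (unit_vec a) - \<pi> (unit_vec b) \<in> \<pi> ` Gamma0"
proof -
  have "unit_vec a - unit_vec b \<in> (Gamma0 :: (real ^ 'a) set)"
    unfolding Gamma0_def by (rule group_closure.base) blast
  then show ?thesis by (metis image_eqI linear_diff[OF linear_\<pi>])
qed

text \<open>Discreteness comes from \<open>inj_on_coord_sum_0\<close>. Density of the orbit holds
  because, by \<open>integer_vector_decompose\<close>, the lattice and the image of one basis vector
  generate all projected integer vectors.\<close>

lemma minimal_translation: "minimal_translation P (\<pi> ` Gamma0) (\<pi> (unit_vec a))"
proof
  show "subspace P" by (rule subspace_P)
  show "\<pi> ` Gamma0 \<subseteq> P" using \<pi>_in_P by blast
  have "0 \<in> (Gamma0 :: (real ^ 'a) set)" by (simp add: Gamma0_def)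
  then show "0 \<in> \<pi> ` Gamma0" by (metis image_eqI linear_0[OF linear_\<pi>])
  show "s - t \<in> \<pi> ` Gamma0" if st: "s \<in> \<pi> ` Gamma0" "t \<in> \<pi> ` Gamma0" for s t
  proof -
    obtain x y where xy: "x \<in> Gamma0" "y \<in> Gamma0" "s = \<pi> x" "t = \<pi> y" using st by blast
    then have "x - y \<in> Gamma0" unfolding Gamma0_def by (intro group_closure.diff)
    then show ?thesis using xy by (metis image_eqI linear_diff[OF linear_\<pi>])
  qed
  show "countable (\<pi> ` Gamma0)"
    using countable_subset[OF _ countable_integer_vectors] Gamma0_subset by blast
  show "\<exists>r>0. \<forall>t\<in>\<pi> ` Gamma0. norm t < r \<longrightarrow> t = 0"
  proof -
    have sub: "subspace {x :: real ^ 'a. coord_sum x = 0}"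
      by (simp add: subspace_def linear_0[OF linear_coord_sum] linear_add[OF linear_coord_sum]
          linear_scale[OF linear_coord_sum])
    \<comment> \<open>On the hyperplane the injective map \<open>\<pi>\<close> shrinks norms at most
      by a factor \<open>c\<close>, and a nonzero integer vector has norm at least \<open>1\<close>;
      so \<open>c\<close> itself is a radius of separation.\<close>
    have "\<exists>c>0. \<forall>x\<in>{x. coord_sum x = 0}. c * norm x \<le> norm (\<pi> x)"
      using linear_\<pi> inj_on_coord_sum_0
      by (intro injective_imp_isometric[OF closed_subspace[OF sub] sub])
        (auto simp: linear_conv_bounded_linear)
    then obtain c where c: "c > 0" "\<And>x. coord_sum x = 0 \<Longrightarrow> c * norm x \<le> norm (\<pi> x)"
      by blast
    have "\<pi> x = 0" if x: "x \<in> Gamma0" and small: "norm (\<pi> x) < c" for x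
    proof (rule ccontr)
      assume "\<pi> x \<noteq> 0"
      then have "x \<noteq> 0" using linear_0[OF linear_\<pi>] by auto
      then obtain a where a: "x $ a \<noteq> 0" by (auto simp: vec_eq_iff)
      have "x $ a \<in> \<int>" using Gamma0_subset[OF x] by (simp add: integer_vectors_def)
      then have "1 \<le> \<bar>x $ a\<bar>" using a by (rule Ints_nonzero_abs_ge1)
      also have "\<dots> \<le> norm x" by (rule component_le_norm_cart)
      finally have "c \<le> c * norm x" using c(1) by simp
      also have "\<dots> \<le> norm (\<pi> x)" using Gamma0_subset[OF x] by (intro c) simp
      finally show False using small by simp
    qed
    then show ?thesis using c(1) by blast
  qed
  show "\<pi> (unit_vec a) \<in> P" by (rule \<pi>_in_P)
  have "\<pi> ` integer_vectors \<subseteq> {l + of_int k *\<^sub>R \<pi> (unit_vec a) | l k. l \<in> \<pi> ` Gamma0}"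
  proof
    fix y assume "y \<in> \<pi> ` integer_vectors"
    then obtain x where x: "x \<in> integer_vectors" "y = \<pi> x" by blast
    obtain k l where "l \<in> Gamma0" "x = l + of_int k *\<^sub>R unit_vec a"
      using integer_vector_decompose[OF x(1)] by blast
    then have "y = \<pi> l + of_int k *\<^sub>R \<pi> (unit_vec a)" "\<pi> l \<in> \<pi> ` Gamma0"
      using x(2) by (simp_all add: linear_add[OF linear_\<pi>] linear_scale[OF linear_\<pi>])
    then show "y \<in> {l + of_int k *\<^sub>R \<pi> (unit_vec a) | l k. l \<in> \<pi> ` Gamma0}" by blast
  qed
  then show "P \<subseteq> closure {l + of_int k *\<^sub>R \<pi> (unit_vec a) | l k. l \<in> \<pi> ` Gamma0}"
    using closure_mono dense by blast
qed

end

section \<open>Discrete lines as sets of partial sums of basis vectors\<close>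

lemma Ab_prefix: "Ab (map u [0..<m]) = (\<Sum>k<m. unit_vec (u k))"
  by (induction m) (simp_all add: Ab_def vec_eq_iff axis_def count_list_append)

lemma discrete_line_letter_eq:
  "discrete_line_letter u a = {\<Sum>k<m. unit_vec (u k) | m. u m = a}"
proof -
  have "is_prefix (v @ [a]) u \<longleftrightarrow> (\<exists>m. v = map u [0..<m] \<and> u m = a)" for v
    by (auto simp: is_prefix_def)
  then show ?thesis
    unfolding discrete_line_letter_def by (auto simp flip: Ab_prefix)
qed

lemma discrete_line_eq:
  "discrete_line u = {\<Sum>k<m. unit_vec (u k) | m. True}"
proof -
  have "is_prefix v u \<longleftrightarrow> (\<exists>m. v = map u [0..<m])" for v
    by (auto simp: is_prefix_def)
  then show ?thesis
    unfolding discrete_line_def by (auto simp flip: Ab_prefix)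
qed

section \<open>The position map of a bounded discrete line\<close>

text \<open>Applied to complements the inequality reverses, because both total masses are
  \<open>1\<close>.\<close>

lemma prob_measure_eqI_le:
  assumes "prob_space M" "prob_space N" and sets: "sets M = sets N"
    and le: "\<And>A. A \<in> sets M \<Longrightarrow> emeasure M A \<le> emeasure N A"
  shows "M = N"
proof (rule measure_eqI[OF sets])
  interpret M: prob_space M by fact
  interpret N: prob_space N by fact
  fix A assume A: "A \<in> sets M"
  have "measure M A \<le> measure N A" "measure M (space M - A) \<le> measure N (space M - A)"
    using le[OF A] le[OF sets.compl_sets[OF A]] by (simp_all add: M.emeasure_eq_measure N.emeasure_eq_measure)
  moreover have "measure M (space M - A) = 1 - measure M A"
    using A by (rule M.prob_compl)
  moreover have "measure N (space M - A) = 1 - measure N A"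
    using A sets N.prob_compl[of A] sets_eq_imp_space_eq[OF sets] by simp
  ultimately show "emeasure M A = emeasure N A"
    by (simp add: M.emeasure_eq_measure N.emeasure_eq_measure)
qed

locale bounded_discrete_line = hyperplane_projection \<pi> P + minimal_word u
  for \<pi> :: "real ^ 'a \<Rightarrow> real ^ 'a::finite" and P and u :: "nat \<Rightarrow> 'a" +
  assumes bounded_line: "bounded (\<pi> ` discrete_line u)"
    and disjoint_pieces: "disjoint_in_measure (lborel_subspace P) UNIV
           (\<lambda>a. closure (\<pi> ` discrete_line_letter u a))"
begin

abbreviation "L \<equiv> \<pi> ` Gamma0"
text \<open>The letter \<open>u 0\<close> is an arbitrary choice: by
  \<open>\<pi>_unit_vec_diff\<close> all letters give the same translation modulo
  \<open>L\<close>.\<close>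

abbreviation "e \<equiv> \<pi> (unit_vec (u 0))"
abbreviation "piece a \<equiv> closure (\<pi> ` discrete_line_letter u a)"
abbreviation "R \<equiv> closure (\<pi> ` discrete_line u)"
abbreviation "Y \<equiv> borel_of (subshift u)"
abbreviation "\<T> \<equiv> borel_of (torus P L)"

sublocale minimal_translation P L e
  by (rule minimal_translation)

lemma image_partial_sums:
  "\<pi> ` {\<Sum>k<m. unit_vec (u k) | m. Q m} = {\<Sum>k<m. \<pi> (unit_vec (u k)) | m. Q m}"
  by (simp add: setcompr_eq_image image_image linear_sum[OF linear_\<pi>])

definition position :: "(nat \<Rightarrow> 'a) \<Rightarrow> real ^ 'a" where
  "position = (SOME position. continuous_map (subshift u) euclidean position \<and>
    (\<forall>x\<in>X. position (word_shift x) = position x + \<pi> (unit_vec (x 0))) \<and>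
    (\<forall>A. position ` {x \<in> X. x 0 \<in> A} = closure {\<Sum>k<m. \<pi> (unit_vec (u k)) | m. u m \<in> A}))"

lemma position: "continuous_map (subshift u) euclidean position"
    "\<And>x. x \<in> X \<Longrightarrow> position (word_shift x) = position x + \<pi> (unit_vec (x 0))"
    "\<And>A. position ` {x \<in> X. x 0 \<in> A} = closure {\<Sum>k<m. \<pi> (unit_vec (u k)) | m. u m \<in> A}"
proof -
  have "\<pi> ` discrete_line u = range (\<lambda>m. \<Sum>k<m. \<pi> (unit_vec (u k)))"
    unfolding discrete_line_eq image_partial_sums by (simp add: full_SetCompr_eq)
  then have "bounded (range (\<lambda>m. \<Sum>k<m. \<pi> (unit_vec (u k))))"
    using bounded_line by simp
  then have "\<exists>position. continuous_map (subshift u) euclidean position \<and>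
    (\<forall>x\<in>X. position (word_shift x) = position x + \<pi> (unit_vec (x 0))) \<and>
    (\<forall>A. position ` {x \<in> X. x 0 \<in> A} = closure {\<Sum>k<m. \<pi> (unit_vec (u k)) | m. u m \<in> A})"
  proof (rule coboundary)
    fix position :: "(nat \<Rightarrow> 'a) \<Rightarrow> real ^ 'a"
    assume "continuous_map (subshift u) euclidean position"
      "\<And>x. x \<in> X \<Longrightarrow> position (word_shift x) = position x + \<pi> (unit_vec (x 0))"
      "\<And>A. position ` {x \<in> X. x 0 \<in> A} = closure {\<Sum>k<m. \<pi> (unit_vec (u k)) | m. u m \<in> A}"
    then show ?thesis by (intro exI[of _ position]) simp
  qed
  from someI_ex[OF this, folded position_def]
  show "continuous_map (subshift u) euclidean position"
    "\<And>x. x \<in> X \<Longrightarrow> position (word_shift x) = position x + \<pi> (unit_vec (x 0))"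
    "\<And>A. position ` {x \<in> X. x 0 \<in> A} = closure {\<Sum>k<m. \<pi> (unit_vec (u k)) | m. u m \<in> A}"
    by blast+
qed

lemma position_piece: "position ` {x \<in> X. x 0 = a} = piece a"
proof -
  have "\<pi> ` discrete_line_letter u a = {\<Sum>k<m. \<pi> (unit_vec (u k)) | m. u m = a}"
    unfolding discrete_line_letter_eq by (rule image_partial_sums)
  then show ?thesis using position(3)[of "{a}"] by simp
qed

lemma position_X: "position ` X = R"
proof -
  have "\<pi> ` discrete_line u = {\<Sum>k<m. \<pi> (unit_vec (u k)) | m. True}"
    unfolding discrete_line_eq by (rule image_partial_sums)
  then show ?thesis using position(3)[of UNIV] by simp
qed

lemma position_in_piece: "x \<in> X \<Longrightarrow> position x \<in> piece (x 0)"
  using position_piece by blast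

lemma position_in_R: "x \<in> X \<Longrightarrow> position x \<in> R"
  using position_X by blast

lemma in_R_iff: "x \<in> R \<longleftrightarrow> (\<exists>a. x \<in> piece a)"
  by (simp add: closure_discrete_line)

lemma R_sub: "R \<subseteq> P"
  using closed_subspace[OF subspace_P] \<pi>_in_P by (intro closure_minimal) auto

lemma piece_sub: "piece a \<subseteq> P"
  using in_R_iff R_sub by blast

lemma compact_R: "compact R"
  using bounded_line by simp

lemma R_sets: "R \<in> sets \<Lambda>" and piece_sets: "piece a \<in> sets \<Lambda>"
  using R_sub piece_sub by (auto simp: sets_\<Lambda>_iff)

lemma piece_translate: "x \<in> piece a \<Longrightarrow> x + \<pi> (unit_vec a) \<in> R"
proof -
  assume "x \<in> piece a"
  then obtain y where "y \<in> X" "y 0 = a" "x = position y" unfolding position_piece[symmetric] by blast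
  then have "x + \<pi> (unit_vec a) = position (word_shift y)" "word_shift y \<in> X"
    using position(2) shift_in_subshift by auto
  then show ?thesis using position_in_R by simp
qed

text \<open>Surjectivity of the shift seen through \<open>position\<close>: the translated pieces
  cover \<open>R\<close>. This permits backward steps in \<open>cover\<close> and the covering
  argument in \<open>invariant_\<mu>\<close>.\<close>

lemma R_preimage: "x \<in> R \<Longrightarrow> \<exists>a. x - \<pi> (unit_vec a) \<in> piece a"
proof -
  assume "x \<in> R"
  then have "x \<in> position ` word_shift ` X" unfolding shift_surj position_X .
  then obtain y where "y \<in> X" "x = position (word_shift y)" by blast
  then have "x - \<pi> (unit_vec (y 0)) \<in> piece (y 0)" using position_in_piece position(2) by simp
  then show ?thesis by blast
qed

text \<open>The set \<open>C = R + L\<close> is closed, being the sum of a compact and a closed set.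
  It contains \<open>0\<close> and is stable under \<open>L\<close>, \<open>e\<close> and
  \<open>- e\<close>, hence contains the dense group of \<open>dense_orbit\<close>.\<close>

lemma cover:
  assumes x: "x \<in> P"
  shows "\<exists>t\<in>L. x + t \<in> R"
proof -
  define C where "C = (\<Union>r\<in>R. \<Union>t\<in>L. {r + t})"
  have C_iff: "y \<in> C \<longleftrightarrow> (\<exists>r\<in>R. y - r \<in> L)" for y
    unfolding C_def by (force simp: algebra_simps)
  have "closed L"
  proof -
    obtain r where r: "r > 0" "\<And>t. t \<in> L \<Longrightarrow> norm t < r \<Longrightarrow> t = 0"
      using L_discrete by blast
    have "\<forall>x\<in>L. \<forall>y\<in>L. dist y x < r \<longrightarrow> y = x"
      using r(2) L_diff unfolding dist_norm by (metis eq_iff_diff_eq_0)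
    with r(1) show ?thesis by (rule discrete_imp_closed)
  qed
  then have closed: "closed C"
    unfolding C_def using compact_R by (intro compact_closed_sums)
  have C_L: "y + l \<in> C" if yl: "y \<in> C" "l \<in> L" for y l
  proof -
    obtain r where r: "r \<in> R" "y - r \<in> L" using yl(1) C_iff by blast
    have "(y - r) + l \<in> L" using r(2) yl(2) by (rule L_add)
    then show ?thesis
      unfolding C_iff using r(1) by (intro bexI[of _ r]) (simp_all add: algebra_simps)
  qed
  have C_e: "y + e \<in> C" if y: "y \<in> C" for y
  proof -
    obtain r where r: "r \<in> R" "y - r \<in> L" using y C_iff by blast
    then obtain a where "r \<in> piece a" using in_R_iff by blast
    then have "r + \<pi> (unit_vec a) \<in> R" by (rule piece_translate)
    moreover have "(y - r) + (e - \<pi> (unit_vec a)) \<in> L"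
      using r(2) \<pi>_unit_vec_diff by (rule L_add)
    ultimately show ?thesis
      unfolding C_iff by (intro bexI[of _ "r + \<pi> (unit_vec a)"]) (simp_all add: algebra_simps)
  qed
  have C_e': "y - e \<in> C" if y: "y \<in> C" for y
  proof -
    obtain r where r: "r \<in> R" "y - r \<in> L" using y C_iff by blast
    then obtain a where a: "r - \<pi> (unit_vec a) \<in> piece a" using R_preimage by blast
    then have "r - \<pi> (unit_vec a) \<in> R" using in_R_iff by blast
    moreover have "(y - r) + (\<pi> (unit_vec a) - e) \<in> L"
      using r(2) \<pi>_unit_vec_diff by (rule L_add)
    ultimately show ?thesis
      unfolding C_iff by (intro bexI[of _ "r - \<pi> (unit_vec a)"]) (simp_all add: algebra_simps)
  qed
  have zero: "0 \<in> C"
  proof -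
    have "0 \<in> \<pi> ` discrete_line u"
      unfolding discrete_line_eq using linear_0[OF linear_\<pi>]
      by (intro image_eqI[of _ _ 0]) (auto intro!: exI[of _ 0])
    then have "0 \<in> R" by (rule closure_subset[THEN subsetD])
    then show ?thesis
      unfolding C_iff using L_0 by (intro bexI[of _ 0]) simp_all
  qed
  have nat: "of_nat k *\<^sub>R e \<in> C" "- (of_nat k *\<^sub>R e) \<in> C" for k
  proof (induction k)
    case (Suc k)
    show "of_nat (Suc k) *\<^sub>R e \<in> C" using C_e[OF Suc(1)] by (simp add: algebra_simps)
    have "- (of_nat (Suc k) *\<^sub>R e) = - (of_nat k *\<^sub>R e) - e" by (simp add: algebra_simps)
    then show "- (of_nat (Suc k) *\<^sub>R e) \<in> C" using C_e'[OF Suc(2)] by (simp only:)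
  qed (use zero in auto)
  have "of_int k *\<^sub>R e \<in> C" for k
  proof (cases "k \<ge> 0")
    case True
    then show ?thesis using nat(1)[of "nat k"] by simp
  next
    case False
    then show ?thesis using nat(2)[of "nat (- k)"] by simp
  qed
  then have "l + of_int k *\<^sub>R e \<in> C" if "l \<in> L" for l k
    using C_L that by (subst add.commute) blast
  then have "{l + of_int k *\<^sub>R e | l k. l \<in> L} \<subseteq> C" by blast
  then have "P \<subseteq> C"
    using closed by (intro order_trans[OF dense_orbit] closure_minimal)
  then obtain r where "r \<in> R" "x - r \<in> L" using x C_iff by blast
  then have "- (x - r) \<in> L" "x + - (x - r) \<in> R" using L_uminus by (blast, simp)
  then show ?thesis by blast
qed

lemma union_translates: "(\<Union>t\<in>L. (\<lambda>x. x + t) ` R) = P"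
proof (intro antisym subsetI)
  fix x assume "x \<in> P"
  then obtain t where "t \<in> L" "x + t \<in> R" using cover by blast
  moreover have "x = (x + t) + - t" by simp
  ultimately show "x \<in> (\<Union>t\<in>L. (\<lambda>x. x + t) ` R)" using L_uminus by blast
qed (use R_sub L_P P_add in auto)

lemma emeasure_R: "emeasure \<Lambda> R \<noteq> 0" "emeasure \<Lambda> R < \<infinity>"
  using emeasure_cover_nonzero[OF R_sets cover] emeasure_\<Lambda>_bounded[OF compact_imp_bounded[OF compact_R]]
  by auto

text \<open>The very choice made inside \<open>torus_lebesgue\<close>, so that
  \<open>torus_lebesgue_eq\<close> is a mere unfolding.\<close>

definition F :: "(real ^ 'a) set" where "F = (SOME F. is_fundamental_domain P L F)"

lemma F: "is_fundamental_domain P L F"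
  unfolding F_def by (rule someI_ex) (rule fundamental_domain_exists)

lemma emeasure_F: "emeasure \<Lambda> F < \<infinity>" "emeasure \<Lambda> F \<noteq> 0" "F \<in> sets \<Lambda>"
  using emeasure_fundamental_domain[OF F R_sets emeasure_R(2) cover] by auto

lemma torus_lebesgue_eq: "torus_lebesgue P L = distr (uniform_measure \<Lambda> F) \<T> (coset L)"
  by (simp add: torus_lebesgue_def F_def)

text \<open>Saturation under the countable dense group \<open>\<pi> ` integer_vectors\<close>, which contains every
  translation used by the dynamics.\<close>

definition sat :: "(real ^ 'a) set \<Rightarrow> (real ^ 'a) set" where
  "sat A = (\<Union>v\<in>\<pi> ` integer_vectors. (\<lambda>x. x + v) ` A)"

lemma sat_null: "A \<in> null_sets \<Lambda> \<Longrightarrow> sat A \<in> null_sets \<Lambda>"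
  unfolding sat_def using countable_integer_vectors \<pi>_in_P
  by (intro null_sets_UN') (auto intro: null_sets_\<Lambda>_translate)

lemma sat_superset: "A \<subseteq> sat A"
proof
  fix x assume "x \<in> A"
  moreover have "0 \<in> \<pi> ` integer_vectors"
    using linear_0[OF linear_\<pi>] by (intro image_eqI[of _ _ 0]) (auto simp: integer_vectors_def)
  ultimately show "x \<in> sat A" unfolding sat_def by force
qed

lemma sat_translate:
  assumes v: "v \<in> integer_vectors"
  shows "x + \<pi> v \<in> sat A \<longleftrightarrow> x \<in> sat A"
proof -
  have *: "x + \<pi> v \<in> sat A" if x: "x \<in> sat A" and v: "v \<in> integer_vectors" for x v
  proof -
    obtain y w where y: "y \<in> A" "w \<in> integer_vectors" "x = y + \<pi> w"
      using x by (auto simp: sat_def)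
    then have "x + \<pi> v = y + \<pi> (w + v)" "w + v \<in> integer_vectors"
      using v by (simp_all add: linear_add[OF linear_\<pi>] integer_vectors_add)
    with y(1) show ?thesis unfolding sat_def by blast
  qed
  have "- v \<in> integer_vectors" using v by (simp add: integer_vectors_def)
  then show ?thesis
    using *[OF _ v, of x] *[of "x + \<pi> v" "- v"] by (auto simp: linear_neg[OF linear_\<pi>])
qed

lemma sat_translate_unit: "x + \<pi> (unit_vec a) \<in> sat A \<longleftrightarrow> x \<in> sat A"
  by (rule sat_translate) (rule unit_vec_integer)

lemma sat_translate_L: "t \<in> L \<Longrightarrow> x + t \<in> sat A \<longleftrightarrow> x \<in> sat A"
  using sat_translate Gamma0_subset by blast

text \<open>Saturating the overlaps of the pieces, rather than removing them alone, keeps the whole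
  orbit of a good point good; the letter-by-letter induction in \<open>position_inj\<close> needs
  this.\<close>

definition Z :: "(real ^ 'a) set" where
  "Z = sat (\<Union>a. \<Union>b\<in>- {a}. piece a \<inter> piece b)"

lemma Z_null: "Z \<in> null_sets \<Lambda>"
proof -
  have "piece a \<inter> piece b \<in> null_sets \<Lambda>" if "a \<noteq> b" for a b
    using disjoint_pieces that by (auto simp: disjoint_in_measure_def pairwise_def)
  then have "(\<Union>a. \<Union>b\<in>- {a}. piece a \<inter> piece b) \<in> null_sets \<Lambda>"
    by (intro null_sets_UN' countable_finite) auto
  then show ?thesis unfolding Z_def by (rule sat_null)
qed

lemma piece_unique: "x \<in> piece a \<Longrightarrow> x \<in> piece b \<Longrightarrow> x \<notin> Z \<Longrightarrow> a = b"
proof (rule ccontr)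
  assume x: "x \<in> piece a" "x \<in> piece b" "x \<notin> Z" and "a \<noteq> b"
  then have "x \<in> (\<Union>a. \<Union>b\<in>- {a}. piece a \<inter> piece b)" by auto
  then have "x \<in> Z" unfolding Z_def by (rule sat_superset[THEN subsetD])
  with x(3) show False by simp
qed

lemma position_inj:
  assumes "x \<in> X" "y \<in> X" "position x = position y" "position x \<notin> Z"
  shows "x = y"
proof
  have first: "x 0 = y 0" if "x \<in> X" "y \<in> X" "position x = position y" "position x \<notin> Z" for x y
    using piece_unique[of "position x" "x 0" "y 0"] position_in_piece[of x] position_in_piece[of y] that by simp
  fix n
  show "x n = y n"
    using assms
  proof (induction n arbitrary: x y)
    case 0
    then show ?case by (rule first)
  next
    case (Suc n)
    have eq: "x 0 = y 0" using Suc.prems by (rule first)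
    have "position (word_shift x) \<notin> Z"
      using Suc.prems position(2)[of x] sat_translate_unit unfolding Z_def by simp
    then have "word_shift x n = word_shift y n"
      using Suc.prems position(2)[of x] position(2)[of y] eq shift_in_subshift by (intro Suc.IH) auto
    then show ?case by (simp add: word_shift_def)
  qed
qed

text \<open>The inverse of \<open>position\<close> off \<open>Z\<close>; the default
  \<open>u\<close> merely keeps the values inside the subshift.\<close>

definition coding :: "real ^ 'a \<Rightarrow> nat \<Rightarrow> 'a" where
  "coding x = (if x \<in> R - Z then inv_into X position x else u)"

lemma coding_X: "coding x \<in> X"
  using in_subshift_self inv_into_into[of x position X] position_X by (auto simp: coding_def)

lemma position_coding: "x \<in> R \<Longrightarrow> x \<notin> Z \<Longrightarrow> position (coding x) = x"
  using f_inv_into_f[of x position X] position_X by (simp add: coding_def)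

lemma coding_position: "x \<in> X \<Longrightarrow> position x \<notin> Z \<Longrightarrow> coding (position x) = x"
  using position_inj[OF coding_X, of x "position x"] position_coding[OF position_in_R, of x] by simp

lemma position_measurable: "position \<in> measurable Y \<Lambda>"
  using continuous_map_measurable_borel[OF position(1)] R_sub position_in_R
  by (intro measurable_\<Lambda>I) (auto simp: space_borel_of)

text \<open>A closed \<open>C\<close> is compact, so \<open>position\<close> maps it onto a compact
  set, and off \<open>Z\<close> this image is the preimage of \<open>C\<close> under
  \<open>coding\<close>.\<close>

lemma coding_measurable: "coding \<in> measurable \<Lambda> Y"
proof (rule measurable_borel_ofI)
  show "coding \<in> space \<Lambda> \<rightarrow> X" using coding_X by auto
  fix C assume C: "closedin (subshift u) C"
  have CX: "C \<subseteq> X" using C by (rule closedin_subset)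
  have "compact (position ` C)"
    using image_compactin[OF closedin_compact_space[OF compact_space_subshift C] position(1)] by simp
  then have "closed (position ` C)" by (rule compact_imp_closed)
  then have gC: "position ` C \<in> sets \<Lambda>"
    using CX position_in_R R_sub by (auto simp: sets_\<Lambda>_iff)
  have Zs: "Z \<in> sets \<Lambda>" using Z_null by auto
  \<comment> \<open>The second set in the union accounts for the points where \<open>coding\<close>
    takes its default value \<open>u\<close>.\<close>
  have "coding -` C \<inter> P = (position ` C - Z) \<union> (if u \<in> C then P - (R - Z) else {})"
  proof (intro antisym subsetI)
    fix x assume x: "x \<in> coding -` C \<inter> P"
    show "x \<in> (position ` C - Z) \<union> (if u \<in> C then P - (R - Z) else {})"
    proof (cases "x \<in> R - Z")
      case True
      then have "x = position (coding x)" using position_coding by simp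
      then show ?thesis using x True by blast
    next
      case False
      then have "coding x = u" unfolding coding_def by (rule if_not_P)
      then show ?thesis using x False by auto
    qed
  next
    fix x assume x: "x \<in> (position ` C - Z) \<union> (if u \<in> C then P - (R - Z) else {})"
    show "x \<in> coding -` C \<inter> P"
    proof (cases "x \<in> position ` C - Z")
      case True
      then obtain y where "y \<in> C" "x = position y" "x \<notin> Z" by blast
      then show ?thesis using CX coding_position position_in_R R_sub by auto
    next
      case False
      then have "u \<in> C" "x \<in> P - (R - Z)" using x by (auto split: if_splits)
      then show ?thesis by (auto simp: coding_def)
    qed
  qed
  also have "\<dots> \<in> sets \<Lambda>"
    using gC Zs R_sets sets.top[of \<Lambda>] by auto
  finally show "coding -` C \<inter> space \<Lambda> \<in> sets \<Lambda>" by simp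
qed

section \<open>The invariant measure on the subshift\<close>

abbreviation \<nu> :: "(real ^ 'a) measure" where "\<nu> \<equiv> uniform_measure \<Lambda> R"

definition \<mu> :: "(nat \<Rightarrow> 'a) measure" where "\<mu> = distr \<nu> Y coding"

lemma prob_\<nu>: "prob_space \<nu>"
  using emeasure_R by (intro prob_space_uniform_measure) auto

lemma AE_\<nu>: "AE x in \<nu>. x \<in> R \<and> x \<notin> Z"
  using R_sets AE_not_in[OF Z_null] by (intro AE_uniform_measureI) auto

lemma coding_measurable_\<nu>: "coding \<in> measurable \<nu> Y"
  using coding_measurable by (simp cong: measurable_cong_sets)

lemma sets_\<mu>: "sets \<mu> = sets Y" and space_\<mu>: "space \<mu> = X"
  by (simp_all add: \<mu>_def space_borel_of)

lemma prob_\<mu>: "prob_space \<mu>"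
  unfolding \<mu>_def using prob_space.prob_space_distr[OF prob_\<nu> coding_measurable_\<nu>] .

lemma position_measurable_\<mu>: "position \<in> measurable \<mu> \<Lambda>"
  using position_measurable measurable_cong_sets[OF sets_\<mu> refl] by blast

lemma distr_\<mu>_position: "distr \<mu> \<Lambda> position = \<nu>"
proof -
  have "distr \<mu> \<Lambda> position = distr \<nu> \<Lambda> (position \<circ> coding)"
    unfolding \<mu>_def using position_measurable coding_measurable_\<nu> by (rule distr_distr)
  also have "\<dots> = distr \<nu> \<Lambda> (\<lambda>x. x)"
  proof (rule distr_cong_AE)
    show "AE x in \<nu>. (position \<circ> coding) x = x"
      using AE_\<nu> by eventually_elim (simp add: position_coding)
    show "position \<circ> coding \<in> measurable \<nu> \<Lambda>"
      using coding_measurable_\<nu> position_measurable by (rule measurable_comp)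
    show "(\<lambda>x. x) \<in> measurable \<nu> \<Lambda>"
      by (simp cong: measurable_cong_sets)
  qed simp_all
  also have "\<dots> = \<nu>" by (rule distr_id2) simp
  finally show ?thesis .
qed

lemma word_shift_measurable: "word_shift \<in> measurable Y Y"
  by (rule continuous_map_measurable_borel_of[OF continuous_map_word_shift])

text \<open>Off \<open>Z\<close> the piece containing a point is named by the first letter of its
  coding, so \<open>coding\<close> carries the domain exchange to the shift.\<close>

lemma coding_shift:
  assumes "x \<in> piece a" "x \<notin> Z"
  shows "word_shift (coding x) = coding (x + \<pi> (unit_vec a))"
proof -
  have x: "position (coding x) = x" using assms in_R_iff by (intro position_coding) blast
  then have "coding x 0 = a" using piece_unique[OF _ assms, of "coding x 0"] position_in_piece[OF coding_X, of x] by simp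
  then have "position (word_shift (coding x)) = x + \<pi> (unit_vec a)" using position(2)[OF coding_X] x by simp
  moreover have "x + \<pi> (unit_vec a) \<notin> Z" using assms(2) sat_translate_unit by (simp add: Z_def)
  ultimately show ?thesis using coding_position[OF shift_in_subshift[OF coding_X], of x] by simp
qed

text \<open>The pieces \<open>piece a + \<pi> (unit_vec a)\<close> cover \<open>R\<close>, so the domain exchange can only increase the
  measure of a preimage, and then, by passing to complements, preserves it.\<close>

lemma invariant_\<mu>: "invariant_borel_probability (subshift u) word_shift \<mu>"
proof -
  have Sm: "word_shift \<in> measurable \<mu> \<mu>"
    using word_shift_measurable measurable_cong_sets[OF sets_\<mu> sets_\<mu>] by blast
  have "\<mu> = distr \<mu> \<mu> word_shift"
  proof (rule prob_measure_eqI_le[OF prob_\<mu>])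
    show "prob_space (distr \<mu> \<mu> word_shift)"
      using prob_space.prob_space_distr[OF prob_\<mu> Sm] .
    show "sets \<mu> = sets (distr \<mu> \<mu> word_shift)" by simp
    fix V assume V: "V \<in> sets \<mu>"
    then have VY: "V \<in> sets Y" by (simp add: sets_\<mu>)
    \<comment> \<open>Discarding points outside \<open>R\<close> or in \<open>Z\<close> costs only a
      \<open>\<nu>\<close>-null set and makes the sets \<open>B a\<close> below disjoint.\<close>
    define C where "C = (coding -` V \<inter> P) \<inter> (R - Z)"
    have Zs: "Z \<in> sets \<Lambda>" using Z_null by auto
    have Cs: "C \<in> sets \<Lambda>"
      unfolding C_def using measurable_sets[OF coding_measurable VY] R_sets Zs by auto
    \<comment> \<open>The part in piece \<open>a\<close> of the preimage of \<open>C\<close> under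
      the domain exchange. The translated sets cover \<open>C\<close>, while the sets
      \<open>B a\<close> themselves are disjoint, so their union has at least the measure of
      \<open>C\<close>.\<close>
    define B where "B a = piece a \<inter> (\<lambda>x. x + - \<pi> (unit_vec a)) ` C" for a
    have Bs: "B a \<in> sets \<Lambda>" for a
      unfolding B_def using piece_sets Cs \<pi>_in_P P_uminus by (intro sets.Int sets_\<Lambda>_translate) auto
    have B_iff: "x \<in> B a \<longleftrightarrow> x \<in> piece a \<and> x + \<pi> (unit_vec a) \<in> C" for x a
      unfolding B_def by (simp only: translate_eq_vimage) simp
    have B_Z: "B a \<inter> Z = {}" for a
      using B_iff sat_translate_unit unfolding C_def Z_def by auto
    have "emeasure \<Lambda> C \<le> emeasure \<Lambda> (\<Union>a. (\<lambda>x. x + \<pi> (unit_vec a)) ` B a)"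
    proof (rule emeasure_mono)
      show "(\<Union>a. (\<lambda>x. x + \<pi> (unit_vec a)) ` B a) \<in> sets \<Lambda>"
        using Bs \<pi>_in_P by (intro sets.finite_UN sets_\<Lambda>_translate) auto
      show "C \<subseteq> (\<Union>a. (\<lambda>x. x + \<pi> (unit_vec a)) ` B a)"
      proof
        fix x assume x: "x \<in> C"
        then have "x \<in> R" by (simp add: C_def)
        then obtain a where "x - \<pi> (unit_vec a) \<in> piece a" using R_preimage by blast
        then have "x - \<pi> (unit_vec a) \<in> B a" using x by (simp add: B_iff)
        moreover have "x = (x - \<pi> (unit_vec a)) + \<pi> (unit_vec a)" by simp
        ultimately show "x \<in> (\<Union>a. (\<lambda>x. x + \<pi> (unit_vec a)) ` B a)" by blast
      qed
    qed
    also have "\<dots> \<le> (\<Sum>a\<in>UNIV. emeasure \<Lambda> ((\<lambda>x. x + \<pi> (unit_vec a)) ` B a))"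
      using Bs \<pi>_in_P by (intro emeasure_subadditive_finite) (auto intro: sets_\<Lambda>_translate)
    also have "\<dots> = (\<Sum>a\<in>UNIV. emeasure \<Lambda> (B a))"
      using Bs \<pi>_in_P by (simp add: emeasure_\<Lambda>_translate)
    also have "\<dots> = emeasure \<Lambda> (\<Union>a. B a)"
    proof (rule sum_emeasure)
      show "disjoint_family_on B UNIV"
        using B_Z piece_unique B_iff unfolding disjoint_family_on_def by blast
    qed (use Bs in auto)
    finally have le: "emeasure \<Lambda> C \<le> emeasure \<Lambda> (\<Union>a. B a)" .
    have CR: "R \<inter> C = C" by (auto simp: C_def)
    have BR: "R \<inter> (\<Union>a. B a) = (\<Union>a. B a)" using B_iff in_R_iff by auto
    have "emeasure \<mu> V = emeasure \<nu> (coding -` V \<inter> P)"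
      unfolding \<mu>_def using emeasure_distr[OF coding_measurable_\<nu> VY] by simp
    also have "\<dots> = emeasure \<nu> C"
    proof (rule emeasure_eq_AE)
      show "AE x in \<nu>. x \<in> coding -` V \<inter> P \<longleftrightarrow> x \<in> C"
        using AE_\<nu> by eventually_elim (auto simp: C_def)
      show "coding -` V \<inter> P \<in> sets \<nu>" using measurable_sets[OF coding_measurable VY] by simp
      show "C \<in> sets \<nu>" using Cs by simp
    qed
    also have "\<dots> \<le> emeasure \<nu> (\<Union>a. B a)"
      using le Cs Bs R_sets CR BR by (simp add: divide_right_mono_ennreal)
    also have "\<dots> \<le> emeasure \<nu> (coding -` (word_shift -` V \<inter> X) \<inter> P)"
    proof (rule emeasure_mono)
      show "(\<Union>a. B a) \<subseteq> coding -` (word_shift -` V \<inter> X) \<inter> P"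
      proof
        fix x assume "x \<in> (\<Union>a. B a)"
        then obtain a where a: "x \<in> B a" by blast
        then have "x \<notin> Z" "x \<in> piece a" "x + \<pi> (unit_vec a) \<in> C" using B_Z B_iff by auto
        then have "word_shift (coding x) \<in> V" using coding_shift by (simp add: C_def)
        then show "x \<in> coding -` (word_shift -` V \<inter> X) \<inter> P"
          using coding_X \<open>x \<in> piece a\<close> piece_sub by auto
      qed
      have "word_shift -` V \<inter> X \<in> sets Y"
        using measurable_sets[OF word_shift_measurable VY] by (simp add: space_borel_of)
      from measurable_sets[OF coding_measurable this]
      show "coding -` (word_shift -` V \<inter> X) \<inter> P \<in> sets \<nu>" by simp
    qed
    also have "\<dots> = emeasure \<mu> (word_shift -` V \<inter> X)"
      unfolding \<mu>_def using measurable_sets[OF word_shift_measurable VY]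
      by (subst emeasure_distr[OF coding_measurable_\<nu>]) (simp_all add: space_borel_of)
    also have "\<dots> = emeasure (distr \<mu> \<mu> word_shift) V"
      using V by (subst emeasure_distr[OF Sm]) (simp_all add: space_\<mu>)
    finally show "emeasure \<mu> V \<le> emeasure (distr \<mu> \<mu> word_shift) V" .
  qed
  then show ?thesis
    unfolding invariant_borel_probability_def measure_preserving_def
    using sets_\<mu> prob_\<mu> Sm by simp
qed

end

section \<open>The factor map onto the torus and its multiplicity\<close>

context bounded_discrete_line
begin

text \<open>\<open>equidistribution\<close> for the image of \<open>M\<close> under
  \<open>position\<close>. Shift invariance of \<open>M\<close> yields its hypothesis
  \<open>inv\<close>, since the position of a shifted word differs from
  \<open>position y + e\<close> by an element of \<open>L\<close>.\<close>

lemma nn_integral_hits_invariant: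
  assumes M: "invariant_borel_probability (subshift u) word_shift M" and A: "A \<in> sets \<Lambda>"
  shows "(\<integral>\<^sup>+x. hits A x \<partial>distr M \<Lambda> position) = emeasure \<Lambda> A / emeasure \<Lambda> F"
proof -
  have sets_M: "sets M = sets Y" and prob_M: "prob_space M"
    and S: "word_shift \<in> measurable M M" "distr M M word_shift = M"
    using M by (auto simp: invariant_borel_probability_def measure_preserving_def)
  have space_M: "space M = X" using sets_eq_imp_space_eq[OF sets_M] by (simp add: space_borel_of)
  have gM: "position \<in> measurable M \<Lambda>" using position_measurable measurable_cong_sets[OF sets_M refl] by blast
  define \<kappa> where "\<kappa> = distr M \<Lambda> position"
  interpret \<kappa>: prob_space \<kappa> unfolding \<kappa>_def by (rule prob_space.prob_space_distr[OF prob_M gM])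
  have int_\<kappa>: "(\<integral>\<^sup>+x. f x \<partial>\<kappa>) = (\<integral>\<^sup>+y. f (position y) \<partial>M)"
    if "f \<in> borel_measurable borel" for f :: "real ^ 'a \<Rightarrow> ennreal"
    unfolding \<kappa>_def using gM borel_measurable_\<Lambda>[OF that] by (subst nn_integral_distr) simp_all
  have inv: "(\<integral>\<^sup>+x. hits A (x + e) \<partial>\<kappa>) = (\<integral>\<^sup>+x. hits A x \<partial>\<kappa>)" if A: "A \<in> sets \<Lambda>" for A
  proof -
    have [measurable]: "A \<in> sets borel" using A by (simp add: sets_\<Lambda>_iff)
    have hg: "(\<lambda>y. hits A (position y)) \<in> borel_measurable M"
      using measurable_compose[OF measurable_\<Lambda>_borel[OF gM] borel_measurable_hits] by simp
    have "(\<integral>\<^sup>+x. hits A (x + e) \<partial>\<kappa>) = (\<integral>\<^sup>+y. hits A (position y + e) \<partial>M)"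
      by (rule int_\<kappa>) measurable
    also have "\<dots> = (\<integral>\<^sup>+y. hits A (position (word_shift y)) \<partial>M)"
    proof (rule nn_integral_cong)
      fix y assume "y \<in> space M"
      then have "y \<in> X" by (simp add: space_M)
      then have "position (word_shift y) = (position y + e) + (\<pi> (unit_vec (y 0)) - e)" using position(2) by simp
      then show "hits A (position y + e) = hits A (position (word_shift y))"
        using hits_lattice[OF \<pi>_unit_vec_diff] by metis
    qed
    also have "\<dots> = (\<integral>\<^sup>+y. hits A (position y) \<partial>distr M M word_shift)"
      using S(1) hg by (intro nn_integral_distr[symmetric]) auto
    also have "\<dots> = (\<integral>\<^sup>+x. hits A x \<partial>\<kappa>)"
      unfolding S(2) by (rule int_\<kappa>[symmetric]) measurable
    finally show ?thesis .
  qed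
  have "sets \<kappa> = sets \<Lambda>" by (simp add: \<kappa>_def)
  from equidistribution[OF this \<kappa>.finite_measure_axioms inv F A]
  have "(\<integral>\<^sup>+x. hits A x \<partial>\<kappa>) * emeasure \<Lambda> F = emeasure \<Lambda> A"
    using \<kappa>.emeasure_space_1 sets_eq_imp_space_eq[OF \<open>sets \<kappa> = sets \<Lambda>\<close>] by simp
  then have "(\<integral>\<^sup>+x. hits A x \<partial>\<kappa>) * emeasure \<Lambda> F / emeasure \<Lambda> F = emeasure \<Lambda> A / emeasure \<Lambda> F"
    by simp
  then show ?thesis
    using emeasure_F by (simp add: \<kappa>_def mult_divide_eq_ennreal less_top)
qed

definition \<phi> :: "(nat \<Rightarrow> 'a) \<Rightarrow> (real ^ 'a) set" where "\<phi> x = coset L (position x)"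

lemma continuous_map_\<phi>: "continuous_map (subshift u) (torus P L) \<phi>"
proof -
  have "continuous_map (subshift u) (top_of_set P) position"
    using position(1) position_in_R R_sub by (auto simp: continuous_map_in_subtopology)
  from continuous_map_compose[OF this continuous_map_coset]
  show ?thesis by (simp add: \<phi>_def[abs_def] comp_def)
qed

lemma \<phi>_measurable: "\<phi> \<in> measurable Y \<T>"
  using continuous_map_\<phi> by (rule continuous_map_measurable_borel_of)

lemma \<phi>_image: "\<phi> ` X = coset L ` P"
proof -
  have "\<phi> ` X = coset L ` position ` X" by (auto simp: \<phi>_def)
  also have "\<dots> = coset L ` P"
  proof (intro antisym subsetI)
    fix c assume "c \<in> coset L ` P"
    then obtain x where x: "x \<in> P" "c = coset L x" by blast
    then show "c \<in> coset L ` position ` X"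
      using cover[OF x(1)] unfolding x(2) coset_image_iff position_X by blast
  qed (use position_X R_sub in auto)
  finally show ?thesis .
qed

text \<open>Acts on a coset as a set of points, so that no representative has to be chosen.\<close>

abbreviation "T \<equiv> (`) (\<lambda>x. x + e)"

lemma T_coset: "T (coset L x) = coset L (x + \<pi> (unit_vec a))"
proof -
  have "T (coset L x) = coset L (x + e)"
    unfolding coset_def image_image by (simp add: algebra_simps)
  also have "\<dots> = coset L (x + \<pi> (unit_vec a))"
    using \<pi>_unit_vec_diff by (simp add: coset_eq_iff)
  finally show ?thesis .
qed

lemma \<phi>_shift: "x \<in> X \<Longrightarrow> \<phi> (word_shift x) = T (\<phi> x)"
  using position(2) T_coset by (simp add: \<phi>_def)

lemma semi_conjugacy_\<phi>: "semi_conjugacy (subshift u) word_shift (torus P L) T \<phi>"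
  unfolding semi_conjugacy_def topspace_torus
  using continuous_map_\<phi> \<phi>_image \<phi>_shift by simp

lemma sets_torus_lebesgue: "sets (torus_lebesgue P L) = sets \<T>"
  and space_torus_lebesgue: "space (torus_lebesgue P L) = coset L ` P"
  by (simp_all add: torus_lebesgue_eq space_borel_of topspace_torus)

lemma emeasure_torus_lebesgue:
  assumes "V \<in> sets \<T>"
  shows "emeasure (torus_lebesgue P L) V = emeasure \<Lambda> (F \<inter> {x \<in> P. coset L x \<in> V}) / emeasure \<Lambda> F"
proof -
  have m: "coset L \<in> measurable (uniform_measure \<Lambda> F) \<T>"
    using measurable_coset by (simp cong: measurable_cong_sets)
  have "{x \<in> P. coset L x \<in> V} \<in> sets \<Lambda>"
    using measurable_sets[OF measurable_coset assms] by (simp add: vimage_def Int_def conj_commute)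
  moreover have "coset L -` V \<inter> space (uniform_measure \<Lambda> F) = {x \<in> P. coset L x \<in> V}"
    by auto
  ultimately show ?thesis
    unfolding torus_lebesgue_eq using emeasure_distr[OF m assms] emeasure_F by simp
qed

text \<open>A Borel set of the torus lifts to an \<open>L\<close>-periodic set \<open>B\<close>. Its
  indicator on \<open>P\<close> is the count \<open>hits (F \<inter> B)\<close>, and
  \<open>nn_integral_hits_invariant\<close> evaluates that for every invariant
  \<open>M\<close>.\<close>

lemma measure_preserving_\<phi>:
  assumes M: "invariant_borel_probability (subshift u) word_shift M"
  shows "measure_preserving M (torus_lebesgue P L) \<phi>"
proof -
  have sets_M: "sets M = sets Y" using M by (simp add: invariant_borel_probability_def)
  have gM: "position \<in> measurable M \<Lambda>" using position_measurable measurable_cong_sets[OF sets_M refl] by blast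
  have m: "\<phi> \<in> measurable M (torus_lebesgue P L)"
    using \<phi>_measurable measurable_cong_sets[OF sets_M sets_torus_lebesgue] by blast
  have "distr M (torus_lebesgue P L) \<phi> = torus_lebesgue P L"
  proof (rule measure_eqI)
    fix V assume "V \<in> sets (distr M (torus_lebesgue P L) \<phi>)"
    then have V: "V \<in> sets \<T>" by (simp add: sets_torus_lebesgue)
    define B where "B = {x \<in> P. coset L x \<in> V}"
    have Bs: "B \<in> sets \<Lambda>"
      using measurable_sets[OF measurable_coset V] by (simp add: B_def vimage_def Int_def conj_commute)
    \<comment> \<open>Periodicity pulls \<open>B\<close> out of the count, and \<open>F\<close> has
      one point in each coset.\<close>
    have hits: "hits (F \<inter> B) x = indicator B x" if x: "x \<in> P" for x
    proof -
      have "x + t \<in> B \<longleftrightarrow> x \<in> B" if t: "t \<in> L" for t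
      proof -
        have "coset L (x + t) = coset L x" using t by (simp add: coset_eq_iff)
        moreover have "x + t \<in> P" using x L_P[OF t] by (rule P_add)
        ultimately show ?thesis using x by (simp add: B_def)
      qed
      then have "hits (F \<inter> B) x = (\<integral>\<^sup>+t. indicator F (x + t) * indicator B x \<partial>count_space L)"
        unfolding hits_def by (intro nn_integral_cong) (auto simp: indicator_def)
      also have "\<dots> = hits F x * indicator B x"
        unfolding hits_def by (simp add: nn_integral_multc)
      finally show ?thesis using hits_fundamental_domain[OF F x] by simp
    qed
    have "emeasure (distr M (torus_lebesgue P L) \<phi>) V = emeasure M (\<phi> -` V \<inter> space M)"
      using m V by (intro emeasure_distr) (simp_all add: sets_torus_lebesgue)
    also have "\<phi> -` V \<inter> space M = position -` B \<inter> space M"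
      using measurable_space[OF gM] by (auto simp: B_def \<phi>_def)
    also have "emeasure M (position -` B \<inter> space M) = emeasure (distr M \<Lambda> position) B"
      using gM Bs by (rule emeasure_distr[symmetric])
    also have "\<dots> = (\<integral>\<^sup>+x. indicator B x \<partial>distr M \<Lambda> position)"
      using Bs by simp
    also have "\<dots> = (\<integral>\<^sup>+x. hits (F \<inter> B) x \<partial>distr M \<Lambda> position)"
      using hits by (intro nn_integral_cong) simp
    also have "\<dots> = emeasure \<Lambda> (F \<inter> B) / emeasure \<Lambda> F"
      using M Bs emeasure_F by (intro nn_integral_hits_invariant) auto
    also have "\<dots> = emeasure (torus_lebesgue P L) V"
      using V by (simp add: emeasure_torus_lebesgue B_def)
    finally show "emeasure (distr M (torus_lebesgue P L) \<phi>) V = emeasure (torus_lebesgue P L) V" .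
  qed simp
  with m show ?thesis by (simp add: measure_preserving_def)
qed

lemma hits_R_borel: "hits R \<in> borel_measurable \<Lambda>"
  by (intro borel_measurable_\<Lambda> borel_measurable_hits) simp

text \<open>Comparing \<open>distr \<mu> \<Lambda> position = \<nu>\<close>, whose \<open>L\<close>-periodization has density \<open>hits R / emeasure \<Lambda> R\<close>, with
  the equidistribution theorem.\<close>

lemma AE_hits_R: "AE x in \<Lambda>. hits R x = emeasure \<Lambda> R / emeasure \<Lambda> F"
proof (rule \<Lambda>.density_unique2)
  show "hits R \<in> borel_measurable \<Lambda>" by (rule hits_R_borel)
  fix A assume A: "A \<in> sets \<Lambda>"
  have R0: "emeasure \<Lambda> R \<noteq> 0" "emeasure \<Lambda> R \<noteq> \<top>" using emeasure_R by auto
  have hA: "hits A \<in> borel_measurable \<Lambda>"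
    using A by (intro borel_measurable_\<Lambda> borel_measurable_hits) (simp add: sets_\<Lambda>_iff)
  have "(\<integral>\<^sup>+x. hits A x * indicator R x \<partial>\<Lambda>) / emeasure \<Lambda> R = (\<integral>\<^sup>+x. hits A x \<partial>\<nu>)"
    using hA R_sets by (rule nn_integral_uniform_measure[symmetric])
  also have "\<dots> = emeasure \<Lambda> A / emeasure \<Lambda> F"
    using nn_integral_hits_invariant[OF invariant_\<mu> A] by (simp add: distr_\<mu>_position)
  finally have *: "(\<integral>\<^sup>+x. hits R x * indicator A x \<partial>\<Lambda>) / emeasure \<Lambda> R = emeasure \<Lambda> A / emeasure \<Lambda> F"
    using nn_integral_hits_swap[OF A R_sets] by simp
  have "(\<integral>\<^sup>+x. hits R x * indicator A x \<partial>\<Lambda>)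
      = (\<integral>\<^sup>+x. hits R x * indicator A x \<partial>\<Lambda>) / emeasure \<Lambda> R * emeasure \<Lambda> R"
    using R0 by (simp add: ennreal_divide_times less_top)
  also have "\<dots> = emeasure \<Lambda> R / emeasure \<Lambda> F * emeasure \<Lambda> A"
    unfolding * by (simp add: ennreal_divide_times mult.commute ennreal_times_divide)
  also have "\<dots> = (\<integral>\<^sup>+x. emeasure \<Lambda> R / emeasure \<Lambda> F * indicator A x \<partial>\<Lambda>)"
    using A by (simp add: nn_integral_cmult_indicator)
  finally show "(\<integral>\<^sup>+x. hits R x * indicator A x \<partial>\<Lambda>)
      = (\<integral>\<^sup>+x. emeasure \<Lambda> R / emeasure \<Lambda> F * indicator A x \<partial>\<Lambda>)" .
qed simp

lemma hits_R_finite_iff: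
  "hits R x = of_nat m \<longleftrightarrow> finite {t \<in> L. x + t \<in> R} \<and> card {t \<in> L. x + t \<in> R} = m"
  unfolding hits_eq_emeasure by (subst emeasure_count_space) auto

lemma AE_\<Lambda>_imp_ex: "AE x in \<Lambda>. Q x \<Longrightarrow> \<exists>x\<in>P. Q x"
proof -
  assume "AE x in \<Lambda>. Q x"
  then obtain N where N: "\<And>x. x \<in> space \<Lambda> - N \<Longrightarrow> Q x" "N \<in> null_sets \<Lambda>"
    by (rule AE_E3) (rule that)
  have "P \<notin> null_sets \<Lambda>" using emeasure_\<Lambda>_P by auto
  moreover have "P \<in> sets \<Lambda>" by (simp add: sets_\<Lambda>_iff)
  ultimately have "\<not> P \<subseteq> N" using N(2) null_sets_subset by blast
  then show ?thesis using N(1) by auto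
qed

text \<open>The finite constant of \<open>AE_hits_R\<close> is attained at an actual point, where it
  is a cardinality; \<open>cover\<close> makes it positive.\<close>

lemma multiplicity:
  obtains m where "m > 0" "emeasure \<Lambda> R / emeasure \<Lambda> F = of_nat m"
proof -
  obtain x where x: "x \<in> P" "hits R x = emeasure \<Lambda> R / emeasure \<Lambda> F"
    using AE_\<Lambda>_imp_ex[OF AE_hits_R] by blast
  have "emeasure \<Lambda> R / emeasure \<Lambda> F \<noteq> \<top>"
    using emeasure_R emeasure_F by (simp add: ennreal_divide_eq_top_iff less_top)
  then have fin: "finite {t \<in> L. x + t \<in> R}"
    using x(2) unfolding hits_eq_emeasure by (auto simp: emeasure_count_space split: if_splits)
  then have "emeasure \<Lambda> R / emeasure \<Lambda> F = of_nat (card {t \<in> L. x + t \<in> R})"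
    using hits_R_finite_iff[of x] x(2) by simp
  moreover have "card {t \<in> L. x + t \<in> R} > 0"
    using cover[OF x(1)] fin by (auto simp: card_gt_0_iff)
  ultimately show thesis using that by blast
qed

text \<open>Periodicity prevents the saturation of \<open>W\<close> from exceeding \<open>W\<close>,
  so nullity descends to the torus.\<close>

lemma coset_null_sets:
  assumes W: "W \<in> null_sets \<Lambda>" and inv: "\<And>x t. x \<in> W \<Longrightarrow> t \<in> L \<Longrightarrow> x + t \<in> W"
  shows "coset L ` W \<in> null_sets (torus_lebesgue P L)"
proof -
  have Ws: "W \<in> sets \<Lambda>" using W by auto
  have V: "coset L ` W \<in> sets \<T>" using Ws by (rule coset_image_sets)
  have "{x \<in> P. coset L x \<in> coset L ` W} \<subseteq> W"
  proof
    fix x assume "x \<in> {x \<in> P. coset L x \<in> coset L ` W}"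
    then obtain t where "t \<in> L" "x + t \<in> W" by (auto simp: coset_image_iff)
    then have "x + t + - t \<in> W" using inv L_uminus by blast
    then show "x \<in> W" by simp
  qed
  then have "F \<inter> {x \<in> P. coset L x \<in> coset L ` W} \<subseteq> W" by blast
  from emeasure_eq_0[OF Ws null_setsD1[OF W] this]
  have "emeasure \<Lambda> (F \<inter> {x \<in> P. coset L x \<in> coset L ` W}) = 0" .
  then have "emeasure (torus_lebesgue P L) (coset L ` W) = 0"
    using V by (simp add: emeasure_torus_lebesgue)
  then show ?thesis using V by (simp add: null_sets_def sets_torus_lebesgue)
qed

text \<open>Off \<open>Z\<close>, where \<open>position\<close> is injective, the fibre over the
  coset of \<open>x\<close> is in bijection with the points of \<open>R\<close> in that coset, whose
  number is almost everywhere the constant of \<open>multiplicity\<close>.\<close>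

lemma finite_extension_\<phi>: "finite_extension_map \<mu> word_shift (torus_lebesgue P L) T \<phi>"
proof -
  obtain m where m: "m > 0" "emeasure \<Lambda> R / emeasure \<Lambda> F = of_nat m" by (rule multiplicity)
  define W where "W = (Z \<inter> P) \<union> {x \<in> P. hits R x \<noteq> of_nat m}"
  have "{x \<in> P. hits R x \<noteq> of_nat m} \<in> null_sets \<Lambda>"
  proof -
    have "{x \<in> space \<Lambda>. hits R x \<noteq> of_nat m} \<in> sets \<Lambda>"
      using hits_R_borel by (intro borel_measurable_neq) auto
    moreover have "AE x in \<Lambda>. hits R x = of_nat m" using AE_hits_R m(2) by simp
    ultimately show ?thesis
      using AE_iff_measurable[of "{x \<in> P. hits R x \<noteq> of_nat m}" \<Lambda> "\<lambda>x. hits R x = of_nat m"]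
      by (simp add: null_sets_def)
  qed
  moreover have "Z \<inter> P \<in> null_sets \<Lambda>"
    using Z_null sets.top[of \<Lambda>] by (intro null_set_Int2) auto
  ultimately have W: "W \<in> null_sets \<Lambda>" unfolding W_def by (intro null_sets.Un)
  have W_inv: "x + t \<in> W" if "x \<in> W" "t \<in> L" for x t
    using that hits_lattice[OF that(2)] sat_translate_L[OF that(2)] P_add[OF _ L_P[OF that(2)], of x]
    unfolding W_def Z_def by auto
  have card: "card {y \<in> X. \<phi> y = coset L x} = m" if x: "x \<in> P" "x \<notin> W" for x
  proof -
    have "bij_betw (\<lambda>y. position y - x) {y \<in> X. \<phi> y = coset L x} {t \<in> L. x + t \<in> R}"
      unfolding bij_betw_def
    proof (intro conjI inj_onI antisym subsetI)
      fix y z assume y: "y \<in> {y \<in> X. \<phi> y = coset L x}" and z: "z \<in> {y \<in> X. \<phi> y = coset L x}"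
        and "position y - x = position z - x"
      then have "position y = position z" by simp
      moreover have "position y \<notin> Z"
      proof -
        have "position y - x \<in> L" using y by (simp add: \<phi>_def coset_eq_iff)
        then have "x + (position y - x) \<in> Z \<longleftrightarrow> x \<in> Z" unfolding Z_def by (rule sat_translate_L)
        then show ?thesis using x by (simp add: W_def)
      qed
      ultimately show "y = z" using y z position_inj by blast
    next
      fix t assume "t \<in> (\<lambda>y. position y - x) ` {y \<in> X. \<phi> y = coset L x}"
      then obtain y where "y \<in> X" "\<phi> y = coset L x" "t = position y - x" by blast
      then show "t \<in> {t \<in> L. x + t \<in> R}"
        using position_in_R[of y] by (simp add: \<phi>_def coset_eq_iff)
    next
      fix t assume t: "t \<in> {t \<in> L. x + t \<in> R}"
      then have "x + t \<in> position ` X" unfolding position_X by simp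
      then obtain y where y: "y \<in> X" "x + t = position y" by blast
      from y(2) have "position y = x + t" ..
      then have gt: "position y - x = t" by simp
      moreover have "\<phi> y = coset L x"
        using t by (simp add: \<phi>_def coset_eq_iff gt)
      ultimately show "t \<in> (\<lambda>y. position y - x) ` {y \<in> X. \<phi> y = coset L x}"
        using y(1) by blast
    qed
    then have "card {y \<in> X. \<phi> y = coset L x} = card {t \<in> L. x + t \<in> R}"
      by (rule bij_betw_same_card)
    also have "\<dots> = m" using x hits_R_finite_iff[of x m] by (simp add: W_def)
    finally show ?thesis .
  qed
  have "AE c in torus_lebesgue P L. card {x \<in> space \<mu>. \<phi> x = c} = m"
  proof (rule AE_I'[OF coset_null_sets[OF W W_inv]])
    show "{c \<in> space (torus_lebesgue P L). card {x \<in> space \<mu>. \<phi> x = c} \<noteq> m} \<subseteq> coset L ` W"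
      using card by (auto simp: space_torus_lebesgue space_\<mu>)
  qed
  moreover have "factor_map \<mu> word_shift (torus_lebesgue P L) T \<phi>"
    unfolding factor_map_def
    using measure_preserving_\<phi>[OF invariant_\<mu>] \<phi>_image \<phi>_shift
    by (auto simp: space_\<mu> space_torus_lebesgue intro!: AE_I2)
  ultimately show ?thesis
    unfolding finite_extension_map_def using m(1) by blast
qed

end

section \<open>The tiling case\<close>

locale tiling_discrete_line = bounded_discrete_line +
  assumes tiling: "disjoint_in_measure \<Lambda> L (\<lambda>t. (\<lambda>x. x + t) ` R)"
begin

text \<open>Saturated like \<open>Z\<close>, so that its complement is stable under the dynamics as
  well as under \<open>L\<close>.\<close>

definition Q :: "(real ^ 'a) set" where
  "Q = sat (\<Union>r\<in>L. \<Union>t\<in>L - {r}. (\<lambda>x. x + r) ` R \<inter> (\<lambda>x. x + t) ` R)"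

lemma Q_null: "Q \<in> null_sets \<Lambda>"
proof -
  have "(\<lambda>x. x + r) ` R \<inter> (\<lambda>x. x + t) ` R \<in> null_sets \<Lambda>" if r: "r \<in> L" and t: "t \<in> L - {r}" for r t
  proof -
    have "t \<in> L" "r \<noteq> t" using t by blast+
    from pairwiseD[OF tiling[unfolded disjoint_in_measure_def] r this] show ?thesis .
  qed
  then have "(\<Union>r\<in>L. \<Union>t\<in>L - {r}. (\<lambda>x. x + r) ` R \<inter> (\<lambda>x. x + t) ` R) \<in> null_sets \<Lambda>"
    using L_countable by (intro null_sets_UN' countable_Diff)
  then show ?thesis unfolding Q_def by (rule sat_null)
qed

lemma representative_unique:
  assumes "x \<notin> Q" "r \<in> L" "t \<in> L" "x + r \<in> R" "x + t \<in> R"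
  shows "r = t"
proof (rule ccontr)
  assume "r \<noteq> t"
  \<comment> \<open>The point \<open>x\<close> lies in the translate of \<open>R\<close> by
    \<open>- r\<close> exactly when \<open>x + r\<close> lies in \<open>R\<close>, hence the
    signs.\<close>
  then have "- r \<in> L" "- t \<in> L - {- r}" using assms L_uminus by auto
  moreover have "x \<in> (\<lambda>x. x + - r) ` R \<inter> (\<lambda>x. x + - t) ` R"
    using assms by (simp only: translate_eq_vimage) simp
  ultimately have "x \<in> (\<Union>r\<in>L. \<Union>t\<in>L - {r}. (\<lambda>x. x + r) ` R \<inter> (\<lambda>x. x + t) ` R)" by blast
  then have "x \<in> Q" unfolding Q_def by (rule sat_superset[THEN subsetD])
  with assms(1) show False by simp
qed

text \<open>The ratio of the two measures is the almost everywhere value of \<open>hits R\<close>;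
  at a point outside \<open>Q\<close> the count is \<open>1\<close>.\<close>

lemma emeasure_R_eq_F: "emeasure \<Lambda> R = emeasure \<Lambda> F"
proof -
  have "AE x in \<Lambda>. hits R x = emeasure \<Lambda> R / emeasure \<Lambda> F \<and> x \<notin> Q"
    using AE_hits_R AE_not_in[OF Q_null] by eventually_elim simp
  then obtain x where x: "x \<in> P" "hits R x = emeasure \<Lambda> R / emeasure \<Lambda> F" "x \<notin> Q"
    using AE_\<Lambda>_imp_ex by blast
  obtain t where t: "t \<in> L" "x + t \<in> R" using cover[OF x(1)] by blast
  have "{r \<in> L. x + r \<in> R} = {t}"
    using representative_unique[OF x(3) _ t(1) _ t(2)] t by blast
  then have "emeasure \<Lambda> R / emeasure \<Lambda> F = 1"
    using x(2) t(1) by (simp add: hits_eq_emeasure)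
  then have "emeasure \<Lambda> R / emeasure \<Lambda> F * emeasure \<Lambda> F = emeasure \<Lambda> F" by simp
  then show ?thesis
    using emeasure_F by (simp add: ennreal_divide_times less_top)
qed

text \<open>The indicator of \<open>R \<inter> A\<close> is at most its periodization, whose
  integral is known for every invariant \<open>M\<close> and equals the \<open>\<nu>\<close>-measure
  of \<open>A\<close> because \<open>R\<close> and \<open>F\<close> have equal measure. An
  inequality between probabilities is an equality.\<close>

lemma distr_g_unique:
  assumes M: "invariant_borel_probability (subshift u) word_shift M"
  shows "distr M \<Lambda> position = \<nu>"
proof -
  have sets_M: "sets M = sets Y" and prob_M: "prob_space M"
    using M by (auto simp: invariant_borel_probability_def)
  have space_M: "space M = X" using sets_eq_imp_space_eq[OF sets_M] by (simp add: space_borel_of)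
  have gM: "position \<in> measurable M \<Lambda>" using position_measurable measurable_cong_sets[OF sets_M refl] by blast
  show ?thesis
  proof (rule prob_measure_eqI_le)
    show "prob_space (distr M \<Lambda> position)" by (rule prob_space.prob_space_distr[OF prob_M gM])
    show "prob_space \<nu>" by (rule prob_\<nu>)
    show "sets (distr M \<Lambda> position) = sets \<nu>" by simp
    fix A assume "A \<in> sets (distr M \<Lambda> position)"
    then have A: "A \<in> sets \<Lambda>" by simp
    have RA: "R \<inter> A \<in> sets \<Lambda>" using R_sets A by (rule sets.Int)
    have "emeasure (distr M \<Lambda> position) A = emeasure M (position -` A \<inter> space M)"
      using gM A by (rule emeasure_distr)
    also have "position -` A \<inter> space M = position -` (R \<inter> A) \<inter> space M"
      using position_in_R by (auto simp: space_M)
    also have "emeasure M (position -` (R \<inter> A) \<inter> space M) = emeasure (distr M \<Lambda> position) (R \<inter> A)"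
      using gM RA by (rule emeasure_distr[symmetric])
    also have "\<dots> = (\<integral>\<^sup>+x. indicator (R \<inter> A) x \<partial>distr M \<Lambda> position)"
      using RA by simp
    also have "\<dots> \<le> (\<integral>\<^sup>+x. hits (R \<inter> A) x \<partial>distr M \<Lambda> position)"
      using hits_ge_1[OF L_0] by (intro nn_integral_mono) (simp add: indicator_def)
    also have "\<dots> = emeasure \<Lambda> (R \<inter> A) / emeasure \<Lambda> F"
      using M RA by (rule nn_integral_hits_invariant)
    also have "\<dots> = emeasure \<nu> A"
      using A R_sets by (simp add: emeasure_R_eq_F)
    finally show "emeasure (distr M \<Lambda> position) A \<le> emeasure \<nu> A" .
  qed
qed

text \<open>The image \<open>\<nu>\<close> of \<open>M\<close> does not charge \<open>Z\<close>, so
  \<open>coding\<close> inverts \<open>position\<close> almost everywhere for \<open>M\<close> and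
  recovers \<open>M\<close> from \<open>\<nu>\<close>.\<close>

lemma uniquely_ergodic_\<mu>: "uniquely_ergodic (subshift u) word_shift \<mu>"
  unfolding uniquely_ergodic_def
proof (intro conjI allI impI invariant_\<mu>)
  fix M assume M: "invariant_borel_probability (subshift u) word_shift M"
  then have sets_M: "sets M = sets Y" by (simp add: invariant_borel_probability_def)
  have space_M: "space M = X" using sets_eq_imp_space_eq[OF sets_M] by (simp add: space_borel_of)
  have gM: "position \<in> measurable M \<Lambda>" using position_measurable measurable_cong_sets[OF sets_M refl] by blast
  have "AE x in distr M \<Lambda> position. x \<notin> Z"
    unfolding distr_g_unique[OF M] using AE_\<nu> by eventually_elim simp
  then have "AE y in M. position y \<notin> Z"
    using AE_distrD[OF gM, of "\<lambda>x. x \<notin> Z"] by simp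
  then have AE: "AE y in M. (coding \<circ> position) y = y"
    using AE_space by eventually_elim (simp add: coding_position space_M)
  have "\<mu> = distr (distr M \<Lambda> position) Y coding"
    by (simp add: \<mu>_def distr_g_unique[OF M])
  also have "\<dots> = distr M Y (coding \<circ> position)"
    using coding_measurable gM by (rule distr_distr)
  also have "\<dots> = distr M Y (\<lambda>y. y)"
  proof (rule distr_cong_AE[OF refl refl AE])
    show "coding \<circ> position \<in> measurable M Y" using gM coding_measurable by (rule measurable_comp)
    show "(\<lambda>y. y) \<in> measurable M Y" using sets_M by (simp add: measurable_ident_sets)
  qed
  also have "\<dots> = M" using sets_M by (intro distr_id2) simp
  finally show "M = \<mu>" ..
qed

section \<open>Isomorphisms between conull invariant sets\<close>

definition G :: "(real ^ 'a) set" where "G = R - (Z \<union> Q)"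

lemma G_sets: "G \<in> sets \<Lambda>" and G_sub: "G \<subseteq> R"
  unfolding G_def using R_sets Z_null Q_null by auto

text \<open>Both exceptional sets are saturated, so no translation used by the dynamics leads into
  them.\<close>

lemma G_step: "x \<in> G \<Longrightarrow> x \<in> piece a \<Longrightarrow> x + \<pi> (unit_vec a) \<in> G"
  using piece_translate sat_translate_unit unfolding G_def Z_def Q_def by auto

abbreviation "XG \<equiv> position -` G \<inter> X"

lemma XG_shift: "word_shift ` XG \<subseteq> XG"
  using G_step position_in_piece position(2) shift_in_subshift by auto

lemma XG_sets: "XG \<in> sets \<mu>"
  using measurable_sets[OF position_measurable G_sets] by (simp add: sets_\<mu> space_borel_of)

lemma G_conull: "R - G \<in> null_sets \<Lambda>"
proof -
  have "Z \<union> Q \<in> null_sets \<Lambda>" using Z_null Q_null by (rule null_sets.Un)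
  moreover have "R - G \<in> sets \<Lambda>" using R_sets G_sets by (rule sets.Diff)
  ultimately show ?thesis by (rule null_sets_subset) (auto simp: G_def)
qed

lemma XG_conull: "space \<mu> - XG \<in> null_sets \<mu>"
proof -
  have m: "space \<mu> - XG \<in> sets \<mu>" using XG_sets by (rule sets.compl_sets)
  have "AE x in distr \<mu> \<Lambda> position. x \<in> G"
    unfolding distr_\<mu>_position using AE_not_in[OF G_conull] R_sets
    by (intro AE_uniform_measureI) auto
  then have "AE y in \<mu>. position y \<in> G"
    using AE_distrD[OF position_measurable_\<mu>, of "\<lambda>x. x \<in> G"] by simp
  then have "AE y in \<mu>. y \<notin> space \<mu> - XG"
    using AE_space by eventually_elim (simp add: space_\<mu>)
  then show ?thesis using AE_iff_null_sets[OF m] by simp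
qed

lemma inj_on_position: "inj_on position XG"
  using position_inj unfolding inj_on_def G_def by blast

lemma position_XG: "position ` XG = G"
proof (intro antisym subsetI)
  fix x assume x: "x \<in> G"
  then have "x \<in> position ` X" using G_sub unfolding position_X by blast
  then show "x \<in> position ` XG" using x by blast
qed auto

text \<open>On \<open>XG\<close> the map \<open>coding\<close> inverts \<open>position\<close>, so a
  direct image under \<open>position\<close> is a preimage under \<open>coding\<close>, cut down to
  \<open>G\<close>.\<close>

lemma position_image_sets:
  assumes "V \<in> sets \<mu>" "V \<subseteq> XG"
  shows "position ` V \<in> sets \<Lambda>"
proof -
  have "position ` V = (coding -` V \<inter> P) \<inter> G"
  proof (intro antisym subsetI)
    fix x assume "x \<in> position ` V"
    then obtain y where y: "y \<in> V" "x = position y" by blast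
    then have "y \<in> X" "x \<in> G" using assms(2) by auto
    moreover from this have "coding x = y" using y(2) coding_position by (simp add: G_def)
    ultimately show "x \<in> (coding -` V \<inter> P) \<inter> G" using y G_sub R_sub by auto
  next
    fix x assume x: "x \<in> (coding -` V \<inter> P) \<inter> G"
    then have "x = position (coding x)" using position_coding by (simp add: G_def)
    then show "x \<in> position ` V" using x by blast
  qed
  also have "coding -` V \<inter> P \<in> sets \<Lambda>"
    using measurable_sets[OF coding_measurable, of V] assms(1) by (simp add: sets_\<mu>)
  then have "(coding -` V \<inter> P) \<inter> G \<in> sets \<Lambda>" using G_sets by (rule sets.Int)
  finally show ?thesis .
qed

lemma isomorphic_domain_exchange:
  "measurably_isomorphic \<mu> word_shift (normalized_lebesgue_on P R) (domain_exchange \<pi> u)"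
proof (rule measurably_isomorphicI)
  let ?N = "normalized_lebesgue_on P R"
  have N: "?N = restrict_space \<nu> R" by (simp add: normalized_lebesgue_on_def)
  have RN: "R \<inter> space \<nu> \<in> sets \<nu>" using R_sets R_sub by (simp add: Int_absorb2)
  have sets_N: "A \<in> sets ?N \<longleftrightarrow> A \<subseteq> R \<and> A \<in> sets \<Lambda>" for A
    using RN by (simp add: N sets_restrict_space_iff)
  have emeasure_N: "emeasure ?N A = emeasure \<nu> A" if "A \<subseteq> R" for A
    unfolding N using RN that by (rule emeasure_restrict_space)
  have space_N: "space ?N = R"
    using R_sub by (auto simp: N space_restrict_space)
  have gN: "position \<in> measurable \<mu> ?N"
    unfolding N
  proof (rule measurable_restrict_space2)
    show "position \<in> space \<mu> \<rightarrow> R" using position_in_R by (simp add: space_\<mu>)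
    show "position \<in> measurable \<mu> \<nu>" using position_measurable_\<mu> by (simp cong: measurable_cong_sets)
  qed
  have "distr \<mu> ?N position = ?N"
  proof (rule measure_eqI)
    fix A assume "A \<in> sets (distr \<mu> ?N position)"
    then have A: "A \<in> sets ?N" by simp
    then have A': "A \<subseteq> R" "A \<in> sets \<Lambda>" by (auto simp: sets_N)
    have "emeasure (distr \<mu> ?N position) A = emeasure \<mu> (position -` A \<inter> space \<mu>)"
      using gN A by (rule emeasure_distr)
    also have "\<dots> = emeasure (distr \<mu> \<Lambda> position) A"
      using position_measurable_\<mu> A'(2) by (rule emeasure_distr[symmetric])
    finally show "emeasure (distr \<mu> ?N position) A = emeasure ?N A"
      using A' by (simp add: distr_\<mu>_position emeasure_N)
  qed simp
  then show "measure_preserving \<mu> ?N position" using gN by (simp add: measure_preserving_def)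
  show "XG \<in> sets \<mu>" by (rule XG_sets)
  show "space \<mu> - XG \<in> null_sets \<mu>" by (rule XG_conull)
  show "word_shift ` XG \<subseteq> XG" by (rule XG_shift)
  show "G \<in> sets ?N" using G_sets G_sub by (simp add: sets_N)
  show "space ?N - G \<in> null_sets ?N"
  proof (rule null_setsI)
    have RG: "R - G \<in> sets \<Lambda>" using R_sets G_sets by (rule sets.Diff)
    have "emeasure \<Lambda> (R \<inter> (R - G)) = 0"
      using null_setsD1[OF G_conull] by (simp add: Int_absorb1)
    then show "emeasure ?N (space ?N - G) = 0"
      using RG R_sets by (simp add: space_N emeasure_N)
    show "space ?N - G \<in> sets ?N" using RG by (simp add: space_N sets_N)
  qed
  \<comment> \<open>A point of \<open>G\<close> lies in a single piece, so the \<open>else\<close>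
    branch of \<open>domain_exchange\<close> is never taken.\<close>
  have exchange: "domain_exchange \<pi> u x = x + \<pi> (unit_vec a)" if "x \<in> G" "x \<in> piece a" for x a
  proof -
    have "b = a" if b: "x \<in> piece b" for b
      using piece_unique[OF b \<open>x \<in> piece a\<close>] \<open>x \<in> G\<close> by (simp add: G_def)
    then have "\<exists>!a. x \<in> piece a" "(THE a. x \<in> piece a) = a" using \<open>x \<in> piece a\<close> by blast+
    then show ?thesis by (simp add: domain_exchange_def)
  qed
  show "domain_exchange \<pi> u ` G \<subseteq> G"
  proof
    fix y assume "y \<in> domain_exchange \<pi> u ` G"
    then obtain x where x: "x \<in> G" "y = domain_exchange \<pi> u x" by blast
    then obtain a where a: "x \<in> piece a" using G_sub in_R_iff by blast
    show "y \<in> G" using exchange[OF x(1) a] G_step[OF x(1) a] x(2) by simp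
  qed
  show "bij_betw position XG G" using inj_on_position position_XG by (simp add: bij_betw_def)
  show "position ` V \<in> sets ?N" if "V \<in> sets \<mu>" "V \<subseteq> XG" for V
    using position_image_sets[OF that] that(2) position_in_R by (auto simp: sets_N)
  show "position (word_shift x) = domain_exchange \<pi> u (position x)" if "x \<in> XG" for x
    using that exchange[of "position x" "x 0"] position_in_piece[of x] position(2)[of x] by simp
qed

text \<open>The conull set \<open>XG\<close> serves again: off \<open>Q\<close> a coset meets
  \<open>R\<close> at most once, so following \<open>position\<close> by the quotient map stays
  injective.\<close>

lemma isomorphic_torus: "measurably_isomorphic \<mu> word_shift (torus_lebesgue P L) T"
proof (rule measurably_isomorphicI)
  let ?N = "torus_lebesgue P L"
  show "measure_preserving \<mu> ?N \<phi>" using invariant_\<mu> by (rule measure_preserving_\<phi>)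
  show "XG \<in> sets \<mu>" by (rule XG_sets)
  show "space \<mu> - XG \<in> null_sets \<mu>" by (rule XG_conull)
  show "word_shift ` XG \<subseteq> XG" by (rule XG_shift)
  have image: "\<phi> ` V = coset L ` position ` V" for V
    unfolding \<phi>_def image_image ..
  have img: "\<phi> ` V \<in> sets ?N" if "V \<in> sets \<mu>" "V \<subseteq> XG" for V
    unfolding image sets_torus_lebesgue using position_image_sets[OF that] by (rule coset_image_sets)
  then show "\<phi> ` V \<in> sets ?N" if "V \<in> sets \<mu>" "V \<subseteq> XG" for V
    using that by blast
  show GN: "coset L ` G \<in> sets ?N"
    unfolding sets_torus_lebesgue using G_sets by (rule coset_image_sets)
  have W: "(Z \<union> Q) \<inter> P \<in> null_sets \<Lambda>"
    using null_sets.Un[OF Z_null Q_null] sets.top[of \<Lambda>] by (intro null_set_Int2) auto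
  have W_inv: "x + t \<in> (Z \<union> Q) \<inter> P" if "x \<in> (Z \<union> Q) \<inter> P" "t \<in> L" for x t
    using that sat_translate_L[OF that(2)] P_add[OF _ L_P[OF that(2)], of x]
    unfolding Z_def Q_def by auto
  \<comment> \<open>By \<open>cover\<close> a coset missing \<open>G\<close> still meets
    \<open>R\<close>, necessarily in \<open>Z\<close> or \<open>Q\<close>; saturation carries this
    to every representative.\<close>
  have "space ?N - coset L ` G \<subseteq> coset L ` ((Z \<union> Q) \<inter> P)"
  proof
    fix c assume "c \<in> space ?N - coset L ` G"
    then obtain x where x: "x \<in> P" "c = coset L x" "c \<notin> coset L ` G"
      by (auto simp: space_torus_lebesgue)
    obtain t where t: "t \<in> L" "x + t \<in> R" using cover[OF x(1)] by blast
    then have "x + t \<notin> G" using x(3) unfolding x(2) coset_image_iff by blast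
    then have "x + t \<in> Z \<union> Q" using t(2) by (simp add: G_def)
    then have "x \<in> Z \<union> Q" using sat_translate_L[OF t(1)] unfolding Z_def Q_def by auto
    then show "c \<in> coset L ` ((Z \<union> Q) \<inter> P)" using x(1,2) by blast
  qed
  moreover have "space ?N - coset L ` G \<in> sets ?N" using GN by (rule sets.compl_sets)
  ultimately show "space ?N - coset L ` G \<in> null_sets ?N"
    using coset_null_sets[OF W W_inv] null_sets_subset by blast
  show "T ` coset L ` G \<subseteq> coset L ` G"
  proof
    fix c assume "c \<in> T ` coset L ` G"
    then obtain x where x: "x \<in> G" "c = T (coset L x)" by blast
    then obtain a where "x \<in> piece a" using G_sub in_R_iff by blast
    then have "x + \<pi> (unit_vec a) \<in> G" using x(1) G_step by blast
    then show "c \<in> coset L ` G" unfolding x(2) T_coset[of x a] by blast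
  qed
  have "inj_on (coset L) G"
  proof (rule inj_onI)
    fix x y assume xy: "x \<in> G" "y \<in> G" "coset L x = coset L y"
    then have "y - x \<in> L" using L_uminus[of "x - y"] by (simp add: coset_eq_iff)
    \<comment> \<open>The lattice vectors \<open>0\<close> and \<open>y - x\<close> both carry
      \<open>x\<close> into \<open>R\<close>.\<close>
    then have "0 = y - x"
      using xy L_0 by (intro representative_unique[of x]) (auto simp: G_def)
    then show "x = y" by simp
  qed
  then have "inj_on (coset L \<circ> position) XG"
    using inj_on_position position_XG by (intro comp_inj_on) simp_all
  then show "bij_betw \<phi> XG (coset L ` G)"
    using image[of XG] position_XG by (simp add: bij_betw_def \<phi>_def[abs_def] comp_def)
  show "\<phi> (word_shift x) = T (\<phi> x)" if "x \<in> XG" for x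
    using that by (intro \<phi>_shift) simp
qed

end

theorem theorem2p3:
  fixes u :: "nat \<Rightarrow> 'a::finite"
    and \<pi> :: "real ^ 'a \<Rightarrow> real ^ 'a"
    and P :: "(real ^ 'a) set"
  defines "R \<equiv> closure (\<pi> ` discrete_line u)"
    and "L \<equiv> \<pi> ` Gamma0"
  assumes "projection_onto_hyperplane \<pi> P"
    and "closure (\<pi> ` integer_vectors) = P"
    and "bounded (\<pi> ` discrete_line u)"
    and "minimal_system (subshift u) word_shift"
    and "\<And>a. top_of_set P frontier_of closure (\<pi> ` discrete_line_letter u a)
               \<in> null_sets (lborel_subspace P)"
    and "disjoint_in_measure (lborel_subspace P) UNIV
           (\<lambda>a. closure (\<pi> ` discrete_line_letter u a))"
  shows "\<exists>T. (\<forall>a. \<forall>x\<in>P. T (coset L x) = coset L (x + \<pi> (unit_vec a))) \<and>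
    (\<exists>\<mu>. invariant_borel_probability (subshift u) word_shift \<mu> \<and>
       (\<exists>\<phi>. finite_extension_map \<mu> word_shift (torus_lebesgue P L) T \<phi> \<and>
            semi_conjugacy (subshift u) word_shift (torus P L) T \<phi>) \<and>
       (\<Union>t\<in>L. (\<lambda>x. x + t) ` R) = P \<and>
       (disjoint_in_measure (lborel_subspace P) L (\<lambda>t. (\<lambda>x. x + t) ` R) \<longrightarrow>
          uniquely_ergodic (subshift u) word_shift \<mu> \<and>
          measurably_isomorphic \<mu> word_shift (torus_lebesgue P L) T \<and>
          measurably_isomorphic \<mu> word_shift (normalized_lebesgue_on P R) (domain_exchange \<pi> u)))"
proof -
  interpret bounded_discrete_line \<pi> P u
    using assms(3-6,8) by unfold_locales
  \<comment> \<open>The tiling assumption enters through a local interpretation, so \<open>T\<close>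
    and \<open>\<mu>\<close> remain those constructed without it, as the order of quantifiers in the
    goal requires.\<close>
  have "uniquely_ergodic (subshift u) word_shift \<mu> \<and>
      measurably_isomorphic \<mu> word_shift (torus_lebesgue P L) T \<and>
      measurably_isomorphic \<mu> word_shift (normalized_lebesgue_on P R) (domain_exchange \<pi> u)"
    if "disjoint_in_measure (lborel_subspace P) L (\<lambda>t. (\<lambda>x. x + t) ` R)"
  proof -
    interpret tiling_discrete_line \<pi> P u
      using that unfolding L_def R_def by unfold_locales
    show ?thesis
      unfolding L_def R_def
      using uniquely_ergodic_\<mu> isomorphic_torus isomorphic_domain_exchange by blast
  qed
  then show ?thesis
    unfolding L_def R_def
    using T_coset invariant_\<mu> finite_extension_\<phi> semi_conjugacy_\<phi> union_translates
    by (intro exI[of _ T] exI[of _ \<mu>] exI[of _ \<phi>] conjI) simp_all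
qed

end
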